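(* Let $(H,\mathcal{R})$ be a quasi-triangular Hopf algebra over $K$ with R-matrix $\mathcal{R}=\sum_i s_i\otimes t_i\in H\otimes H$, and let $(C,\Delta_C)$ be a (left) module-coalgebra over $H$. Let $\sigma_C: C\otimes C\to C\otimes C$ be given by $\sigma_C(x\otimes y)=\sum_i t_i\cdot y\otimes s_i\cdot x$. Then $(C,\Delta_C,\sigma_C)$ is a braided coalgebra.
   Context: $K$ is a field of characteristic $0$. Coalgebras are coassociative and counital. Quasi-triangular: $\mathcal{R}$ is invertible, $\Delta^{op}(h)\mathcal{R}=\mathcal{R}\Delta(h)$ for all $h\in H$, $(\Delta\otimes\mathrm{id})(\mathcal{R})=\mathcal{R}_{13}\mathcal{R}_{23}$ and $(\mathrm{id}\otimes\Delta)(\mathcal{R})=\mathcal{R}_{13}\mathcal{R}_{12}$. A coalgebra $C$ with counit $\varepsilon_C$ is a module-coalgebra over $H$ if $C$ is a left $H$-module with $\Delta_C(h\cdot c)=\sum h_{(1)}\cdot c_{(1)}\otimes h_{(2)}\cdot c_{(2)}$ and $\varepsilon_C(h\cdot c)=\varepsilon(h)\varepsilon_C(c)$. (The map $\sigma_C$ is the braiding $c_{C,C}(x\otimes y)=\sum x_{(-1)}\cdot y\otimes x_{(0)}$ of the Yetter-Drinfel'd module $C$ with coaction $\rho(x)=\sum_i t_i\otimes s_i\cdot x$.) A braiding on a vector space $V$ is an invertible linear map $\sigma\in\mathrm{End}(V\otimes V)$ with $\sigma_1\sigma_2\sigma_1=\sigma_2\sigma_1\sigma_2$ on $V^{\otimes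 3}$, where $\sigma_1=\sigma\otimes\mathrm{id}_V$, $\sigma_2=\mathrm{id}_V\otimes\sigma$. A braided coalgebra $(C,\Delta_C,\sigma)$ is a coalgebra together with a braiding $\sigma$ on $C$ such that $\sigma_1\sigma_2(\Delta_C\otimes\mathrm{id}_C)=(\mathrm{id}_C\otimes\Delta_C)\sigma$, $\sigma_2\sigma_1(\mathrm{id}_C\otimes\Delta_C)=(\Delta_C\otimes\mathrm{id}_C)\sigma$, $(\mathrm{id}_C\otimes\varepsilon_C)\sigma=\varepsilon_C\otimes\mathrm{id}_C$ and $(\varepsilon_C\otimes\mathrm{id}_C)\sigma=\mathrm{id}_C\otimes\varepsilon_C$ (identifying $C\otimes K\cong C\cong K\otimes C$). *)

theory Defs
  imports "HOL-Algebra.Module" "HOL-Algebra.Free_Abelian_Groups"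
begin

section \<open>Linear and bilinear maps\<close>

definition linear_map ::
  "('k, 'm) ring_scheme \<Rightarrow> ('k, 'v, 'p) module_scheme \<Rightarrow> ('k, 'w, 'q) module_scheme \<Rightarrow> ('v \<Rightarrow> 'w) \<Rightarrow> bool"
  where "linear_map K V W f \<longleftrightarrow>
    f \<in> carrier V \<rightarrow> carrier W \<and>
    (\<forall>x\<in>carrier V. \<forall>y\<in>carrier V. f (x \<oplus>\<^bsub>V\<^esub> y) = f x \<oplus>\<^bsub>W\<^esub> f y) \<and>
    (\<forall>a\<in>carrier K. \<forall>x\<in>carrier V. f (a \<odot>\<^bsub>V\<^esub> x) = a \<odot>\<^bsub>W\<^esub> f x)"

definition bilinear_map ::
  "('k, 'm) ring_scheme \<Rightarrow> ('k, 'v, 'p) module_scheme \<Rightarrow> ('k, 'w, 'q) module_scheme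
    \<Rightarrow> ('k, 'u, 'r) module_scheme \<Rightarrow> ('v \<Rightarrow> 'w \<Rightarrow> 'u) \<Rightarrow> bool"
  where "bilinear_map K V W U f \<longleftrightarrow>
    (\<forall>w\<in>carrier W. linear_map K V U (\<lambda>v. f v w)) \<and>
    (\<forall>v\<in>carrier V. linear_map K W U (f v))"

definition scalars :: "('k, 'm) ring_scheme \<Rightarrow> ('k, 'k) module"
  where "scalars K =
    \<lparr>carrier = carrier K, mult = (\<otimes>\<^bsub>K\<^esub>), one = \<one>\<^bsub>K\<^esub>, ring.zero = \<zero>\<^bsub>K\<^esub>, add = (\<oplus>\<^bsub>K\<^esub>), smult = (\<otimes>\<^bsub>K\<^esub>)\<rparr>"


section \<open>Tensor products\<close>

text \<open>
  The tensor product of \<open>V\<close> and \<open>W\<close> over \<open>K\<close> is the free abelian group on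
  \<open>carrier V \<times> carrier W\<close> modulo the subgroup generated by the usual relations; its elements
  are cosets of formal sums.
\<close>

definition tensor_relations ::
  "('k, 'm) ring_scheme \<Rightarrow> ('k, 'v, 'p) module_scheme \<Rightarrow> ('k, 'w, 'q) module_scheme
    \<Rightarrow> ('v \<times> 'w \<Rightarrow>\<^sub>0 int) set"
  where "tensor_relations K V W =
    {frag_of (v \<oplus>\<^bsub>V\<^esub> v', w) - frag_of (v, w) - frag_of (v', w) | v v' w.
       v \<in> carrier V \<and> v' \<in> carrier V \<and> w \<in> carrier W} \<union>
    {frag_of (v, w \<oplus>\<^bsub>W\<^esub> w') - frag_of (v, w) - frag_of (v, w') | v w w'.
       v \<in> carrier V \<and> w \<in> carrier W \<and> w' \<in> carrier W} \<union>
    {frag_of (a \<odot>\<^bsub>V\<^esub> v, w) - frag_of (v, a \<odot>\<^bsub>W\<^esub> w) | a v w.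
       a \<in> carrier K \<and> v \<in> carrier V \<and> w \<in> carrier W}"

definition tensor_kernel ::
  "('k, 'm) ring_scheme \<Rightarrow> ('k, 'v, 'p) module_scheme \<Rightarrow> ('k, 'w, 'q) module_scheme
    \<Rightarrow> ('v \<times> 'w \<Rightarrow>\<^sub>0 int) set"
  where "tensor_kernel K V W =
    generate (free_Abelian_group (carrier V \<times> carrier W)) (tensor_relations K V W)"

definition tensor_class ::
  "('k, 'm) ring_scheme \<Rightarrow> ('k, 'v, 'p) module_scheme \<Rightarrow> ('k, 'w, 'q) module_scheme
    \<Rightarrow> ('v \<times> 'w \<Rightarrow>\<^sub>0 int) \<Rightarrow> ('v \<times> 'w \<Rightarrow>\<^sub>0 int) set"
  where "tensor_class K V W x =
    tensor_kernel K V W #>\<^bsub>free_Abelian_group (carrier V \<times> carrier W)\<^esub> x"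

definition pure_tensor ::
  "('k, 'm) ring_scheme \<Rightarrow> ('k, 'v, 'p) module_scheme \<Rightarrow> ('k, 'w, 'q) module_scheme
    \<Rightarrow> 'v \<Rightarrow> 'w \<Rightarrow> ('v \<times> 'w \<Rightarrow>\<^sub>0 int) set"
  where "pure_tensor K V W v w = tensor_class K V W (frag_of (v, w))"

text \<open>
  The scalar multiplication is induced by \<open>(v, w) \<mapsto> (a \<odot> v, w)\<close>.
  The fields \<open>mult\<close> and \<open>one\<close> describe the tensor product of algebras,
  \<open>(v \<otimes> w)(v' \<otimes> w') = vv' \<otimes> ww'\<close>; they are meaningful only if \<open>V\<close> and \<open>W\<close>
  are algebras, and are never used otherwise.  A union over the representatives of a class
  stands for the value taken on any one of them.
\<close>

definition tensor ::
  "('k, 'm) ring_scheme \<Rightarrow> ('k, 'v, 'p) module_scheme \<Rightarrow> ('k, 'w, 'q) module_scheme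
    \<Rightarrow> ('k, ('v \<times> 'w \<Rightarrow>\<^sub>0 int) set) module"
  where "tensor K V W =
    (let T = free_Abelian_group (carrier V \<times> carrier W) Mod tensor_kernel K V W in
     \<lparr>carrier = carrier T,
      mult = (\<lambda>X Y. \<Union>x\<in>X. \<Union>y\<in>Y. tensor_class K V W
         (frag_extend (\<lambda>(v, w). frag_extend (\<lambda>(v', w').
            frag_of (v \<otimes>\<^bsub>V\<^esub> v', w \<otimes>\<^bsub>W\<^esub> w')) y) x)),
      one = pure_tensor K V W \<one>\<^bsub>V\<^esub> \<one>\<^bsub>W\<^esub>,
      ring.zero = \<one>\<^bsub>T\<^esub>,
      add = (\<otimes>\<^bsub>T\<^esub>),
      smult = (\<lambda>a X. \<Union>x\<in>X. tensor_class K V W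
         (frag_extend (\<lambda>(v, w). frag_of (a \<odot>\<^bsub>V\<^esub> v, w)) x))\<rparr>)"

text \<open>
  For a bilinear \<open>f\<close> into \<open>U\<close>, \<open>tensor_lift U f\<close> is the linear map sending
  \<open>v \<otimes> w\<close> to \<open>f v w\<close>.  In particular \<open>tensor_lift U f (\<Delta> x)\<close> is the Sweedler sum of
  the \<open>f x\<^sub>(\<^sub>1\<^sub>) x\<^sub>(\<^sub>2\<^sub>)\<close>.
\<close>

definition tensor_lift ::
  "('u, 'r) ring_scheme \<Rightarrow> ('v \<Rightarrow> 'w \<Rightarrow> 'u) \<Rightarrow> ('v \<times> 'w \<Rightarrow>\<^sub>0 int) set \<Rightarrow> 'u"
  where "tensor_lift U f X =
    the_elem ((\<lambda>x. \<Oplus>\<^bsub>U\<^esub>p\<in>Poly_Mapping.keys x.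
                  [Poly_Mapping.lookup x p] \<cdot>\<^bsub>U\<^esub> f (fst p) (snd p)) ` X)"

definition tensor_map ::
  "('k, 'm) ring_scheme \<Rightarrow> ('k, 'v, 'p) module_scheme \<Rightarrow> ('k, 'w, 'q) module_scheme
    \<Rightarrow> ('a \<Rightarrow> 'v) \<Rightarrow> ('b \<Rightarrow> 'w) \<Rightarrow> ('a \<times> 'b \<Rightarrow>\<^sub>0 int) set \<Rightarrow> ('v \<times> 'w \<Rightarrow>\<^sub>0 int) set"
  where \<comment> \<open>\<open>f \<otimes> g\<close>; the modules \<open>V\<close>, \<open>W\<close> are the codomains of \<open>f\<close>, \<open>g\<close>\<close>
    "tensor_map K V W f g = tensor_lift (tensor K V W) (\<lambda>a b. pure_tensor K V W (f a) (g b))"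

definition tensor_flip ::
  "('k, 'm) ring_scheme \<Rightarrow> ('k, 'v, 'p) module_scheme \<Rightarrow> ('k, 'w, 'q) module_scheme
    \<Rightarrow> ('v \<times> 'w \<Rightarrow>\<^sub>0 int) set \<Rightarrow> ('w \<times> 'v \<Rightarrow>\<^sub>0 int) set"
  where "tensor_flip K V W = tensor_lift (tensor K W V) (\<lambda>v w. pure_tensor K W V w v)"

text \<open>
  Triple tensor powers are bracketed to the left, \<open>(V \<otimes> V) \<otimes> V\<close>, and the identification
  with \<open>V \<otimes> (V \<otimes> V)\<close> is made explicit.
\<close>

abbreviation "tensor2 K V \<equiv> tensor K V V"

abbreviation "tensor3 K V \<equiv> tensor K (tensor K V V) V"

definition pure_tensor3 ::
  "('k, 'm) ring_scheme \<Rightarrow> ('k, 'v, 'p) module_scheme \<Rightarrow> 'v \<Rightarrow> 'v \<Rightarrow> 'v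
    \<Rightarrow> (('v \<times> 'v \<Rightarrow>\<^sub>0 int) set \<times> 'v \<Rightarrow>\<^sub>0 int) set"
  where "pure_tensor3 K V x y z = pure_tensor K (tensor2 K V) V (pure_tensor K V V x y) z"

definition assoc_left ::
  "('k, 'm) ring_scheme \<Rightarrow> ('k, 'v, 'p) module_scheme
    \<Rightarrow> ('v \<times> ('v \<times> 'v \<Rightarrow>\<^sub>0 int) set \<Rightarrow>\<^sub>0 int) set \<Rightarrow> (('v \<times> 'v \<Rightarrow>\<^sub>0 int) set \<times> 'v \<Rightarrow>\<^sub>0 int) set"
  where \<comment> \<open>\<open>x \<otimes> (y \<otimes> z) \<mapsto> (x \<otimes> y) \<otimes> z\<close>\<close>
    "assoc_left K V = tensor_lift (tensor3 K V)
      (\<lambda>x. tensor_lift (tensor3 K V) (\<lambda>y z. pure_tensor3 K V x y z))"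

definition assoc_right ::
  "('k, 'm) ring_scheme \<Rightarrow> ('k, 'v, 'p) module_scheme
    \<Rightarrow> (('v \<times> 'v \<Rightarrow>\<^sub>0 int) set \<times> 'v \<Rightarrow>\<^sub>0 int) set \<Rightarrow> ('v \<times> ('v \<times> 'v \<Rightarrow>\<^sub>0 int) set \<Rightarrow>\<^sub>0 int) set"
  where \<comment> \<open>\<open>(x \<otimes> y) \<otimes> z \<mapsto> x \<otimes> (y \<otimes> z)\<close>\<close>
    "assoc_right K V = tensor_lift (tensor K V (tensor2 K V))
      (\<lambda>X z. tensor_lift (tensor K V (tensor2 K V))
        (\<lambda>x y. pure_tensor K V (tensor2 K V) x (pure_tensor K V V y z)) X)"

definition unit_left ::
  "('k, 'm) ring_scheme \<Rightarrow> ('k, 'v, 'p) module_scheme \<Rightarrow> ('k \<times> 'v \<Rightarrow>\<^sub>0 int) set \<Rightarrow> 'v"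
  where \<comment> \<open>the identification of \<open>K \<otimes> V\<close> with \<open>V\<close>\<close>
    "unit_left K V = tensor_lift V (\<lambda>a v. a \<odot>\<^bsub>V\<^esub> v)"

definition unit_right ::
  "('k, 'm) ring_scheme \<Rightarrow> ('k, 'v, 'p) module_scheme \<Rightarrow> ('v \<times> 'k \<Rightarrow>\<^sub>0 int) set \<Rightarrow> 'v"
  where \<comment> \<open>the identification of \<open>V \<otimes> K\<close> with \<open>V\<close>\<close>
    "unit_right K V = tensor_lift V (\<lambda>v a. a \<odot>\<^bsub>V\<^esub> v)"

text \<open>Maps on the tensor square acting on the left, resp. right, two factors of the tensor cube.\<close>

definition on_left ::
  "('k, 'm) ring_scheme \<Rightarrow> ('k, 'v, 'p) module_scheme
    \<Rightarrow> (('v \<times> 'v \<Rightarrow>\<^sub>0 int) set \<Rightarrow> ('v \<times> 'v \<Rightarrow>\<^sub>0 int) set)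
    \<Rightarrow> (('v \<times> 'v \<Rightarrow>\<^sub>0 int) set \<times> 'v \<Rightarrow>\<^sub>0 int) set \<Rightarrow> (('v \<times> 'v \<Rightarrow>\<^sub>0 int) set \<times> 'v \<Rightarrow>\<^sub>0 int) set"
  where "on_left K V \<sigma> = tensor_map K (tensor2 K V) V \<sigma> (\<lambda>z. z)"

definition on_right ::
  "('k, 'm) ring_scheme \<Rightarrow> ('k, 'v, 'p) module_scheme
    \<Rightarrow> (('v \<times> 'v \<Rightarrow>\<^sub>0 int) set \<Rightarrow> ('v \<times> 'v \<Rightarrow>\<^sub>0 int) set)
    \<Rightarrow> (('v \<times> 'v \<Rightarrow>\<^sub>0 int) set \<times> 'v \<Rightarrow>\<^sub>0 int) set \<Rightarrow> (('v \<times> 'v \<Rightarrow>\<^sub>0 int) set \<times> 'v \<Rightarrow>\<^sub>0 int) set"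
  where "on_right K V \<sigma> X =
    assoc_left K V (tensor_map K V (tensor2 K V) (\<lambda>x. x) \<sigma> (assoc_right K V X))"


section \<open>Coalgebras, bialgebras, Hopf algebras\<close>

definition comult_left ::
  "('k, 'm) ring_scheme \<Rightarrow> ('k, 'v, 'p) module_scheme \<Rightarrow> ('v \<Rightarrow> ('v \<times> 'v \<Rightarrow>\<^sub>0 int) set)
    \<Rightarrow> ('v \<times> 'v \<Rightarrow>\<^sub>0 int) set \<Rightarrow> (('v \<times> 'v \<Rightarrow>\<^sub>0 int) set \<times> 'v \<Rightarrow>\<^sub>0 int) set"
  where \<comment> \<open>\<open>\<Delta> \<otimes> id\<close>\<close>
    "comult_left K V \<Delta> = tensor_map K (tensor2 K V) V \<Delta> (\<lambda>x. x)"

definition comult_right ::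
  "('k, 'm) ring_scheme \<Rightarrow> ('k, 'v, 'p) module_scheme \<Rightarrow> ('v \<Rightarrow> ('v \<times> 'v \<Rightarrow>\<^sub>0 int) set)
    \<Rightarrow> ('v \<times> 'v \<Rightarrow>\<^sub>0 int) set \<Rightarrow> (('v \<times> 'v \<Rightarrow>\<^sub>0 int) set \<times> 'v \<Rightarrow>\<^sub>0 int) set"
  where \<comment> \<open>\<open>id \<otimes> \<Delta>\<close>\<close>
    "comult_right K V \<Delta> X = assoc_left K V (tensor_map K V (tensor2 K V) (\<lambda>x. x) \<Delta> X)"

definition counit_left ::
  "('k, 'm) ring_scheme \<Rightarrow> ('k, 'v, 'p) module_scheme \<Rightarrow> ('v \<Rightarrow> 'k) \<Rightarrow> ('v \<times> 'v \<Rightarrow>\<^sub>0 int) set \<Rightarrow> 'v"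
  where \<comment> \<open>\<open>\<epsilon> \<otimes> id\<close>\<close>
    "counit_left K V \<epsilon> X = unit_left K V (tensor_map K (scalars K) V \<epsilon> (\<lambda>x. x) X)"

definition counit_right ::
  "('k, 'm) ring_scheme \<Rightarrow> ('k, 'v, 'p) module_scheme \<Rightarrow> ('v \<Rightarrow> 'k) \<Rightarrow> ('v \<times> 'v \<Rightarrow>\<^sub>0 int) set \<Rightarrow> 'v"
  where \<comment> \<open>\<open>id \<otimes> \<epsilon>\<close>\<close>
    "counit_right K V \<epsilon> X = unit_right K V (tensor_map K V (scalars K) (\<lambda>x. x) \<epsilon> X)"

locale vector_space_over = K?: field K + V?: module K V for K and V

locale coalgebra = vector_space_over K C for K and C +
  fixes \<Delta> and \<epsilon>
  assumes comult_linear: "linear_map K C (tensor2 K C) \<Delta>"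
    and counit_linear: "linear_map K C (scalars K) \<epsilon>"
    and coassoc: "c \<in> carrier C \<Longrightarrow> comult_left K C \<Delta> (\<Delta> c) = comult_right K C \<Delta> (\<Delta> c)"
    and counit_l: "c \<in> carrier C \<Longrightarrow> counit_left K C \<epsilon> (\<Delta> c) = c"
    and counit_r: "c \<in> carrier C \<Longrightarrow> counit_right K C \<epsilon> (\<Delta> c) = c"

text \<open>The library locale \<open>algebra\<close> is restricted to commutative algebras.\<close>

locale assoc_algebra = vector_space_over K A + ring A for K and A +
  assumes smult_mult_left: "\<lbrakk>a \<in> carrier K; x \<in> carrier A; y \<in> carrier A\<rbrakk>
      \<Longrightarrow> (a \<odot>\<^bsub>A\<^esub> x) \<otimes>\<^bsub>A\<^esub> y = a \<odot>\<^bsub>A\<^esub> (x \<otimes>\<^bsub>A\<^esub> y)"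
    and smult_mult_right: "\<lbrakk>a \<in> carrier K; x \<in> carrier A; y \<in> carrier A\<rbrakk>
      \<Longrightarrow> x \<otimes>\<^bsub>A\<^esub> (a \<odot>\<^bsub>A\<^esub> y) = a \<odot>\<^bsub>A\<^esub> (x \<otimes>\<^bsub>A\<^esub> y)"

locale bialgebra = assoc_algebra K H + coalgebra K H \<Delta> \<epsilon> for K and H and \<Delta> and \<epsilon> +
  assumes comult_hom: "\<Delta> \<in> ring_hom H (tensor2 K H)"
    and counit_hom: "\<epsilon> \<in> ring_hom H K"

locale hopf_algebra = bialgebra K H \<Delta> \<epsilon> for K and H and \<Delta> and \<epsilon> +
  fixes S
  assumes antipode_linear: "linear_map K H H S"
    and antipode_l: "h \<in> carrier H \<Longrightarrow>
      tensor_lift H (\<lambda>x y. S x \<otimes>\<^bsub>H\<^esub> y) (\<Delta> h) = \<epsilon> h \<odot>\<^bsub>H\<^esub> \<one>\<^bsub>H\<^esub>"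
    and antipode_r: "h \<in> carrier H \<Longrightarrow>
      tensor_lift H (\<lambda>x y. x \<otimes>\<^bsub>H\<^esub> S y) (\<Delta> h) = \<epsilon> h \<odot>\<^bsub>H\<^esub> \<one>\<^bsub>H\<^esub>"


section \<open>Quasi-triangular Hopf algebras\<close>

definition leg12 ::
  "('k, 'm) ring_scheme \<Rightarrow> ('k, 'h, 'p) module_scheme
    \<Rightarrow> ('h \<times> 'h \<Rightarrow>\<^sub>0 int) set \<Rightarrow> (('h \<times> 'h \<Rightarrow>\<^sub>0 int) set \<times> 'h \<Rightarrow>\<^sub>0 int) set"
  where "leg12 K H = tensor_lift (tensor3 K H) (\<lambda>s t. pure_tensor3 K H s t \<one>\<^bsub>H\<^esub>)"

definition leg13 ::
  "('k, 'm) ring_scheme \<Rightarrow> ('k, 'h, 'p) module_scheme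
    \<Rightarrow> ('h \<times> 'h \<Rightarrow>\<^sub>0 int) set \<Rightarrow> (('h \<times> 'h \<Rightarrow>\<^sub>0 int) set \<times> 'h \<Rightarrow>\<^sub>0 int) set"
  where "leg13 K H = tensor_lift (tensor3 K H) (\<lambda>s t. pure_tensor3 K H s \<one>\<^bsub>H\<^esub> t)"

definition leg23 ::
  "('k, 'm) ring_scheme \<Rightarrow> ('k, 'h, 'p) module_scheme
    \<Rightarrow> ('h \<times> 'h \<Rightarrow>\<^sub>0 int) set \<Rightarrow> (('h \<times> 'h \<Rightarrow>\<^sub>0 int) set \<times> 'h \<Rightarrow>\<^sub>0 int) set"
  where "leg23 K H = tensor_lift (tensor3 K H) (\<lambda>s t. pure_tensor3 K H \<one>\<^bsub>H\<^esub> s t)"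

locale quasitriangular_hopf_algebra = hopf_algebra K H \<Delta> \<epsilon> S
    for K and H and \<Delta> and \<epsilon> and S +
  fixes R
  assumes R_invertible: "R \<in> Units (tensor2 K H)"
    and R_op_comult: "h \<in> carrier H \<Longrightarrow>
      tensor_flip K H H (\<Delta> h) \<otimes>\<^bsub>tensor2 K H\<^esub> R = R \<otimes>\<^bsub>tensor2 K H\<^esub> \<Delta> h"
    and R_comult_left: "comult_left K H \<Delta> R = leg13 K H R \<otimes>\<^bsub>tensor3 K H\<^esub> leg23 K H R"
    and R_comult_right: "comult_right K H \<Delta> R = leg13 K H R \<otimes>\<^bsub>tensor3 K H\<^esub> leg12 K H R"


section \<open>Module-coalgebras\<close>

locale left_module = assoc_algebra K H + vector_space_over K C for K and H and C +
  fixes act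
  assumes act_bilinear: "bilinear_map K H C C act"
    and act_mult: "\<lbrakk>h \<in> carrier H; h' \<in> carrier H; c \<in> carrier C\<rbrakk>
      \<Longrightarrow> act (h \<otimes>\<^bsub>H\<^esub> h') c = act h (act h' c)"
    and act_one: "c \<in> carrier C \<Longrightarrow> act \<one>\<^bsub>H\<^esub> c = c"

locale module_coalgebra =
    H: bialgebra K H \<Delta>\<^sub>H \<epsilon>\<^sub>H + C: coalgebra K C \<Delta>\<^sub>C \<epsilon>\<^sub>C + left_module K H C act
    for K and H and \<Delta>\<^sub>H and \<epsilon>\<^sub>H and C and \<Delta>\<^sub>C and \<epsilon>\<^sub>C and act +
  assumes comult_act: "\<lbrakk>h \<in> carrier H; c \<in> carrier C\<rbrakk> \<Longrightarrow>
      \<Delta>\<^sub>C (act h c) =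
        tensor_lift (tensor2 K C) (\<lambda>h1 h2.
          tensor_lift (tensor2 K C) (\<lambda>c1 c2. pure_tensor K C C (act h1 c1) (act h2 c2)) (\<Delta>\<^sub>C c))
          (\<Delta>\<^sub>H h)"
    and counit_act: "\<lbrakk>h \<in> carrier H; c \<in> carrier C\<rbrakk> \<Longrightarrow>
      \<epsilon>\<^sub>C (act h c) = \<epsilon>\<^sub>H h \<otimes>\<^bsub>K\<^esub> \<epsilon>\<^sub>C c"


section \<open>Braidings and braided coalgebras\<close>

locale braiding = vector_space_over K V for K and V +
  fixes \<sigma>
  assumes braiding_linear: "linear_map K (tensor2 K V) (tensor2 K V) \<sigma>"
    and braiding_invertible: "bij_betw \<sigma> (carrier (tensor2 K V)) (carrier (tensor2 K V))"
    and braid_relation: "X \<in> carrier (tensor3 K V) \<Longrightarrow>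
      on_left K V \<sigma> (on_right K V \<sigma> (on_left K V \<sigma> X)) =
      on_right K V \<sigma> (on_left K V \<sigma> (on_right K V \<sigma> X))"

locale braided_coalgebra = coalgebra K C \<Delta> \<epsilon> + braiding K C \<sigma>
    for K and C and \<Delta> and \<epsilon> and \<sigma> +
  assumes comult_left_braid: "X \<in> carrier (tensor2 K C) \<Longrightarrow>
      on_left K C \<sigma> (on_right K C \<sigma> (comult_left K C \<Delta> X)) = comult_right K C \<Delta> (\<sigma> X)"
    and comult_right_braid: "X \<in> carrier (tensor2 K C) \<Longrightarrow>
      on_right K C \<sigma> (on_left K C \<sigma> (comult_right K C \<Delta> X)) = comult_left K C \<Delta> (\<sigma> X)"
    and counit_right_braid: "X \<in> carrier (tensor2 K C) \<Longrightarrow>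
      counit_right K C \<epsilon> (\<sigma> X) = counit_left K C \<epsilon> X"
    and counit_left_braid: "X \<in> carrier (tensor2 K C) \<Longrightarrow>
      counit_left K C \<epsilon> (\<sigma> X) = counit_right K C \<epsilon> X"

text \<open>\<open>x \<otimes> y \<mapsto> \<Sum>\<^sub>i t\<^sub>i \<cdot> y \<otimes> s\<^sub>i \<cdot> x\<close>, for an R-matrix presented as \<open>\<Sum>\<^sub>i s\<^sub>i \<otimes> t\<^sub>i\<close>.\<close>

definition module_braiding ::
  "('k, 'm) ring_scheme \<Rightarrow> ('k, 'c, 'p) module_scheme \<Rightarrow> ('h \<Rightarrow> 'c \<Rightarrow> 'c)
    \<Rightarrow> 'i set \<Rightarrow> ('i \<Rightarrow> 'h) \<Rightarrow> ('i \<Rightarrow> 'h) \<Rightarrow> ('c \<times> 'c \<Rightarrow>\<^sub>0 int) set \<Rightarrow> ('c \<times> 'c \<Rightarrow>\<^sub>0 int) set"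
  where "module_braiding K C act I s t =
    tensor_lift (tensor2 K C)
      (\<lambda>x y. \<Oplus>\<^bsub>tensor2 K C\<^esub>i\<in>I. pure_tensor K C C (act (t i) y) (act (s i) x))"

end

theory Submission
  imports Defs
begin

text \<open>
  Every identity of tensors is checked on pure tensors, by the universal property of the tensor
  product. Evaluating the two hexagon axioms on trilinear maps turns them into identities between
  finite sums; the compatibility of the braiding with the comultiplication of \<open>C\<close> is an instance of
  each. The Yang-Baxter equation for \<open>R\<close> gives the braid relation. Writing \<open>\<epsilon>\<close> for the counit of
  \<open>H\<close>, the hexagon axioms and the invertibility of \<open>R\<close> give \<open>(\<epsilon> \<otimes> id) R = 1 = (id \<otimes> \<epsilon>) R\<close>, which is
  the compatibility with the counit of \<open>C\<close>. Finally the braiding is \<open>X \<mapsto> flip (R \<cdot> X)\<close>, with inverse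
  \<open>X \<mapsto> R\<^sup>-\<^sup>1 \<cdot> flip X\<close>.
\<close>

section \<open>Homomorphisms out of free abelian groups\<close>

text \<open>A tensor is a coset of formal integer sums, and \<open>smult\<close>,
  \<open>mult\<close> and \<open>tensor_lift\<close> all refer to its representatives, so each has
  to be shown independent of the choice before anything can be computed. Scalar multiplication on a
  tensor product is itself a lift; lifts must therefore exist before the tensor product is known to
  be a module. This is why they are built for balanced maps into abelian groups, with linearity for
  bilinear maps as a later refinement. The R-matrix has a chosen presentation, comultiplied elements
  have none. So a linear map at \<open>R\<close> is a finite sum over \<open>I\<close>, while
  Sweedler sums remain lifts, and the computations alternate between the two forms. The hexagon
  axioms say that a strand crosses a doubled strand one copy at a time. They are evaluated with an
  arbitrary target module and an arbitrary trilinear map because the applications put the action on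
  fixed vectors, and even a Sweedler sum over \<open>\<Delta>\<^sub>C x\<close>, into that
  map.\<close>

definition frag_sum :: "('u, 'r) ring_scheme \<Rightarrow> ('p \<Rightarrow> 'u) \<Rightarrow> ('p \<Rightarrow>\<^sub>0 int) \<Rightarrow> 'u"
  where "frag_sum U f x = (\<Oplus>\<^bsub>U\<^esub>p\<in>Poly_Mapping.keys x. [Poly_Mapping.lookup x p] \<cdot>\<^bsub>U\<^esub> f p)"

context abelian_group
begin

lemma frag_sum_closed:
  assumes "f \<in> S \<rightarrow> carrier G" "Poly_Mapping.keys x \<subseteq> S"
  shows "frag_sum G f x \<in> carrier G"
  unfolding frag_sum_def
  by (intro finsum_closed Pi_I add.int_pow_closed funcset_mem[OF assms(1)] subsetD[OF assms(2)])

text \<open>A key outside the support has coefficient 0 and contributes a zero multiple. The purpose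
  is to bring several formal sums to a common index set.\<close>

lemma frag_sum_superset:
  assumes "f \<in> A \<rightarrow> carrier G" "Poly_Mapping.keys x \<subseteq> A" "finite A"
  shows "frag_sum G f x = (\<Oplus>p\<in>A. [Poly_Mapping.lookup x p] \<cdot> f p)"
  unfolding frag_sum_def
proof (rule add.finprod_mono_neutral_cong_left)
  show "[Poly_Mapping.lookup x i] \<cdot> f i = \<zero>" if "i \<in> A - Poly_Mapping.keys x" for i
  proof -
    have "Poly_Mapping.lookup x i = 0"
      using that by (simp add: not_in_keys_iff_lookup_eq_zero)
    then show ?thesis
      using add_pow_int_ge[of 0 G "f i"] by simp
  qed
qed (use assms in \<open>simp_all add: Pi_iff add.int_pow_closed\<close>)

text \<open>Coefficients can cancel, so the support of \<open>x + y\<close> may be smaller than the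
  union of the two supports; all three sums are therefore taken over that union.\<close>

lemma frag_sum_add:
  assumes f: "f \<in> S \<rightarrow> carrier G" and x: "Poly_Mapping.keys x \<subseteq> S" and y: "Poly_Mapping.keys y \<subseteq> S"
  shows "frag_sum G f (x + y) = frag_sum G f x \<oplus> frag_sum G f y"
proof -
  let ?A = "Poly_Mapping.keys x \<union> Poly_Mapping.keys y"
  have A: "f \<in> ?A \<rightarrow> carrier G"
    by (rule subsetD[OF Pi_anti_mono[OF Un_least[OF x y]] f])
  have k: "Poly_Mapping.keys (x + y) \<subseteq> ?A"
    by (rule keys_add)
  have "frag_sum G f (x + y) = (\<Oplus>p\<in>?A. [Poly_Mapping.lookup (x + y) p] \<cdot> f p)"
    by (rule frag_sum_superset[OF A k]) simp
  also have "\<dots> = (\<Oplus>p\<in>?A. [Poly_Mapping.lookup x p] \<cdot> f p \<oplus> [Poly_Mapping.lookup y p] \<cdot> f p)"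
    by (rule add.finprod_cong') (use A in \<open>simp_all add: lookup_add Pi_iff add.int_pow_mult add.int_pow_closed\<close>)
  also have "\<dots> = (\<Oplus>p\<in>?A. [Poly_Mapping.lookup x p] \<cdot> f p) \<oplus> (\<Oplus>p\<in>?A. [Poly_Mapping.lookup y p] \<cdot> f p)"
    by (rule finsum_addf) (use A in \<open>simp_all add: Pi_iff add.int_pow_closed\<close>)
  also have "\<dots> = frag_sum G f x \<oplus> frag_sum G f y"
    by (simp only: frag_sum_superset[OF A Un_upper1] frag_sum_superset[OF A Un_upper2] finite_Un finite_keys simp_thms)
  finally show ?thesis .
qed

lemma frag_sum_of [simp]: "f p \<in> carrier G \<Longrightarrow> frag_sum G f (frag_of p) = f p"
  unfolding frag_sum_def by (simp add: keys_frag_of)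

lemma frag_sum_zero [simp]: "frag_sum G f 0 = \<zero>"
  unfolding frag_sum_def by simp

lemma frag_sum_minus:
  assumes f: "f \<in> S \<rightarrow> carrier G" and x: "Poly_Mapping.keys x \<subseteq> S"
  shows "frag_sum G f (- x) = \<ominus> frag_sum G f x"
proof -
  have "frag_sum G f (- x) \<oplus> frag_sum G f x = \<zero>"
    using frag_sum_add[OF f, of "- x" x] x by (simp add: keys_minus)
  then show ?thesis
    using frag_sum_closed[OF f] x by (intro minus_equality[symmetric]) (simp_all add: keys_minus)
qed

lemma frag_sum_diff:
  assumes f: "f \<in> S \<rightarrow> carrier G" and x: "Poly_Mapping.keys x \<subseteq> S" and y: "Poly_Mapping.keys y \<subseteq> S"
  shows "frag_sum G f (x - y) = frag_sum G f x \<ominus> frag_sum G f y"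
  using frag_sum_add[OF f x, of "- y"] frag_sum_minus[OF f y] y
  by (simp add: keys_minus a_minus_def)

end

lemma tensor_lift_eq: "tensor_lift U f X = the_elem (frag_sum U (\<lambda>p. f (fst p) (snd p)) ` X)"
  by (simp add: tensor_lift_def frag_sum_def)

section \<open>Tensor products of modules\<close>

text \<open>These are the conditions under which the additive extension of \<open>f\<close> kills
  \<open>tensor_relations\<close>. Scalars are only moved from one argument to the other, never out
  of \<open>f\<close>, so the target can be a bare abelian group. This makes the notion usable
  before the tensor product is known to be a module.\<close>

definition balanced_map ::
  "('k, 'm) ring_scheme \<Rightarrow> ('k, 'v, 'p) module_scheme \<Rightarrow> ('k, 'w, 'q) module_scheme
    \<Rightarrow> ('u, 'r) ring_scheme \<Rightarrow> ('v \<Rightarrow> 'w \<Rightarrow> 'u) \<Rightarrow> bool"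
  where "balanced_map K V W U f \<longleftrightarrow>
    (\<forall>v\<in>carrier V. \<forall>w\<in>carrier W. f v w \<in> carrier U) \<and>
    (\<forall>v\<in>carrier V. \<forall>v'\<in>carrier V. \<forall>w\<in>carrier W. f (v \<oplus>\<^bsub>V\<^esub> v') w = f v w \<oplus>\<^bsub>U\<^esub> f v' w) \<and>
    (\<forall>v\<in>carrier V. \<forall>w\<in>carrier W. \<forall>w'\<in>carrier W. f v (w \<oplus>\<^bsub>W\<^esub> w') = f v w \<oplus>\<^bsub>U\<^esub> f v w') \<and>
    (\<forall>a\<in>carrier K. \<forall>v\<in>carrier V. \<forall>w\<in>carrier W. f (a \<odot>\<^bsub>V\<^esub> v) w = f v (a \<odot>\<^bsub>W\<^esub> w))"

locale tensor_product = V: module K V + W: module K W for K and V and W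
begin

abbreviation "S \<equiv> carrier V \<times> carrier W"
abbreviation "F \<equiv> free_Abelian_group S"
abbreviation "N \<equiv> tensor_kernel K V W"
abbreviation "cls \<equiv> tensor_class K V W"
abbreviation "T \<equiv> tensor K V W"
abbreviation pt (infixl "\<otimes>\<^sub>t" 70) where "pt \<equiv> pure_tensor K V W"

lemma relations_in_F: "tensor_relations K V W \<subseteq> carrier F"
proof
  fix r assume "r \<in> tensor_relations K V W"
  then consider
      (1) v v' w where "r = frag_of (v \<oplus>\<^bsub>V\<^esub> v', w) - frag_of (v, w) - frag_of (v', w)"
        "v \<in> carrier V" "v' \<in> carrier V" "w \<in> carrier W"
    | (2) v w w' where "r = frag_of (v, w \<oplus>\<^bsub>W\<^esub> w') - frag_of (v, w) - frag_of (v, w')"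
        "v \<in> carrier V" "w \<in> carrier W" "w' \<in> carrier W"
    | (3) a v w where "r = frag_of (a \<odot>\<^bsub>V\<^esub> v, w) - frag_of (v, a \<odot>\<^bsub>W\<^esub> w)"
        "a \<in> carrier K" "v \<in> carrier V" "w \<in> carrier W"
    unfolding tensor_relations_def by blast
  then show "r \<in> carrier F"
  proof cases
    case 1
    then show ?thesis
      unfolding carrier_free_Abelian_group_iff
      by (simp only:) (intro subset_trans[OF keys_diff] Un_least, simp_all add: keys_frag_of)
  next
    case 2
    then show ?thesis
      unfolding carrier_free_Abelian_group_iff
      by (simp only:) (intro subset_trans[OF keys_diff] Un_least, simp_all add: keys_frag_of)
  next
    case 3
    then show ?thesis
      unfolding carrier_free_Abelian_group_iff
      by (simp only:) (intro subset_trans[OF keys_diff] Un_least, simp_all add: keys_frag_of)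
  qed
qed

lemma subgroup_kernel: "subgroup N F"
  unfolding tensor_kernel_def
  by (rule group.generate_is_subgroup) (use relations_in_F in auto)

lemma normal_kernel: "N \<lhd> F"
  by (rule comm_group.normal_iff_subgroup[THEN iffD2, OF abelian_free_Abelian_group subgroup_kernel])

lemma kernel_keys: "n \<in> N \<Longrightarrow> Poly_Mapping.keys n \<subseteq> S"
  using subgroup.mem_carrier[OF subgroup_kernel] by simp

lemma class_eq: "cls x = {n + x | n. n \<in> N}"
  unfolding tensor_class_def r_coset_def by auto

lemma class_self: "x \<in> cls x"
  using subgroup.one_closed[OF subgroup_kernel] unfolding class_eq by force

lemma carrier_tensor: "carrier T = cls ` {x. Poly_Mapping.keys x \<subseteq> S}"
  unfolding tensor_def Let_def by (auto simp: FactGroup_def RCOSETS_def tensor_class_def)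

lemma class_closed: "Poly_Mapping.keys x \<subseteq> S \<Longrightarrow> cls x \<in> carrier T"
  unfolding carrier_tensor by blast

lemma class_cases:
  assumes "X \<in> carrier T"
  obtains x where "Poly_Mapping.keys x \<subseteq> S" "X = cls x"
  using assms unfolding carrier_tensor by blast

lemma class_add:
  assumes "Poly_Mapping.keys x \<subseteq> S" "Poly_Mapping.keys y \<subseteq> S"
  shows "cls x \<oplus>\<^bsub>T\<^esub> cls y = cls (x + y)"
  using normal.rcos_sum[OF normal_kernel, of x y] assms
  unfolding tensor_def Let_def by (simp add: FactGroup_def tensor_class_def)

lemma zero_tensor: "\<zero>\<^bsub>T\<^esub> = cls 0"
proof -
  have "cls 0 = N"
    unfolding class_eq by auto
  then show ?thesis
    unfolding tensor_def Let_def by (simp add: FactGroup_def)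
qed

lemma class_eqI:
  assumes "Poly_Mapping.keys y \<subseteq> S" "x - y \<in> N"
  shows "cls x = cls y"
proof -
  have "x \<in> cls y"
    unfolding class_eq using assms(2) by force
  then show ?thesis
    unfolding tensor_class_def
    using group.repr_independence[OF group_free_Abelian_group _ _ subgroup_kernel] assms(1) by fastforce
qed

sublocale T: abelian_group T
proof (rule abelian_groupI)
  fix X Y Z assume XYZ: "X \<in> carrier T" "Y \<in> carrier T" "Z \<in> carrier T"
  obtain x where x: "Poly_Mapping.keys x \<subseteq> S" "X = cls x"
    using XYZ(1) by (rule class_cases)
  obtain y where y: "Poly_Mapping.keys y \<subseteq> S" "Y = cls y"
    using XYZ(2) by (rule class_cases)
  obtain z where z: "Poly_Mapping.keys z \<subseteq> S" "Z = cls z"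
    using XYZ(3) by (rule class_cases)
  note k = x(1) y(1) z(1) and eq = x(2) y(2) z(2)
  have s: "Poly_Mapping.keys (u + u') \<subseteq> S" if "Poly_Mapping.keys u \<subseteq> S" "Poly_Mapping.keys u' \<subseteq> S" for u u'
    by (rule subset_trans[OF keys_add Un_least[OF that]])
  show "X \<oplus>\<^bsub>T\<^esub> Y \<in> carrier T" "X \<oplus>\<^bsub>T\<^esub> Y = Y \<oplus>\<^bsub>T\<^esub> X"
    using k by (simp_all add: eq class_add class_closed s add.commute)
  show "X \<oplus>\<^bsub>T\<^esub> Y \<oplus>\<^bsub>T\<^esub> Z = X \<oplus>\<^bsub>T\<^esub> (Y \<oplus>\<^bsub>T\<^esub> Z)"
    using k by (simp add: eq class_add s add.assoc)
next
  show "\<zero>\<^bsub>T\<^esub> \<in> carrier T"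
    by (simp add: zero_tensor class_closed)
next
  fix X assume "X \<in> carrier T"
  then obtain x where x: "Poly_Mapping.keys x \<subseteq> S" "X = cls x"
    by (rule class_cases)
  show "\<zero>\<^bsub>T\<^esub> \<oplus>\<^bsub>T\<^esub> X = X"
    using class_add[of 0 x] x by (simp add: zero_tensor)
  show "\<exists>Y\<in>carrier T. Y \<oplus>\<^bsub>T\<^esub> X = \<zero>\<^bsub>T\<^esub>"
    using class_add[of "- x" x] x by (intro bexI[of _ "cls (- x)"]) (auto simp: zero_tensor keys_minus class_closed)
qed

lemma pure_closed [simp, intro]: "v \<in> carrier V \<Longrightarrow> w \<in> carrier W \<Longrightarrow> v \<otimes>\<^sub>t w \<in> carrier T"
  unfolding pure_tensor_def by (rule class_closed) (simp add: keys_frag_of)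

lemma class_minus: "Poly_Mapping.keys x \<subseteq> S \<Longrightarrow> cls (- x) = \<ominus>\<^bsub>T\<^esub> cls x"
  by (rule T.minus_equality[symmetric]) (auto simp: class_add class_closed keys_minus zero_tensor)

lemma relation_in_kernel: "r \<in> tensor_relations K V W \<Longrightarrow> r \<in> N"
  unfolding tensor_kernel_def by (rule generate.incl)

text \<open>The three clauses are the three families of generators of \<open>N\<close>. For
  additivity the difference of the two representatives is a generator after regrouping by
  \<open>diff_diff_eq\<close>.\<close>

lemma pure_balanced: "balanced_map K V W T (\<otimes>\<^sub>t)"
  unfolding balanced_map_def
proof (intro conjI ballI)
  fix v v' w assume *: "v \<in> carrier V" "v' \<in> carrier V" "w \<in> carrier W"
  have k: "Poly_Mapping.keys (frag_of (v, w) + frag_of (v', w)) \<subseteq> S"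
    using * by (intro subset_trans[OF keys_add]) (auto simp: keys_frag_of)
  have "(v \<oplus>\<^bsub>V\<^esub> v') \<otimes>\<^sub>t w = cls (frag_of (v, w) + frag_of (v', w))"
    unfolding pure_tensor_def
    by (rule class_eqI[OF k], rule relation_in_kernel)
      (use * in \<open>force simp: tensor_relations_def diff_diff_eq\<close>)
  then show "(v \<oplus>\<^bsub>V\<^esub> v') \<otimes>\<^sub>t w = v \<otimes>\<^sub>t w \<oplus>\<^bsub>T\<^esub> v' \<otimes>\<^sub>t w"
    using * unfolding pure_tensor_def by (simp add: class_add keys_frag_of)
next
  fix v w w' assume *: "v \<in> carrier V" "w \<in> carrier W" "w' \<in> carrier W"
  have k: "Poly_Mapping.keys (frag_of (v, w) + frag_of (v, w')) \<subseteq> S"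
    using * by (intro subset_trans[OF keys_add]) (auto simp: keys_frag_of)
  have "v \<otimes>\<^sub>t (w \<oplus>\<^bsub>W\<^esub> w') = cls (frag_of (v, w) + frag_of (v, w'))"
    unfolding pure_tensor_def
    by (rule class_eqI[OF k], rule relation_in_kernel)
      (use * in \<open>force simp: tensor_relations_def diff_diff_eq\<close>)
  then show "v \<otimes>\<^sub>t (w \<oplus>\<^bsub>W\<^esub> w') = v \<otimes>\<^sub>t w \<oplus>\<^bsub>T\<^esub> v \<otimes>\<^sub>t w'"
    using * unfolding pure_tensor_def by (simp add: class_add keys_frag_of)
next
  fix a v w assume *: "a \<in> carrier K" "v \<in> carrier V" "w \<in> carrier W"
  show "(a \<odot>\<^bsub>V\<^esub> v) \<otimes>\<^sub>t w = v \<otimes>\<^sub>t (a \<odot>\<^bsub>W\<^esub> w)"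
    unfolding pure_tensor_def
    by (rule class_eqI, simp add: keys_frag_of *, rule relation_in_kernel)
      (use * in \<open>force simp: tensor_relations_def\<close>)
qed simp

text \<open>Pure tensors generate \<open>T\<close> already as an abelian group, since scalars can be
  absorbed into a factor. The maps are only assumed additive because this principle serves to prove
  the module axioms of \<open>T\<close> and the homogeneity of lifts.\<close>

lemma additive_eqI:
  assumes U: "abelian_group U"
    and f: "\<And>X. X \<in> carrier T \<Longrightarrow> f X \<in> carrier U"
      "\<And>X Y. X \<in> carrier T \<Longrightarrow> Y \<in> carrier T \<Longrightarrow> f (X \<oplus>\<^bsub>T\<^esub> Y) = f X \<oplus>\<^bsub>U\<^esub> f Y"
    and g: "\<And>X. X \<in> carrier T \<Longrightarrow> g X \<in> carrier U"
      "\<And>X Y. X \<in> carrier T \<Longrightarrow> Y \<in> carrier T \<Longrightarrow> g (X \<oplus>\<^bsub>T\<^esub> Y) = g X \<oplus>\<^bsub>U\<^esub> g Y"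
    and eq: "\<And>v w. v \<in> carrier V \<Longrightarrow> w \<in> carrier W \<Longrightarrow> f (v \<otimes>\<^sub>t w) = g (v \<otimes>\<^sub>t w)"
    and X: "X \<in> carrier T"
  shows "f X = g X"
proof -
  interpret U: abelian_group U by (rule U)
  obtain x where x: "Poly_Mapping.keys x \<subseteq> S" and Xx: "X = cls x"
    using X by (rule class_cases)
  have "group_hom (add_monoid T) (add_monoid U) f" "group_hom (add_monoid T) (add_monoid U) g"
    using f g by (auto intro!: group_hom.intro group_hom_axioms.intro homI T.a_group U.a_group)
  then interpret f: group_hom "add_monoid T" "add_monoid U" f + g: group_hom "add_monoid T" "add_monoid U" g .
  \<comment> \<open>The induction over formal sums proceeds by differences, so both maps must be
    known to commute with negation.\<close>
  have inv: "f (\<ominus>\<^bsub>T\<^esub> Y) = \<ominus>\<^bsub>U\<^esub> f Y" "g (\<ominus>\<^bsub>T\<^esub> Y) = \<ominus>\<^bsub>U\<^esub> g Y" if "Y \<in> carrier T" for Y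
    using f.hom_inv[of Y] g.hom_inv[of Y] that by (simp_all add: a_inv_def)
  have "f (cls x) = g (cls x)"
  proof (rule free_Abelian_group_induct[OF x])
    show "f (cls 0) = g (cls 0)"
      using f.hom_one g.hom_one by (simp flip: zero_tensor)
  next
    fix x y
    assume x: "Poly_Mapping.keys x \<subseteq> S" and y: "Poly_Mapping.keys y \<subseteq> S"
      and eqs: "f (cls x) = g (cls x)" "f (cls y) = g (cls y)"
    have k: "Poly_Mapping.keys (- y) \<subseteq> S"
      using y by (simp only: keys_minus)
    have "cls (x - y) = cls x \<oplus>\<^bsub>T\<^esub> \<ominus>\<^bsub>T\<^esub> cls y"
      using class_add[OF x k] class_minus[OF y] by simp
    then show "f (cls (x - y)) = g (cls (x - y))"
      using class_closed[OF x] class_closed[OF y] by (simp add: inv f(2) g(2) eqs)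
  next
    fix p assume "p \<in> S"
    then show "f (cls (frag_of p)) = g (cls (frag_of p))"
      using eq[of "fst p" "snd p"] by (auto simp: pure_tensor_def)
  qed
  then show ?thesis by (simp add: Xx)
qed

end

section \<open>The universal property for balanced maps\<close>

locale balanced_extension = tensor_product K V W + U: abelian_group U for K and V and W and U +
  fixes f
  assumes balanced: "balanced_map K V W U f"
begin

abbreviation "\<phi> \<equiv> frag_sum U (\<lambda>p. f (fst p) (snd p))"

lemma f_closed: "v \<in> carrier V \<Longrightarrow> w \<in> carrier W \<Longrightarrow> f v w \<in> carrier U"
  using balanced unfolding balanced_map_def by blast

lemma f_Pi: "(\<lambda>p. f (fst p) (snd p)) \<in> S \<rightarrow> carrier U"
  using f_closed by auto

text \<open>Each family of generators is one clause of \<open>balanced_map\<close> with everything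
  moved to one side.\<close>

lemma frag_sum_relation: 
  assumes "r \<in> tensor_relations K V W"
  shows "\<phi> r = \<zero>\<^bsub>U\<^esub>"
proof -
  have *: "\<phi> (frag_of p - frag_of q) = f (fst p) (snd p) \<ominus>\<^bsub>U\<^esub> f (fst q) (snd q)"
    if "p \<in> S" "q \<in> S" for p q
    using that f_closed by (subst U.frag_sum_diff[OF f_Pi]) (auto simp: keys_frag_of)
  have **: "\<phi> (frag_of p - frag_of q - frag_of r) = f (fst p) (snd p) \<ominus>\<^bsub>U\<^esub> f (fst q) (snd q) \<ominus>\<^bsub>U\<^esub> f (fst r) (snd r)"
    if "p \<in> S" "q \<in> S" "r \<in> S" for p q r
  proof -
    have "Poly_Mapping.keys (frag_of p - frag_of q) \<subseteq> S"
      using that by (intro subset_trans[OF keys_diff]) (auto simp: keys_frag_of)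
    then show ?thesis
      using that f_closed by (subst U.frag_sum_diff[OF f_Pi]) (auto simp: keys_frag_of *)
  qed
  have c: "a = b \<oplus>\<^bsub>U\<^esub> c \<Longrightarrow> b \<in> carrier U \<Longrightarrow> c \<in> carrier U \<Longrightarrow> a \<ominus>\<^bsub>U\<^esub> b \<ominus>\<^bsub>U\<^esub> c = \<zero>\<^bsub>U\<^esub>" for a b c
    using U.r_neg[of "b \<oplus>\<^bsub>U\<^esub> c"] by (simp add: a_minus_def U.a_assoc U.minus_add)
  consider
      (1) v v' w where "r = frag_of (v \<oplus>\<^bsub>V\<^esub> v', w) - frag_of (v, w) - frag_of (v', w)"
        "v \<in> carrier V" "v' \<in> carrier V" "w \<in> carrier W"
    | (2) v w w' where "r = frag_of (v, w \<oplus>\<^bsub>W\<^esub> w') - frag_of (v, w) - frag_of (v, w')"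
        "v \<in> carrier V" "w \<in> carrier W" "w' \<in> carrier W"
    | (3) a v w where "r = frag_of (a \<odot>\<^bsub>V\<^esub> v, w) - frag_of (v, a \<odot>\<^bsub>W\<^esub> w)"
        "a \<in> carrier K" "v \<in> carrier V" "w \<in> carrier W"
    using assms unfolding tensor_relations_def by blast
  then show ?thesis
  proof cases
    case 1
    then have "f (v \<oplus>\<^bsub>V\<^esub> v') w = f v w \<oplus>\<^bsub>U\<^esub> f v' w"
      using balanced unfolding balanced_map_def by blast
    with 1 show ?thesis by (simp add: ** c f_closed)
  next
    case 2
    then have "f v (w \<oplus>\<^bsub>W\<^esub> w') = f v w \<oplus>\<^bsub>U\<^esub> f v w'"
      using balanced unfolding balanced_map_def by blast
    with 2 show ?thesis by (simp add: ** c f_closed)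
  next
    case 3
    then have "f (a \<odot>\<^bsub>V\<^esub> v) w = f v (a \<odot>\<^bsub>W\<^esub> w)"
      using balanced unfolding balanced_map_def by blast
    with 3 show ?thesis by (simp add: * f_closed a_minus_def U.r_neg)
  qed
qed

lemma frag_sum_kernel:
  assumes "n \<in> N"
  shows "\<phi> n = \<zero>\<^bsub>U\<^esub>"
  using assms unfolding tensor_kernel_def
proof (induction rule: generate.induct)
  case one
  then show ?case by simp
next
  case (incl h)
  then show ?case by (rule frag_sum_relation)
next
  case (inv h)
  then have "h \<in> carrier F"
    using relations_in_F by (rule rev_subsetD)
  then have "Poly_Mapping.keys h \<subseteq> S"
    by (simp only: carrier_free_Abelian_group_iff)
  then show ?case
    using frag_sum_relation[OF inv] U.frag_sum_minus[OF f_Pi] by (simp only: inv_free_Abelian_group) simp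
next
  case (eng h1 h2)
  then have k: "Poly_Mapping.keys h1 \<subseteq> S" "Poly_Mapping.keys h2 \<subseteq> S"
    using kernel_keys[unfolded tensor_kernel_def] by simp_all
  show ?case
    using U.frag_sum_add[OF f_Pi k] by (simp only: mult_free_Abelian_group eng U.l_zero U.zero_closed)
qed

lemma frag_sum_representative:
  assumes "y \<in> cls x" "Poly_Mapping.keys x \<subseteq> S"
  shows "\<phi> y = \<phi> x"
proof -
  obtain n where n: "n \<in> N" "y = n + x"
    using assms unfolding class_eq by blast
  then show ?thesis
    using U.frag_sum_add[OF f_Pi kernel_keys[OF n(1)] assms(2)] frag_sum_kernel[OF n(1)]
      U.frag_sum_closed[OF f_Pi assms(2)] by simp
qed

text \<open>Representatives of a class differ by elements of \<open>N\<close>, on which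
  \<open>\<phi>\<close> vanishes. So the image in the definition of \<open>tensor_lift\<close> is a
  singleton, and \<open>the_elem\<close> returns its element.\<close>

lemma lift_class:
  assumes "Poly_Mapping.keys x \<subseteq> S"
  shows "tensor_lift U f (cls x) = \<phi> x"
proof -
  have "\<phi> ` cls x = {\<phi> x}"
  proof (intro equalityI subsetI)
    show "u \<in> {\<phi> x}" if "u \<in> \<phi> ` cls x" for u
      using that frag_sum_representative[OF _ assms] by (elim imageE) simp
    show "u \<in> \<phi> ` cls x" if "u \<in> {\<phi> x}" for u
      using that class_self[of x] by simp
  qed
  then show ?thesis
    unfolding tensor_lift_eq by simp
qed

lemma lift_pure:
  assumes "v \<in> carrier V" "w \<in> carrier W"
  shows "tensor_lift U f (v \<otimes>\<^sub>t w) = f v w"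
proof -
  have "Poly_Mapping.keys (frag_of (v, w)) \<subseteq> S"
    using assms by (simp add: keys_frag_of)
  then show ?thesis
    unfolding pure_tensor_def by (simp only: lift_class) (simp add: assms f_closed)
qed

lemma lift_closed:
  assumes "X \<in> carrier T"
  shows "tensor_lift U f X \<in> carrier U"
proof -
  obtain x where x: "Poly_Mapping.keys x \<subseteq> S" "X = cls x"
    using assms by (rule class_cases)
  show ?thesis
    unfolding x(2) lift_class[OF x(1)] by (rule U.frag_sum_closed[OF f_Pi x(1)])
qed

lemma lift_add:
  assumes "X \<in> carrier T" "Y \<in> carrier T"
  shows "tensor_lift U f (X \<oplus>\<^bsub>T\<^esub> Y) = tensor_lift U f X \<oplus>\<^bsub>U\<^esub> tensor_lift U f Y"
proof -
  obtain x where x: "Poly_Mapping.keys x \<subseteq> S" "X = cls x"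
    using assms(1) by (rule class_cases)
  obtain y where y: "Poly_Mapping.keys y \<subseteq> S" "Y = cls y"
    using assms(2) by (rule class_cases)
  have xy: "Poly_Mapping.keys (x + y) \<subseteq> S"
    by (rule subset_trans[OF keys_add Un_least[OF x(1) y(1)]])
  show ?thesis
    unfolding x(2) y(2) class_add[OF x(1) y(1)] lift_class[OF x(1)] lift_class[OF y(1)] lift_class[OF xy]
    by (rule U.frag_sum_add[OF f_Pi x(1) y(1)])
qed

text \<open>Meant for the fields \<open>smult\<close> and \<open>mult\<close> of
  \<open>tensor\<close>, which are unions over the representatives of a class: once the family of
  values is a singleton, the union is that single value. Agreement with \<open>\<phi>\<close> is
  demanded only on formal sums supported in \<open>S\<close>, which covers every
  representative.\<close>

lemma image_representatives:
  assumes X: "X \<in> carrier T" and h: "\<And>x. Poly_Mapping.keys x \<subseteq> S \<Longrightarrow> h x = \<phi> x"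
  shows "h ` X = {tensor_lift U f X}"
proof -
  obtain x where x: "Poly_Mapping.keys x \<subseteq> S" "X = cls x"
    using X by (rule class_cases)
  have y: "Poly_Mapping.keys y \<subseteq> S" if y: "y \<in> cls x" for y
  proof -
    obtain n where n: "n \<in> N" "y = n + x"
      using y unfolding class_eq by blast
    show ?thesis
      unfolding n(2) by (rule subset_trans[OF keys_add Un_least[OF kernel_keys[OF n(1)] x(1)]])
  qed
  have "h ` X = (\<lambda>y. \<phi> x) ` X"
  proof (rule image_cong[OF refl])
    fix u assume "u \<in> X"
    then have u: "u \<in> cls x" by (simp only: x(2))
    show "h u = \<phi> x"
      by (rule trans[OF h[OF y[OF u]] frag_sum_representative[OF u x(1)]])
  qed
  also have "\<dots> = {\<phi> x}"
    by (rule image_constant[OF class_self[of x, folded x(2)]])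
  finally show ?thesis
    by (simp only: x(2) lift_class[OF x(1)])
qed

end

section \<open>The module structure of a tensor product\<close>

context tensor_product
begin

text \<open>Both sides of the equation are homomorphisms in \<open>x\<close> that agree on
  generators. The claim about supports is carried through the induction because
  \<open>class_add\<close> and \<open>class_minus\<close> need it.\<close>

lemma class_frag_extend:
  assumes g: "\<And>p. p \<in> A \<Longrightarrow> Poly_Mapping.keys (g p) \<subseteq> S" and x: "Poly_Mapping.keys x \<subseteq> A"
  shows "Poly_Mapping.keys (frag_extend g x) \<subseteq> S \<and>
    cls (frag_extend g x) = frag_sum T (\<lambda>p. cls (g p)) x"
proof (rule free_Abelian_group_induct[OF x])
  show "Poly_Mapping.keys (frag_extend g 0) \<subseteq> S \<and> cls (frag_extend g 0) = frag_sum T (\<lambda>p. cls (g p)) 0"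
    by (simp add: zero_tensor)
next
  have P: "(\<lambda>p. cls (g p)) \<in> A \<rightarrow> carrier T"
    using class_closed[OF g] by (rule Pi_I)
  fix x y
  assume x: "Poly_Mapping.keys x \<subseteq> A" and y: "Poly_Mapping.keys y \<subseteq> A"
    and "Poly_Mapping.keys (frag_extend g x) \<subseteq> S \<and> cls (frag_extend g x) = frag_sum T (\<lambda>p. cls (g p)) x"
    and "Poly_Mapping.keys (frag_extend g y) \<subseteq> S \<and> cls (frag_extend g y) = frag_sum T (\<lambda>p. cls (g p)) y"
  then have k: "Poly_Mapping.keys (frag_extend g x) \<subseteq> S" "Poly_Mapping.keys (frag_extend g y) \<subseteq> S"
    and e: "cls (frag_extend g x) = frag_sum T (\<lambda>p. cls (g p)) x" "cls (frag_extend g y) = frag_sum T (\<lambda>p. cls (g p)) y"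
    by (iprover elim: conjE)+
  have m: "Poly_Mapping.keys (- frag_extend g y) \<subseteq> S"
    using k(2) by (simp only: keys_minus)
  have "cls (frag_extend g (x - y)) = cls (frag_extend g x + - frag_extend g y)"
    by (simp add: frag_extend_diff)
  also have "\<dots> = frag_sum T (\<lambda>p. cls (g p)) (x - y)"
    by (simp only: class_add[OF k(1) m, symmetric] class_minus[OF k(2)] e T.frag_sum_diff[OF P x y] a_minus_def)
  finally have "cls (frag_extend g (x - y)) = frag_sum T (\<lambda>p. cls (g p)) (x - y)" .
  moreover have "Poly_Mapping.keys (frag_extend g (x - y)) \<subseteq> S"
    unfolding frag_extend_diff by (rule subset_trans[OF keys_diff Un_least[OF k]])
  ultimately show "Poly_Mapping.keys (frag_extend g (x - y)) \<subseteq> S \<and>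
      cls (frag_extend g (x - y)) = frag_sum T (\<lambda>p. cls (g p)) (x - y)" by (intro conjI)
next
  fix p assume "p \<in> A"
  then show "Poly_Mapping.keys (frag_extend g (frag_of p)) \<subseteq> S \<and>
      cls (frag_extend g (frag_of p)) = frag_sum T (\<lambda>p. cls (g p)) (frag_of p)"
    using class_closed[OF g] g by simp
qed

lemma balanced_extensionI:
  assumes "abelian_group U" "balanced_map K V W U f"
  shows "balanced_extension K V W U f"
  using assms by (intro balanced_extension.intro tensor_product_axioms balanced_extension_axioms.intro)

lemma pure_add_left: "\<lbrakk>v \<in> carrier V; v' \<in> carrier V; w \<in> carrier W\<rbrakk> \<Longrightarrow>
    (v \<oplus>\<^bsub>V\<^esub> v') \<otimes>\<^sub>t w = v \<otimes>\<^sub>t w \<oplus>\<^bsub>T\<^esub> v' \<otimes>\<^sub>t w"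
  and pure_add_right: "\<lbrakk>v \<in> carrier V; w \<in> carrier W; w' \<in> carrier W\<rbrakk> \<Longrightarrow>
    v \<otimes>\<^sub>t (w \<oplus>\<^bsub>W\<^esub> w') = v \<otimes>\<^sub>t w \<oplus>\<^bsub>T\<^esub> v \<otimes>\<^sub>t w'"
  and pure_smult_right: "\<lbrakk>a \<in> carrier K; v \<in> carrier V; w \<in> carrier W\<rbrakk> \<Longrightarrow>
    v \<otimes>\<^sub>t (a \<odot>\<^bsub>W\<^esub> w) = (a \<odot>\<^bsub>V\<^esub> v) \<otimes>\<^sub>t w"
  using pure_balanced unfolding balanced_map_def by simp_all

text \<open>Moving a second scalar across the tensor sign leaves two scalars in opposite orders on
  the first factor; commutativity of \<open>K\<close> identifies them.\<close>

lemma smult_balanced: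
  assumes "a \<in> carrier K"
  shows "balanced_map K V W T (\<lambda>v w. (a \<odot>\<^bsub>V\<^esub> v) \<otimes>\<^sub>t w)"
  unfolding balanced_map_def using assms
  by (simp add: V.smult_r_distr pure_add_left pure_add_right pure_smult_right
      V.smult_assoc1[symmetric] V.m_comm)

text \<open>All representatives of \<open>X\<close> give the same class, so the union defining
  \<open>smult\<close> is taken over a one-element family, and that element is the lift.\<close>

lemma tensor_smult:
  assumes a: "a \<in> carrier K" and X: "X \<in> carrier T"
  shows "a \<odot>\<^bsub>T\<^esub> X = tensor_lift T (\<lambda>v w. (a \<odot>\<^bsub>V\<^esub> v) \<otimes>\<^sub>t w) X"
proof -
  interpret E: balanced_extension K V W T "\<lambda>v w. (a \<odot>\<^bsub>V\<^esub> v) \<otimes>\<^sub>t w"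
    by (rule balanced_extensionI[OF T.abelian_group_axioms smult_balanced[OF a]])
  have "(\<lambda>x. cls (frag_extend (\<lambda>(v, w). frag_of (a \<odot>\<^bsub>V\<^esub> v, w)) x)) ` X
      = {tensor_lift T (\<lambda>v w. (a \<odot>\<^bsub>V\<^esub> v) \<otimes>\<^sub>t w) X}"
  proof (rule E.image_representatives[OF X])
    fix x :: "'c \<times> 'e \<Rightarrow>\<^sub>0 int" assume x: "Poly_Mapping.keys x \<subseteq> S"
    have "cls (frag_extend (\<lambda>(v, w). frag_of (a \<odot>\<^bsub>V\<^esub> v, w)) x)
      = frag_sum T (\<lambda>p. cls (case p of (v, w) \<Rightarrow> frag_of (a \<odot>\<^bsub>V\<^esub> v, w))) x"
      by (rule class_frag_extend[THEN conjunct2, OF _ x]) (use a in \<open>auto simp: keys_frag_of\<close>)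
    then show "cls (frag_extend (\<lambda>(v, w). frag_of (a \<odot>\<^bsub>V\<^esub> v, w)) x)
      = frag_sum T (\<lambda>p. (a \<odot>\<^bsub>V\<^esub> fst p) \<otimes>\<^sub>t snd p) x"
      by (simp only: pure_tensor_def case_prod_beta)
  qed
  then show ?thesis
    unfolding tensor_def Let_def by simp
qed

lemma smult_pure:
  "\<lbrakk>a \<in> carrier K; v \<in> carrier V; w \<in> carrier W\<rbrakk> \<Longrightarrow> a \<odot>\<^bsub>T\<^esub> (v \<otimes>\<^sub>t w) = (a \<odot>\<^bsub>V\<^esub> v) \<otimes>\<^sub>t w"
  using balanced_extension.lift_pure[OF balanced_extensionI[OF T.abelian_group_axioms smult_balanced]]
  by (simp add: tensor_smult)

lemma smult_tensor_closed: "\<lbrakk>a \<in> carrier K; X \<in> carrier T\<rbrakk> \<Longrightarrow> a \<odot>\<^bsub>T\<^esub> X \<in> carrier T"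
  using balanced_extension.lift_closed[OF balanced_extensionI[OF T.abelian_group_axioms smult_balanced]]
  by (simp add: tensor_smult)

lemma smult_tensor_add: "\<lbrakk>a \<in> carrier K; X \<in> carrier T; Y \<in> carrier T\<rbrakk> \<Longrightarrow>
    a \<odot>\<^bsub>T\<^esub> (X \<oplus>\<^bsub>T\<^esub> Y) = a \<odot>\<^bsub>T\<^esub> X \<oplus>\<^bsub>T\<^esub> a \<odot>\<^bsub>T\<^esub> Y"
  using balanced_extension.lift_add[OF balanced_extensionI[OF T.abelian_group_axioms smult_balanced]]
  by (simp add: tensor_smult)

lemma tensor_module: "module K T"
proof (rule moduleI)
  show "cring K" ..
  show "abelian_group T" ..
  fix a b X assume a: "a \<in> carrier K" and b: "b \<in> carrier K" and X: "X \<in> carrier T"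
  show "(a \<oplus>\<^bsub>K\<^esub> b) \<odot>\<^bsub>T\<^esub> X = a \<odot>\<^bsub>T\<^esub> X \<oplus>\<^bsub>T\<^esub> b \<odot>\<^bsub>T\<^esub> X"
    by (rule additive_eqI[OF T.abelian_group_axioms _ _ _ _ _ X])
      (use a b in \<open>simp_all add: smult_tensor_closed smult_tensor_add smult_pure V.smult_l_distr
        pure_add_left T.a_ac\<close>)
  show "(a \<otimes>\<^bsub>K\<^esub> b) \<odot>\<^bsub>T\<^esub> X = a \<odot>\<^bsub>T\<^esub> (b \<odot>\<^bsub>T\<^esub> X)"
    by (rule additive_eqI[OF T.abelian_group_axioms _ _ _ _ _ X])
      (use a b in \<open>simp_all add: smult_tensor_closed smult_tensor_add smult_pure V.smult_assoc1\<close>)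
next
  fix X assume X: "X \<in> carrier T"
  show "\<one>\<^bsub>K\<^esub> \<odot>\<^bsub>T\<^esub> X = X"
    by (rule additive_eqI[OF T.abelian_group_axioms _ _ _ _ _ X])
      (simp_all add: smult_tensor_closed smult_tensor_add smult_pure)
qed (simp_all add: smult_tensor_closed smult_tensor_add)

end

lemma tensor_is_module [simp, intro]:
  assumes "module K V" "module K W"
  shows "module K (tensor K V W)"
proof -
  interpret tensor_product K V W
    using assms by (rule tensor_product.intro)
  show ?thesis by (rule tensor_module)
qed

lemma scalars_is_module:
  assumes "cring K"
  shows "module K (scalars K)"
proof -
  interpret cring K by (rule assms)
  show ?thesis
    by (rule moduleI[OF assms])
      (auto simp: scalars_def l_distr r_distr m_assoc a_ac intro!: abelian_groupI bexI[of _ "\<ominus>\<^bsub>K\<^esub> _"] l_neg)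
qed

section \<open>Linear and bilinear maps\<close>

lemma linear_map_closed: "linear_map K V W f \<Longrightarrow> x \<in> carrier V \<Longrightarrow> f x \<in> carrier W"
  and linear_map_add: "\<lbrakk>linear_map K V W f; x \<in> carrier V; y \<in> carrier V\<rbrakk> \<Longrightarrow> f (x \<oplus>\<^bsub>V\<^esub> y) = f x \<oplus>\<^bsub>W\<^esub> f y"
  and linear_map_smult: "\<lbrakk>linear_map K V W f; a \<in> carrier K; x \<in> carrier V\<rbrakk> \<Longrightarrow> f (a \<odot>\<^bsub>V\<^esub> x) = a \<odot>\<^bsub>W\<^esub> f x"
  unfolding linear_map_def by auto

lemma linear_mapI:
  assumes "\<And>x. x \<in> carrier V \<Longrightarrow> f x \<in> carrier W"
    and "\<And>x y. x \<in> carrier V \<Longrightarrow> y \<in> carrier V \<Longrightarrow> f (x \<oplus>\<^bsub>V\<^esub> y) = f x \<oplus>\<^bsub>W\<^esub> f y"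
    and "\<And>a x. a \<in> carrier K \<Longrightarrow> x \<in> carrier V \<Longrightarrow> f (a \<odot>\<^bsub>V\<^esub> x) = a \<odot>\<^bsub>W\<^esub> f x"
  shows "linear_map K V W f"
  unfolding linear_map_def using assms by auto

lemma linear_map_cong:
  assumes "module K V" "linear_map K V W f" "\<And>x. x \<in> carrier V \<Longrightarrow> g x = f x"
  shows "linear_map K V W g"
proof -
  interpret module K V by (rule assms)
  show ?thesis
    by (rule linear_mapI) (simp_all add: assms(3) linear_map_closed[OF assms(2)] linear_map_add[OF assms(2)] linear_map_smult[OF assms(2)])
qed

lemma linear_map_id [intro!]: "linear_map K V V (\<lambda>x. x)"
  by (simp add: linear_map_def)

lemma linear_map_comp: "linear_map K W U f \<Longrightarrow> linear_map K V W g \<Longrightarrow> linear_map K V U (\<lambda>x. f (g x))"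
  by (auto simp: linear_map_def Pi_iff)

lemma linear_map_smult_left:
  assumes "module K V" "v \<in> carrier V"
  shows "linear_map K (scalars K) V (\<lambda>a. a \<odot>\<^bsub>V\<^esub> v)"
proof -
  interpret module K V by (rule assms)
  show ?thesis
    using assms(2) by (intro linear_mapI) (simp_all add: scalars_def smult_l_distr smult_assoc1)
qed

lemma linear_map_smult_right:
  assumes "module K V" "a \<in> carrier K"
  shows "linear_map K V V (\<lambda>v. a \<odot>\<^bsub>V\<^esub> v)"
proof -
  interpret module K V by (rule assms)
  show ?thesis
    using assms(2) by (intro linear_mapI) (simp_all add: smult_r_distr smult_assoc1[symmetric] m_comm)
qed

lemma linear_map_zero:
  assumes "module K V" "module K W" "linear_map K V W f"
  shows "f \<zero>\<^bsub>V\<^esub> = \<zero>\<^bsub>W\<^esub>"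
proof -
  interpret V: module K V by (rule assms)
  interpret W: module K W by (rule assms)
  have "f (\<zero>\<^bsub>K\<^esub> \<odot>\<^bsub>V\<^esub> \<zero>\<^bsub>V\<^esub>) = \<zero>\<^bsub>K\<^esub> \<odot>\<^bsub>W\<^esub> f \<zero>\<^bsub>V\<^esub>"
    by (rule linear_map_smult[OF assms(3)]) simp_all
  then show ?thesis
    using linear_map_closed[OF assms(3), of "\<zero>\<^bsub>V\<^esub>"] by simp
qed

lemma linear_map_finsum:
  assumes "module K V" "module K W" "linear_map K V W f" "finite I" "\<And>i. i \<in> I \<Longrightarrow> g i \<in> carrier V"
  shows "f (\<Oplus>\<^bsub>V\<^esub>i\<in>I. g i) = (\<Oplus>\<^bsub>W\<^esub>i\<in>I. f (g i))"
proof -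
  interpret V: module K V by (rule assms)
  interpret W: module K W by (rule assms)
  note c = linear_map_closed[OF assms(3)]
  show ?thesis
    using assms(4,5)
  proof (induction I rule: finite_induct)
    case empty
    then show ?case by (simp add: linear_map_zero[OF assms(1-3)])
  next
    case (insert i I)
    then show ?case
      by (simp add: Pi_iff c linear_map_add[OF assms(3)])
  qed
qed

lemma linear_map_sum:
  assumes "module K V" "module K U" "finite I" "\<And>i. i \<in> I \<Longrightarrow> linear_map K V U (f i)"
  shows "linear_map K V U (\<lambda>x. \<Oplus>\<^bsub>U\<^esub>i\<in>I. f i x)"
proof -
  interpret V: module K V by (rule assms)
  interpret U: module K U by (rule assms)
  show ?thesis
    using assms(3,4)
  proof (induction I rule: finite_induct)
    case empty
    then show ?case by (simp add: linear_map_def)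
  next
    case (insert i I)
    have i: "linear_map K V U (f i)" and I: "linear_map K V U (\<lambda>x. \<Oplus>\<^bsub>U\<^esub>i\<in>I. f i x)"
      using insert by simp_all
    have "linear_map K V U (\<lambda>x. f i x \<oplus>\<^bsub>U\<^esub> (\<Oplus>\<^bsub>U\<^esub>i\<in>I. f i x))"
      by (intro linear_mapI)
        (simp_all add: linear_map_closed[OF i] linear_map_closed[OF I] linear_map_add[OF i] linear_map_add[OF I]
          linear_map_smult[OF i] linear_map_smult[OF I] U.smult_r_distr U.a_ac)
    then show ?case
    proof (rule linear_map_cong[OF assms(1)])
      fix x assume x: "x \<in> carrier V"
      show "(\<Oplus>\<^bsub>U\<^esub>i\<in>insert i I. f i x) = f i x \<oplus>\<^bsub>U\<^esub> (\<Oplus>\<^bsub>U\<^esub>i\<in>I. f i x)"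
        by (rule U.finsum_insert[OF insert.hyps]) (use linear_map_closed[OF insert.prems x] in simp_all)
    qed
  qed
qed

lemma bilinear_mapI:
  assumes "\<And>w. w \<in> carrier W \<Longrightarrow> linear_map K V U (\<lambda>v. f v w)"
    and "\<And>v. v \<in> carrier V \<Longrightarrow> linear_map K W U (\<lambda>w. f v w)"
  shows "bilinear_map K V W U f"
  using assms by (simp add: bilinear_map_def)

text \<open>The inner map \<open>g\<close> is part of the rule so that it can be iterated: linearity
  of a nested expression in one variable reduces to linearity of the subexpression containing that
  variable.\<close>

lemma bilinear_map_left:
  assumes "bilinear_map K V W U f" "w \<in> carrier W" "linear_map K X V g"
  shows "linear_map K X U (\<lambda>x. f (g x) w)"
  using assms by (auto simp: bilinear_map_def intro: linear_map_comp[of K V U "\<lambda>v. f v w"])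

lemma bilinear_map_right:
  assumes "bilinear_map K V W U f" "v \<in> carrier V" "linear_map K X W g"
  shows "linear_map K X U (\<lambda>x. f v (g x))"
  using assms by (auto simp: bilinear_map_def intro: linear_map_comp[of K W U "f v"])

lemma bilinear_map_closed:
  "bilinear_map K V W U f \<Longrightarrow> v \<in> carrier V \<Longrightarrow> w \<in> carrier W \<Longrightarrow> f v w \<in> carrier U"
  unfolding bilinear_map_def linear_map_def by auto

lemma bilinear_map_balanced:
  assumes "module K V" "module K W" "bilinear_map K V W U f"
  shows "balanced_map K V W U f"
proof -
  have l: "linear_map K V U (\<lambda>v. f v w)" if "w \<in> carrier W" for w
    using assms(3) that by (simp add: bilinear_map_def)
  have r: "linear_map K W U (f v)" if "v \<in> carrier V" for v
    using assms(3) that by (simp add: bilinear_map_def)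
  show ?thesis
    unfolding balanced_map_def
    by (simp add: bilinear_map_closed[OF assms(3)] linear_map_add[OF l] linear_map_add[OF r]
        linear_map_smult[OF l] linear_map_smult[OF r])
qed

lemma pure_tensor_bilinear:
  assumes "module K V" "module K W"
  shows "bilinear_map K V W (tensor K V W) (pure_tensor K V W)"
proof -
  interpret tensor_product K V W
    using assms by (rule tensor_product.intro)
  show ?thesis
    by (intro bilinear_mapI linear_mapI)
      (simp_all add: pure_add_left pure_add_right smult_pure pure_smult_right)
qed

lemma tensor_linear_eqI:
  assumes "module K V" "module K W" "module K U"
    and f: "linear_map K (tensor K V W) U f" and g: "linear_map K (tensor K V W) U g"
    and eq: "\<And>v w. v \<in> carrier V \<Longrightarrow> w \<in> carrier W \<Longrightarrow> f (pure_tensor K V W v w) = g (pure_tensor K V W v w)"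
    and X: "X \<in> carrier (tensor K V W)"
  shows "f X = g X"
proof -
  interpret tensor_product K V W
    using assms(1,2) by (rule tensor_product.intro)
  interpret U: module K U by (rule assms)
  show ?thesis
    by (rule additive_eqI[where f = f and g = g and X = X, OF U.abelian_group_axioms])
      (simp_all add: eq X linear_map_closed[OF f] linear_map_closed[OF g] linear_map_add[OF f] linear_map_add[OF g])
qed

lemma
  assumes V: "module K V" and W: "module K W" and U: "module K U" and f: "bilinear_map K V W U f"
  shows tensor_lift_linear: "linear_map K (tensor K V W) U (tensor_lift U f)"
    and tensor_lift_pure: "\<And>v w. v \<in> carrier V \<Longrightarrow> w \<in> carrier W \<Longrightarrow> tensor_lift U f (pure_tensor K V W v w) = f v w"
proof -
  interpret U: module K U by (rule U)
  interpret tensor_product K V W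
    using V W by (rule tensor_product.intro)
  interpret balanced_extension K V W U f
    by (rule balanced_extensionI[OF U.abelian_group_axioms bilinear_map_balanced[OF V W f]])
  show pure: "\<And>v w. v \<in> carrier V \<Longrightarrow> w \<in> carrier W \<Longrightarrow> tensor_lift U f (pure_tensor K V W v w) = f v w"
    by (rule lift_pure)
  have l: "linear_map K V U (\<lambda>v. f v w)" if "w \<in> carrier W" for w
    using f that by (simp add: bilinear_map_def)
  \<comment> \<open>Homogeneity for a fixed scalar is an identity between two additive maps on
    \<open>T\<close>, so it too may be checked on pure tensors.\<close>
  have "tensor_lift U f (a \<odot>\<^bsub>T\<^esub> X) = a \<odot>\<^bsub>U\<^esub> tensor_lift U f X" if a: "a \<in> carrier K" and X: "X \<in> carrier T" for a X
    by (rule additive_eqI[OF U.abelian_group_axioms _ _ _ _ _ X])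
      (use a in \<open>simp_all add: lift_closed lift_add smult_tensor_closed smult_tensor_add smult_pure
        lift_pure U.smult_r_distr linear_map_smult[OF l] f_closed\<close>)
  then show "linear_map K (tensor K V W) U (tensor_lift U f)"
    by (intro linear_mapI lift_closed lift_add)
qed

text \<open>Here the tensor \<open>X\<close> is fixed and the bilinear map varies. Each linearity
  equation in the parameter is an identity between two maps linear in \<open>X\<close>, hence can be
  checked on pure tensors, where it is the hypothesis \<open>L\<close>. Iterated lifts and Sweedler
  sums with parameters rest on this.\<close>

lemma tensor_lift_linear_param:
  assumes V: "module K V" and W: "module K W" and U: "module K U"
    and M: "module K M"
    and X: "X \<in> carrier (tensor K V W)"
    and F: "\<And>x. x \<in> carrier M \<Longrightarrow> bilinear_map K V W U (F x)"
    and L: "\<And>v w. v \<in> carrier V \<Longrightarrow> w \<in> carrier W \<Longrightarrow> linear_map K M U (\<lambda>x. F x v w)"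
  shows "linear_map K M U (\<lambda>x. tensor_lift U (F x) X)"
proof -
  interpret U: module K U by (rule U)
  interpret M: module K M by (rule M)
  note ll = tensor_lift_linear[OF V W U F] and lp = tensor_lift_pure[OF V W U F]
  note c = linear_map_closed[OF ll]
  interpret tensor_product K V W
    using V W by (rule tensor_product.intro)
  interpret T: module K T by (rule tensor_module)
  show ?thesis
  proof (rule linear_mapI)
    fix x y assume x: "x \<in> carrier M" and y: "y \<in> carrier M"
    have "linear_map K T U (\<lambda>X. tensor_lift U (F x) X \<oplus>\<^bsub>U\<^esub> tensor_lift U (F y) X)"
      by (intro linear_mapI)
        (simp_all add: x y c linear_map_add[OF ll] linear_map_smult[OF ll] U.a_ac U.smult_r_distr)
    then show "tensor_lift U (F (x \<oplus>\<^bsub>M\<^esub> y)) X = tensor_lift U (F x) X \<oplus>\<^bsub>U\<^esub> tensor_lift U (F y) X"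
      by (rule tensor_linear_eqI[where f = "tensor_lift U (F (x \<oplus>\<^bsub>M\<^esub> y))", OF V W U ll[OF M.a_closed[OF x y]] _ _ X])
        (simp_all add: x y lp linear_map_add[OF L])
  next
    fix a x assume a: "a \<in> carrier K" and x: "x \<in> carrier M"
    have "linear_map K T U (\<lambda>X. a \<odot>\<^bsub>U\<^esub> tensor_lift U (F x) X)"
      by (rule linear_map_comp[OF linear_map_smult_right[OF U a] ll[OF x]])
    then show "tensor_lift U (F (a \<odot>\<^bsub>M\<^esub> x)) X = a \<odot>\<^bsub>U\<^esub> tensor_lift U (F x) X"
      by (rule tensor_linear_eqI[where f = "tensor_lift U (F (a \<odot>\<^bsub>M\<^esub> x))", OF V W U ll[OF M.smult_closed[OF a x]] _ _ X])
        (simp_all add: a x lp linear_map_smult[OF L])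
  qed (simp add: c X)
qed

section \<open>Finite sums in modules, and linear maps applied to lifts\<close>

lemma (in abelian_monoid) finsum_swap:
  assumes "finite A" "finite B" "\<And>i j. i \<in> A \<Longrightarrow> j \<in> B \<Longrightarrow> f i j \<in> carrier G"
  shows "(\<Oplus>i\<in>A. \<Oplus>j\<in>B. f i j) = (\<Oplus>j\<in>B. \<Oplus>i\<in>A. f i j)"
  using assms(1,3)
proof (induction A rule: finite_induct)
  case empty
  then show ?case by simp
next
  case (insert a A)
  have "(\<Oplus>j\<in>B. \<Oplus>i\<in>insert a A. f i j) = (\<Oplus>j\<in>B. f a j \<oplus> (\<Oplus>i\<in>A. f i j))"
    by (rule add.finprod_cong') (use insert in \<open>simp_all add: Pi_iff\<close>)
  also have "\<dots> = (\<Oplus>j\<in>B. f a j) \<oplus> (\<Oplus>j\<in>B. \<Oplus>i\<in>A. f i j)"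
    by (rule finsum_addf) (use insert in \<open>simp_all add: Pi_iff\<close>)
  finally show ?case
    using insert by (simp add: Pi_iff)
qed

lemma module_finsum_cong:
  assumes "module K U" "\<And>i. i \<in> I \<Longrightarrow> g i \<in> carrier U" "\<And>i. i \<in> I \<Longrightarrow> f i = g i"
  shows "(\<Oplus>\<^bsub>U\<^esub>i\<in>I. f i) = (\<Oplus>\<^bsub>U\<^esub>i\<in>I. g i)"
proof -
  interpret module K U by (rule assms)
  show ?thesis
    using assms(2,3) by (intro M.add.finprod_cong') simp_all
qed

lemma module_finsum_closed:
  assumes "module K U" "\<And>i. i \<in> I \<Longrightarrow> g i \<in> carrier U"
  shows "(\<Oplus>\<^bsub>U\<^esub>i\<in>I. g i) \<in> carrier U"
proof -
  interpret module K U by (rule assms)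
  show ?thesis
    using assms(2) by (intro M.finsum_closed) simp
qed

lemma module_finsum_swap:
  assumes "module K U" "finite A" "finite B" "\<And>i j. i \<in> A \<Longrightarrow> j \<in> B \<Longrightarrow> f i j \<in> carrier U"
  shows "(\<Oplus>\<^bsub>U\<^esub>i\<in>A. \<Oplus>\<^bsub>U\<^esub>j\<in>B. f i j) = (\<Oplus>\<^bsub>U\<^esub>j\<in>B. \<Oplus>\<^bsub>U\<^esub>i\<in>A. f i j)"
proof -
  interpret module K U by (rule assms)
  show ?thesis
    using assms(2-) by (rule M.finsum_swap)
qed

lemma pure_tensor_closed:
  "\<lbrakk>module K V; module K W; v \<in> carrier V; w \<in> carrier W\<rbrakk> \<Longrightarrow> pure_tensor K V W v w \<in> carrier (tensor K V W)"
  by (rule bilinear_map_closed[OF pure_tensor_bilinear])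

lemma tensor_lift_closed:
  "\<lbrakk>module K V; module K W; module K U; bilinear_map K V W U f; X \<in> carrier (tensor K V W)\<rbrakk>
    \<Longrightarrow> tensor_lift U f X \<in> carrier U"
  by (rule linear_map_closed[OF tensor_lift_linear])

text \<open>Linear maps pass under a Sweedler sum. Bilinearity of \<open>g'\<close> is derived: on
  the carriers it is the composite of \<open>f\<close> with \<open>g\<close>.\<close>

lemma linear_map_tensor_lift:
  assumes V: "module K V" and W: "module K W" and U: "module K U" and U': "module K U'"
    and f: "linear_map K U U' f" and g: "bilinear_map K V W U g"
    and eq: "\<And>v w. v \<in> carrier V \<Longrightarrow> w \<in> carrier W \<Longrightarrow> f (g v w) = g' v w"
    and X: "X \<in> carrier (tensor K V W)"
  shows "f (tensor_lift U g X) = tensor_lift U' g' X"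
proof -
  have "linear_map K W U' (g' v)" if v: "v \<in> carrier V" for v
    by (rule linear_map_cong[OF W linear_map_comp[OF f bilinear_map_right[OF g v linear_map_id]]])
      (simp add: eq v)
  moreover have "linear_map K V U' (\<lambda>v. g' v w)" if w: "w \<in> carrier W" for w
    by (rule linear_map_cong[OF V linear_map_comp[OF f bilinear_map_left[OF g w linear_map_id]]])
      (simp add: eq w)
  ultimately have g': "bilinear_map K V W U' g'"
    by (intro bilinear_mapI)
  show ?thesis
    by (rule tensor_linear_eqI[where f = "\<lambda>X. f (tensor_lift U g X)", OF V W U' _ tensor_lift_linear[OF V W U' g'] _ X])
      (simp_all add: tensor_lift_pure[OF V W U g] tensor_lift_pure[OF V W U' g'] eq
        linear_map_comp[OF f tensor_lift_linear[OF V W U g]])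
qed

lemma tensor_lift_cong:
  assumes "module K V" "module K W" "module K U" "bilinear_map K V W U g"
    and "\<And>v w. v \<in> carrier V \<Longrightarrow> w \<in> carrier W \<Longrightarrow> g v w = g' v w"
    and "X \<in> carrier (tensor K V W)"
  shows "tensor_lift U g X = tensor_lift U g' X"
  by (rule linear_map_tensor_lift[where f = "\<lambda>x. x", OF assms(1-3,3) linear_map_id assms(4-6)])

lemma
  assumes "module K A" "module K B" "module K V" "module K W"
    and f: "linear_map K A V f" and g: "linear_map K B W g"
  shows tensor_map_linear: "linear_map K (tensor K A B) (tensor K V W) (tensor_map K V W f g)"
    and tensor_map_pure: "\<And>a b. a \<in> carrier A \<Longrightarrow> b \<in> carrier B \<Longrightarrow>
      tensor_map K V W f g (pure_tensor K A B a b) = pure_tensor K V W (f a) (g b)"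
proof -
  have b: "bilinear_map K A B (tensor K V W) (\<lambda>a b. pure_tensor K V W (f a) (g b))"
    by (intro bilinear_mapI bilinear_map_left[OF pure_tensor_bilinear] bilinear_map_right[OF pure_tensor_bilinear]
        assms linear_map_closed[OF f] linear_map_closed[OF g])
  show "linear_map K (tensor K A B) (tensor K V W) (tensor_map K V W f g)"
    unfolding tensor_map_def by (rule tensor_lift_linear[OF _ _ _ b]) (simp_all add: assms)
  show "tensor_map K V W f g (pure_tensor K A B a b) = pure_tensor K V W (f a) (g b)"
    if "a \<in> carrier A" "b \<in> carrier B" for a b
    unfolding tensor_map_def by (rule tensor_lift_pure[OF _ _ _ b that]) (simp_all add: assms)
qed

lemma tensor_flip_bilinear:
  assumes "module K V" "module K W"
  shows "bilinear_map K V W (tensor K W V) (\<lambda>v w. pure_tensor K W V w v)"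
  by (intro bilinear_mapI bilinear_map_left[OF pure_tensor_bilinear] bilinear_map_right[OF pure_tensor_bilinear]
      assms linear_map_id)

lemma
  assumes "module K V" "module K W"
  shows tensor_flip_linear: "linear_map K (tensor K V W) (tensor K W V) (tensor_flip K V W)"
    and tensor_flip_pure: "\<And>v w. v \<in> carrier V \<Longrightarrow> w \<in> carrier W \<Longrightarrow>
      tensor_flip K V W (pure_tensor K V W v w) = pure_tensor K W V w v"
  unfolding tensor_flip_def
  by (rule tensor_lift_linear[OF _ _ _ tensor_flip_bilinear]; simp add: assms)
    (rule tensor_lift_pure[OF _ _ _ tensor_flip_bilinear]; simp add: assms)

section \<open>Trilinear maps\<close>

definition trilinear_map ::
  "('k, 'm) ring_scheme \<Rightarrow> ('k, 'v, 'p) module_scheme \<Rightarrow> ('k, 'u, 'r) module_scheme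
    \<Rightarrow> ('v \<Rightarrow> 'v \<Rightarrow> 'v \<Rightarrow> 'u) \<Rightarrow> bool"
  where "trilinear_map K V U f \<longleftrightarrow>
    (\<forall>x\<in>carrier V. \<forall>y\<in>carrier V.
      linear_map K V U (\<lambda>z. f z x y) \<and> linear_map K V U (\<lambda>z. f x z y) \<and> linear_map K V U (f x y))"

definition tensor_lift3 ::
  "('u, 'r) ring_scheme \<Rightarrow> ('v \<Rightarrow> 'v \<Rightarrow> 'v \<Rightarrow> 'u) \<Rightarrow> (('v \<times> 'v \<Rightarrow>\<^sub>0 int) set \<times> 'v \<Rightarrow>\<^sub>0 int) set \<Rightarrow> 'u"
  where "tensor_lift3 U f = tensor_lift U (\<lambda>X z. tensor_lift U (\<lambda>x y. f x y z) X)"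

lemma trilinear_mapI:
  assumes "\<And>x y. \<lbrakk>x \<in> carrier V; y \<in> carrier V\<rbrakk> \<Longrightarrow> linear_map K V U (\<lambda>z. f z x y)"
    "\<And>x y. \<lbrakk>x \<in> carrier V; y \<in> carrier V\<rbrakk> \<Longrightarrow> linear_map K V U (\<lambda>z. f x z y)"
    "\<And>x y. \<lbrakk>x \<in> carrier V; y \<in> carrier V\<rbrakk> \<Longrightarrow> linear_map K V U (\<lambda>z. f x y z)"
  shows "trilinear_map K V U f"
  unfolding trilinear_map_def using assms by simp

locale trilinear = V: module K V + U: module K U for K V U +
  fixes f
  assumes trilinear: "trilinear_map K V U f"
begin

lemma lin1: "x \<in> carrier V \<Longrightarrow> y \<in> carrier V \<Longrightarrow> linear_map K V U (\<lambda>z. f z x y)"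
  and lin2: "x \<in> carrier V \<Longrightarrow> y \<in> carrier V \<Longrightarrow> linear_map K V U (\<lambda>z. f x z y)"
  and lin3: "x \<in> carrier V \<Longrightarrow> y \<in> carrier V \<Longrightarrow> linear_map K V U (\<lambda>z. f x y z)"
  using trilinear unfolding trilinear_map_def by simp_all

lemma closed: "\<lbrakk>x \<in> carrier V; y \<in> carrier V; z \<in> carrier V\<rbrakk> \<Longrightarrow> f x y z \<in> carrier U"
  using linear_map_closed[OF lin3] .

lemma bilinear12: "z \<in> carrier V \<Longrightarrow> bilinear_map K V V U (\<lambda>x y. f x y z)"
  by (intro bilinear_mapI lin1 lin2)

lemma lift_bilinear: "bilinear_map K (tensor2 K V) V U (\<lambda>X z. tensor_lift U (\<lambda>x y. f x y z) X)"
  by (rule bilinear_mapI)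
    (assumption | rule tensor_lift_linear tensor_lift_linear_param bilinear12 lin3 V.module_axioms U.module_axioms)+

lemma lift3_linear: "linear_map K (tensor3 K V) U (tensor_lift3 U f)"
  unfolding tensor_lift3_def
  by (intro tensor_lift_linear lift_bilinear tensor_is_module V.module_axioms U.module_axioms)

text \<open>The left factor \<open>X\<close> is an arbitrary tensor, not a pure one: this is the
  shape produced by \<Delta> \<otimes> id.\<close>

lemma lift3_pure_left:
  "X \<in> carrier (tensor2 K V) \<Longrightarrow> z \<in> carrier V \<Longrightarrow>
    tensor_lift3 U f (pure_tensor K (tensor2 K V) V X z) = tensor_lift U (\<lambda>x y. f x y z) X"
  unfolding tensor_lift3_def
  by (rule tensor_lift_pure[OF _ _ _ lift_bilinear]) (auto intro: V.module_axioms U.module_axioms)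

lemma lift3_pure:
  "\<lbrakk>x \<in> carrier V; y \<in> carrier V; z \<in> carrier V\<rbrakk> \<Longrightarrow> tensor_lift3 U f (pure_tensor3 K V x y z) = f x y z"
  unfolding pure_tensor3_def
  by (simp add: lift3_pure_left pure_tensor_closed V.module_axioms U.module_axioms tensor_lift_pure[OF _ _ _ bilinear12])

end

lemma pure_tensor3_trilinear:
  assumes "module K V"
  shows "trilinear_map K V (tensor3 K V) (pure_tensor3 K V)"
  unfolding pure_tensor3_def
  by (intro trilinear_mapI bilinear_map_left[OF pure_tensor_bilinear] bilinear_map_right[OF pure_tensor_bilinear]
      pure_tensor_closed tensor_is_module assms linear_map_id)

lemma tensor3_linear_eqI:
  assumes V: "module K V" and U: "module K U"
    and f: "linear_map K (tensor3 K V) U f" and g: "linear_map K (tensor3 K V) U g"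
    and eq: "\<And>x y z. \<lbrakk>x \<in> carrier V; y \<in> carrier V; z \<in> carrier V\<rbrakk> \<Longrightarrow>
      f (pure_tensor3 K V x y z) = g (pure_tensor3 K V x y z)"
    and X: "X \<in> carrier (tensor3 K V)"
  shows "f X = g X"
proof (rule tensor_linear_eqI[OF tensor_is_module[OF V V] V U f g _ X])
  fix Y z assume Y: "Y \<in> carrier (tensor2 K V)" and z: "z \<in> carrier V"
  have p: "linear_map K (tensor2 K V) (tensor3 K V) (\<lambda>Y. pure_tensor K (tensor2 K V) V Y z)"
    by (intro bilinear_map_left[OF pure_tensor_bilinear] tensor_is_module V z linear_map_id)
  show "f (pure_tensor K (tensor2 K V) V Y z) = g (pure_tensor K (tensor2 K V) V Y z)"
    by (rule tensor_linear_eqI[OF V V U linear_map_comp[OF f p] linear_map_comp[OF g p] _ Y])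
      (use eq z in \<open>simp add: pure_tensor3_def\<close>)
qed

section \<open>Multiplication of tensors\<close>

context balanced_extension
begin

lemma lift_representative:
  assumes X: "X \<in> carrier T" and x: "x \<in> X"
  shows "Poly_Mapping.keys x \<subseteq> S" "tensor_lift U f X = \<phi> x"
proof -
  obtain x' where x': "Poly_Mapping.keys x' \<subseteq> S" "X = cls x'"
    using X by (rule class_cases)
  obtain n where n: "n \<in> N" "x = n + x'"
    using x unfolding x'(2) class_eq by blast
  show k: "Poly_Mapping.keys x \<subseteq> S"
    unfolding n(2) by (rule subset_trans[OF keys_add Un_least[OF kernel_keys[OF n(1)] x'(1)]])
  show "tensor_lift U f X = \<phi> x"
    unfolding x'(2) lift_class[OF x'(1)]
    by (rule frag_sum_representative[OF x[unfolded x'(2)] x'(1), symmetric])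
qed

end

context tensor_product
begin

text \<open>Needed where a union over representatives has constant terms: it equals that constant
  only if there is a representative.\<close>

lemma class_nonempty: "X \<in> carrier T \<Longrightarrow> X \<noteq> {}"
  by (elim class_cases) (use class_self in blast)

end

text \<open>Formulated through bilinearity of the two multiplications so that the construction
  iterates: for (H \<otimes> H) \<otimes> H, bilinearity on the left factor is supplied by
  \<open>tensor_mult_bilinear\<close>.\<close>

locale tensor_product_algebra = tensor_product K V W for K V W +
  assumes mult_V: "bilinear_map K V V V (\<otimes>\<^bsub>V\<^esub>)" and mult_W: "bilinear_map K W W W (\<otimes>\<^bsub>W\<^esub>)"
begin

sublocale T: module K T
  by (rule tensor_module)

abbreviation mult_pure where "mult_pure v w v' w' \<equiv> (v \<otimes>\<^bsub>V\<^esub> v') \<otimes>\<^sub>t (w \<otimes>\<^bsub>W\<^esub> w')"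

lemmas mods = V.module_axioms W.module_axioms T.module_axioms

lemma mult_pure_bilinear:
  "\<lbrakk>v \<in> carrier V; w \<in> carrier W\<rbrakk> \<Longrightarrow> bilinear_map K V W T (mult_pure v w)"
  by (intro bilinear_mapI bilinear_map_left[OF pure_tensor_bilinear] bilinear_map_right[OF pure_tensor_bilinear]
      bilinear_map_left[OF mult_V] bilinear_map_right[OF mult_V] bilinear_map_left[OF mult_W] bilinear_map_right[OF mult_W]
      bilinear_map_closed[OF mult_V] bilinear_map_closed[OF mult_W] mods linear_map_id)

lemma mult_lift_bilinear:
  assumes Y: "Y \<in> carrier T"
  shows "bilinear_map K V W T (\<lambda>v w. tensor_lift T (mult_pure v w) Y)"
  by (rule bilinear_mapI) (assumption | rule tensor_lift_linear_param[OF mods(1,2,3) _ Y] mult_pure_bilinear mods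
      bilinear_map_left[OF pure_tensor_bilinear] bilinear_map_right[OF pure_tensor_bilinear]
      bilinear_map_left[OF mult_V] bilinear_map_left[OF mult_W]
      bilinear_map_right[OF pure_tensor_bilinear] bilinear_map_closed[OF mult_V] bilinear_map_closed[OF mult_W] linear_map_id)+

text \<open>Independence of representatives is needed in both arguments. The product is a lift in
  \<open>Y\<close> for every fixed pair \<open>(v, w)\<close>, and the result is balanced in
  \<open>(v, w)\<close>, hence a lift in \<open>X\<close>.\<close>

lemma tensor_mult:
  assumes X: "X \<in> carrier T" and Y: "Y \<in> carrier T"
  shows "X \<otimes>\<^bsub>T\<^esub> Y = tensor_lift T (\<lambda>v w. tensor_lift T (mult_pure v w) Y) X"
proof -
  let ?m = "\<lambda>x y. cls (frag_extend (\<lambda>(v, w). frag_extend (\<lambda>(v', w').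
      frag_of (v \<otimes>\<^bsub>V\<^esub> v', w \<otimes>\<^bsub>W\<^esub> w')) y) x)"
  interpret E: balanced_extension K V W T "\<lambda>v w. tensor_lift T (mult_pure v w) Y"
    by (rule balanced_extensionI[OF T.abelian_group_axioms bilinear_map_balanced[OF mods(1,2) mult_lift_bilinear[OF Y]]])
  have inner: "balanced_extension K V W T (mult_pure v w)" if "v \<in> carrier V" "w \<in> carrier W" for v w
    by (rule balanced_extensionI[OF T.abelian_group_axioms bilinear_map_balanced[OF mods(1,2) mult_pure_bilinear[OF that]]])
  \<comment> \<open>For a fixed representative \<open>y\<close>, the class of the formal product is
    additive in \<open>x\<close>, and its value at a basis element is a lift evaluated at
    \<open>Y\<close>, which no longer depends on \<open>y\<close>.\<close>
  have step: "?m x y = frag_sum T (\<lambda>p. tensor_lift T (mult_pure (fst p) (snd p)) Y) x"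
    if x: "Poly_Mapping.keys x \<subseteq> S" and y: "y \<in> Y" for x y
  proof -
    have yS: "Poly_Mapping.keys y \<subseteq> S"
      by (rule E.lift_representative(1)[OF Y y])
    have e: "Poly_Mapping.keys (frag_extend (\<lambda>(v', w'). frag_of (v \<otimes>\<^bsub>V\<^esub> v', w \<otimes>\<^bsub>W\<^esub> w')) y) \<subseteq> S \<and>
        cls (frag_extend (\<lambda>(v', w'). frag_of (v \<otimes>\<^bsub>V\<^esub> v', w \<otimes>\<^bsub>W\<^esub> w')) y)
        = frag_sum T (\<lambda>p. cls (case p of (v', w') \<Rightarrow> frag_of (v \<otimes>\<^bsub>V\<^esub> v', w \<otimes>\<^bsub>W\<^esub> w'))) y"
      if "v \<in> carrier V" "w \<in> carrier W" for v w
      by (rule class_frag_extend[OF _ yS])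
        (use that in \<open>auto simp: keys_frag_of bilinear_map_closed[OF mult_V] bilinear_map_closed[OF mult_W]\<close>)
    have k: "Poly_Mapping.keys (case p of (v, w) \<Rightarrow> frag_extend (\<lambda>(v', w').
      frag_of (v \<otimes>\<^bsub>V\<^esub> v', w \<otimes>\<^bsub>W\<^esub> w')) y) \<subseteq> S" if "p \<in> S" for p
      using e[of "fst p" "snd p", THEN conjunct1] that by (simp add: case_prod_beta mem_Times_iff)
    have l: "cls (case p of (v, w) \<Rightarrow> frag_extend (\<lambda>(v', w').
      frag_of (v \<otimes>\<^bsub>V\<^esub> v', w \<otimes>\<^bsub>W\<^esub> w')) y) = tensor_lift T (mult_pure (fst p) (snd p)) Y" if "p \<in> S" for p
    proof -
      have "fst p \<in> carrier V" "snd p \<in> carrier W"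
        using that by auto
      from e[OF this, THEN conjunct2] balanced_extension.lift_representative(2)[OF inner[OF this] Y y]
      show ?thesis
        by (simp only: case_prod_beta pure_tensor_def)
    qed
    have "?m x y = frag_sum T (\<lambda>p. cls (case p of (v, w) \<Rightarrow> frag_extend (\<lambda>(v', w').
      frag_of (v \<otimes>\<^bsub>V\<^esub> v', w \<otimes>\<^bsub>W\<^esub> w')) y)) x"
      by (rule class_frag_extend[THEN conjunct2, OF k x])
    also have "\<dots> = frag_sum T (\<lambda>p. tensor_lift T (mult_pure (fst p) (snd p)) Y) x"
      unfolding frag_sum_def
    proof (rule T.add.finprod_cong'[OF refl Pi_I])
      fix p assume "p \<in> Poly_Mapping.keys x"
      then have p: "p \<in> S"
        by (rule subsetD[OF x])
      then show "[Poly_Mapping.lookup x p] \<cdot>\<^bsub>T\<^esub> tensor_lift T (mult_pure (fst p) (snd p)) Y \<in> carrier T"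
        by (intro T.add.int_pow_closed E.f_closed) (simp_all add: mem_Times_iff)
      show "[Poly_Mapping.lookup x p] \<cdot>\<^bsub>T\<^esub> cls (case p of (v, w) \<Rightarrow> frag_extend (\<lambda>(v', w').
          frag_of (v \<otimes>\<^bsub>V\<^esub> v', w \<otimes>\<^bsub>W\<^esub> w')) y)
        = [Poly_Mapping.lookup x p] \<cdot>\<^bsub>T\<^esub> tensor_lift T (mult_pure (fst p) (snd p)) Y"
        by (simp only: l[OF p])
    qed
    finally show ?thesis .
  qed
  have "(\<lambda>x. \<Union>y\<in>Y. ?m x y) ` X = {tensor_lift T (\<lambda>v w. tensor_lift T (mult_pure v w) Y) X}"
  proof (rule E.image_representatives[OF X])
    fix x :: "'c \<times> 'e \<Rightarrow>\<^sub>0 int" assume x: "Poly_Mapping.keys x \<subseteq> S"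
    have "(\<lambda>y. ?m x y) ` Y = {frag_sum T (\<lambda>p. tensor_lift T (mult_pure (fst p) (snd p)) Y) x}"
      by (simp only: image_cong[OF refl step[OF x]] image_constant_conv class_nonempty[OF Y] if_False)
    then show "(\<Union>y\<in>Y. ?m x y) = frag_sum T (\<lambda>p. tensor_lift T (mult_pure (fst p) (snd p)) Y) x"
      by simp
  qed
  then show ?thesis
    unfolding tensor_def Let_def by simp
qed

lemma tensor_mult_bilinear: "bilinear_map K T T T (\<otimes>\<^bsub>T\<^esub>)"
proof (rule bilinear_mapI)
  fix Y assume Y: "Y \<in> carrier T"
  show "linear_map K T T (\<lambda>X. X \<otimes>\<^bsub>T\<^esub> Y)"
    by (rule linear_map_cong[OF mods(3) tensor_lift_linear[OF mods mult_lift_bilinear[OF Y]]])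
      (simp add: tensor_mult Y)
next
  fix X assume X: "X \<in> carrier T"
  have "linear_map K T T (\<lambda>Y. tensor_lift T (\<lambda>v w. tensor_lift T (mult_pure v w) Y) X)"
    by (rule tensor_lift_linear_param[OF mods mods(3) X] mult_lift_bilinear tensor_lift_linear[OF mods]
        mult_pure_bilinear | assumption)+
  then show "linear_map K T T (\<lambda>Y. X \<otimes>\<^bsub>T\<^esub> Y)"
    by (rule linear_map_cong[OF mods(3)]) (simp add: tensor_mult X)
qed

lemma tensor_mult_pure:
  "\<lbrakk>v \<in> carrier V; w \<in> carrier W; v' \<in> carrier V; w' \<in> carrier W\<rbrakk> \<Longrightarrow>
    (v \<otimes>\<^sub>t w) \<otimes>\<^bsub>T\<^esub> (v' \<otimes>\<^sub>t w') = (v \<otimes>\<^bsub>V\<^esub> v') \<otimes>\<^sub>t (w \<otimes>\<^bsub>W\<^esub> w')"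
  by (simp add: tensor_mult tensor_lift_pure[OF mods mult_lift_bilinear] tensor_lift_pure[OF mods mult_pure_bilinear])

end

lemma bilinear_map_finsum:
  assumes "module K V" "module K W" "module K U" "bilinear_map K V W U f" "finite I" "finite J"
    and g: "\<And>i. i \<in> I \<Longrightarrow> g i \<in> carrier V" and h: "\<And>j. j \<in> J \<Longrightarrow> h j \<in> carrier W"
  shows "f (\<Oplus>\<^bsub>V\<^esub>i\<in>I. g i) (\<Oplus>\<^bsub>W\<^esub>j\<in>J. h j) = (\<Oplus>\<^bsub>U\<^esub>i\<in>I. \<Oplus>\<^bsub>U\<^esub>j\<in>J. f (g i) (h j))"
proof -
  have H: "(\<Oplus>\<^bsub>W\<^esub>j\<in>J. h j) \<in> carrier W"
    by (rule module_finsum_closed[OF assms(2) h])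
  have "f (\<Oplus>\<^bsub>V\<^esub>i\<in>I. g i) (\<Oplus>\<^bsub>W\<^esub>j\<in>J. h j) = (\<Oplus>\<^bsub>U\<^esub>i\<in>I. f (g i) (\<Oplus>\<^bsub>W\<^esub>j\<in>J. h j))"
    by (rule linear_map_finsum[OF assms(1,3) _ assms(5) g])
      (rule bilinear_map_left[OF assms(4) H linear_map_id])
  also have "\<dots> = (\<Oplus>\<^bsub>U\<^esub>i\<in>I. \<Oplus>\<^bsub>U\<^esub>j\<in>J. f (g i) (h j))"
  proof (rule module_finsum_cong[OF assms(3)])
    fix i assume i: "i \<in> I"
    show "(\<Oplus>\<^bsub>U\<^esub>j\<in>J. f (g i) (h j)) \<in> carrier U"
      by (rule module_finsum_closed[OF assms(3)]) (rule bilinear_map_closed[OF assms(4) g[OF i] h])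
    show "f (g i) (\<Oplus>\<^bsub>W\<^esub>j\<in>J. h j) = (\<Oplus>\<^bsub>U\<^esub>j\<in>J. f (g i) (h j))"
      by (rule linear_map_finsum[OF assms(2,3) _ assms(6) h])
        (rule bilinear_map_right[OF assms(4) g[OF i] linear_map_id])
  qed
  finally show ?thesis .
qed

text \<open>The reversal is a product of three adjacent exchanges. It reconciles the order in which
  crossings are applied with the nesting of the sums in the Yang-Baxter identity.\<close>

lemma module_finsum_reverse3:
  assumes U: "module K U" and I: "finite I"
    and f: "\<And>i j k. i \<in> I \<Longrightarrow> j \<in> I \<Longrightarrow> k \<in> I \<Longrightarrow> f i j k \<in> carrier U"
  shows "(\<Oplus>\<^bsub>U\<^esub>i\<in>I. \<Oplus>\<^bsub>U\<^esub>j\<in>I. \<Oplus>\<^bsub>U\<^esub>k\<in>I. f i j k) = (\<Oplus>\<^bsub>U\<^esub>k\<in>I. \<Oplus>\<^bsub>U\<^esub>j\<in>I. \<Oplus>\<^bsub>U\<^esub>i\<in>I. f i j k)"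
proof -
  note c = module_finsum_closed[OF U]
  have "(\<Oplus>\<^bsub>U\<^esub>i\<in>I. \<Oplus>\<^bsub>U\<^esub>j\<in>I. \<Oplus>\<^bsub>U\<^esub>k\<in>I. f i j k) = (\<Oplus>\<^bsub>U\<^esub>j\<in>I. \<Oplus>\<^bsub>U\<^esub>i\<in>I. \<Oplus>\<^bsub>U\<^esub>k\<in>I. f i j k)"
    by (rule module_finsum_swap[OF U I I]) (intro c f)
  also have "\<dots> = (\<Oplus>\<^bsub>U\<^esub>j\<in>I. \<Oplus>\<^bsub>U\<^esub>k\<in>I. \<Oplus>\<^bsub>U\<^esub>i\<in>I. f i j k)"
    by (rule module_finsum_cong[OF U], (intro c f; assumption), rule module_finsum_swap[OF U I I f])
  also have "\<dots> = (\<Oplus>\<^bsub>U\<^esub>k\<in>I. \<Oplus>\<^bsub>U\<^esub>j\<in>I. \<Oplus>\<^bsub>U\<^esub>i\<in>I. f i j k)"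
    by (rule module_finsum_swap[OF U I I]) (intro c f)
  finally show ?thesis .
qed

section \<open>Rebracketing of triple tensors\<close>

context
  fixes K :: "('k, 'm) ring_scheme" and V :: "('k, 'v, 'p) module_scheme"
  assumes V: "module K V"
begin

lemmas tensor_mods = V tensor_is_module[OF V V] tensor_is_module[OF tensor_is_module[OF V V] V]
  tensor_is_module[OF V tensor_is_module[OF V V]]

lemma pure_tensor3_linear:
  assumes g: "linear_map K M V g"
  shows "y \<in> carrier V \<Longrightarrow> z \<in> carrier V \<Longrightarrow> linear_map K M (tensor3 K V) (\<lambda>x. pure_tensor3 K V (g x) y z)"
    and "y \<in> carrier V \<Longrightarrow> z \<in> carrier V \<Longrightarrow> linear_map K M (tensor3 K V) (\<lambda>x. pure_tensor3 K V y (g x) z)"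
    and "y \<in> carrier V \<Longrightarrow> z \<in> carrier V \<Longrightarrow> linear_map K M (tensor3 K V) (\<lambda>x. pure_tensor3 K V y z (g x))"
proof -
  note p = pure_tensor3_trilinear[OF V, unfolded trilinear_map_def, rule_format]
  assume y: "y \<in> carrier V" and z: "z \<in> carrier V"
  show "linear_map K M (tensor3 K V) (\<lambda>x. pure_tensor3 K V (g x) y z)"
    by (rule linear_map_comp[OF p[OF y z, THEN conjunct1] g])
  show "linear_map K M (tensor3 K V) (\<lambda>x. pure_tensor3 K V y (g x) z)"
    by (rule linear_map_comp[OF p[OF y z, THEN conjunct2, THEN conjunct1] g])
  show "linear_map K M (tensor3 K V) (\<lambda>x. pure_tensor3 K V y z (g x))"
    by (rule linear_map_comp[OF p[OF y z, THEN conjunct2, THEN conjunct2] g])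
qed

lemma pure_tensor3_closed:
  "\<lbrakk>x \<in> carrier V; y \<in> carrier V; z \<in> carrier V\<rbrakk> \<Longrightarrow> pure_tensor3 K V x y z \<in> carrier (tensor3 K V)"
  unfolding pure_tensor3_def by (intro pure_tensor_closed tensor_mods)

lemma pure_tensor3_bilinear23:
  "x \<in> carrier V \<Longrightarrow> bilinear_map K V V (tensor3 K V) (\<lambda>y z. pure_tensor3 K V x y z)"
  by (rule bilinear_mapI) (assumption | rule pure_tensor3_linear linear_map_id)+

lemma assoc_left_bilinear:
  "bilinear_map K V (tensor2 K V) (tensor3 K V) (\<lambda>x. tensor_lift (tensor3 K V) (\<lambda>y z. pure_tensor3 K V x y z))"
  by (rule bilinear_mapI)
    (assumption | rule tensor_lift_linear_param[OF V V _ V] pure_tensor3_bilinear23 tensor_mods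
      tensor_lift_linear[OF V V] pure_tensor3_linear linear_map_id)+

lemma assoc_left_linear: "linear_map K (tensor K V (tensor2 K V)) (tensor3 K V) (assoc_left K V)"
  unfolding assoc_left_def by (intro tensor_lift_linear tensor_mods assoc_left_bilinear)

lemma assoc_left_pure:
  "x \<in> carrier V \<Longrightarrow> Y \<in> carrier (tensor2 K V) \<Longrightarrow>
    assoc_left K V (pure_tensor K V (tensor2 K V) x Y) = tensor_lift (tensor3 K V) (\<lambda>y z. pure_tensor3 K V x y z) Y"
  unfolding assoc_left_def by (rule tensor_lift_pure) (intro tensor_mods assoc_left_bilinear)+

lemma assoc_left_pure3:
  "\<lbrakk>x \<in> carrier V; y \<in> carrier V; z \<in> carrier V\<rbrakk> \<Longrightarrow>
    assoc_left K V (pure_tensor K V (tensor2 K V) x (pure_tensor K V V y z)) = pure_tensor3 K V x y z"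
  by (simp add: assoc_left_pure pure_tensor_closed tensor_mods tensor_lift_pure[OF _ _ _ pure_tensor3_bilinear23])

lemma assoc_right_trilinear:
  "trilinear_map K V (tensor K V (tensor2 K V)) (\<lambda>x y z. pure_tensor K V (tensor2 K V) x (pure_tensor K V V y z))"
  by (rule trilinear_mapI)
    (assumption | rule bilinear_map_left[OF pure_tensor_bilinear] bilinear_map_right[OF pure_tensor_bilinear]
      pure_tensor_closed tensor_mods linear_map_id)+

lemma assoc_right_linear: "linear_map K (tensor3 K V) (tensor K V (tensor2 K V)) (assoc_right K V)"
  and assoc_right_pure3: "\<lbrakk>x \<in> carrier V; y \<in> carrier V; z \<in> carrier V\<rbrakk> \<Longrightarrow>
    assoc_right K V (pure_tensor3 K V x y z) = pure_tensor K V (tensor2 K V) x (pure_tensor K V V y z)"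
proof -
  interpret trilinear K V "tensor K V (tensor2 K V)" "\<lambda>x y z. pure_tensor K V (tensor2 K V) x (pure_tensor K V V y z)"
    by (intro trilinear.intro trilinear_axioms.intro tensor_mods assoc_right_trilinear)
  have e: "assoc_right K V = tensor_lift3 (tensor K V (tensor2 K V)) (\<lambda>x y z. pure_tensor K V (tensor2 K V) x (pure_tensor K V V y z))"
    by (simp add: assoc_right_def tensor_lift3_def fun_eq_iff)
  show "linear_map K (tensor3 K V) (tensor K V (tensor2 K V)) (assoc_right K V)"
    unfolding e by (rule lift3_linear)
  show "assoc_right K V (pure_tensor3 K V x y z) = pure_tensor K V (tensor2 K V) x (pure_tensor K V V y z)"
    if "x \<in> carrier V" "y \<in> carrier V" "z \<in> carrier V"
    unfolding e by (rule lift3_pure[OF that])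
qed

end

text \<open>The counterpart of \<open>lift3_pure_left\<close> for id \<otimes> \<Delta>: the right
  factor \<open>Y\<close> is arbitrary, and the rebracketing is absorbed into the
  evaluation.\<close>

lemma (in trilinear) lift3_assoc_left:
  assumes x: "x \<in> carrier V" and Y: "Y \<in> carrier (tensor2 K V)"
  shows "tensor_lift3 U f (assoc_left K V (pure_tensor K V (tensor2 K V) x Y)) = tensor_lift U (\<lambda>y z. f x y z) Y"
  unfolding assoc_left_pure[OF V.module_axioms x Y]
  by (rule linear_map_tensor_lift[OF V.module_axioms V.module_axioms tensor_mods(3)[OF V.module_axioms]
        U.module_axioms lift3_linear pure_tensor3_bilinear23[OF V.module_axioms x] lift3_pure Y]) (rule x)

text \<open>Under a bilinear map a product of tensors becomes a double Sweedler sum. This allows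
  multiplication by a comultiplied element, for which there is no chosen presentation to
  expand.\<close>

lemma (in tensor_product_algebra) tensor_lift_mult:
  assumes U: "module K U" and g: "bilinear_map K V W U g" and X: "X \<in> carrier T" and Y: "Y \<in> carrier T"
  shows "tensor_lift U g (X \<otimes>\<^bsub>T\<^esub> Y)
    = tensor_lift U (\<lambda>v w. tensor_lift U (\<lambda>v' w'. g (v \<otimes>\<^bsub>V\<^esub> v') (w \<otimes>\<^bsub>W\<^esub> w')) Y) X"
  unfolding tensor_mult[OF X Y]
proof (rule linear_map_tensor_lift[OF mods(1,2,3) U tensor_lift_linear[OF mods(1,2) U g] mult_lift_bilinear[OF Y] _ X])
  fix v w assume v: "v \<in> carrier V" and w: "w \<in> carrier W"
  show "tensor_lift U g (tensor_lift T (mult_pure v w) Y)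
    = tensor_lift U (\<lambda>v' w'. g (v \<otimes>\<^bsub>V\<^esub> v') (w \<otimes>\<^bsub>W\<^esub> w')) Y"
    by (rule linear_map_tensor_lift[OF mods(1,2,3) U tensor_lift_linear[OF mods(1,2) U g] mult_pure_bilinear[OF v w] _ Y])
      (simp add: tensor_lift_pure[OF mods(1,2) U g] v w bilinear_map_closed[OF mult_V] bilinear_map_closed[OF mult_W])
qed

lemma tensor_lift_flip:
  assumes V: "module K V" and W: "module K W" and U: "module K U" and g: "bilinear_map K W V U g"
    and X: "X \<in> carrier (tensor K V W)"
  shows "tensor_lift U g (tensor_flip K V W X) = tensor_lift U (\<lambda>v w. g w v) X"
  unfolding tensor_flip_def
  by (rule linear_map_tensor_lift[OF V W tensor_is_module[OF W V] U tensor_lift_linear[OF W V U g]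
        tensor_flip_bilinear[OF V W] _ X])
    (rule tensor_lift_pure[OF W V U g])

section \<open>The R-matrix\<close>

text \<open>The presentation of \<open>R\<close> is part of the data, so that the value of a linear
  map at \<open>R\<close> is a finite sum over \<open>I\<close>.\<close>

locale r_matrix =
  fixes K :: "('k, 'm) ring_scheme" and H :: "('k, 'h, 'p) module_scheme" and \<Delta> \<epsilon> S R
    and I :: "'i set" and s t :: "'i \<Rightarrow> 'h"
  assumes quasitriangular: "quasitriangular_hopf_algebra K H \<Delta> \<epsilon> S R"
    and finite_I: "finite I" and s_closed: "\<And>i. i \<in> I \<Longrightarrow> s i \<in> carrier H"
    and t_closed: "\<And>i. i \<in> I \<Longrightarrow> t i \<in> carrier H"
    and R_sum: "R = (\<Oplus>\<^bsub>tensor2 K H\<^esub>i\<in>I. pure_tensor K H H (s i) (t i))"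
begin

lemma mod_H: "module K H"
  and mult_bilinear: "bilinear_map K H H H (\<otimes>\<^bsub>H\<^esub>)"
  and mult_assoc: "\<lbrakk>x \<in> carrier H; y \<in> carrier H; z \<in> carrier H\<rbrakk> \<Longrightarrow> (x \<otimes>\<^bsub>H\<^esub> y) \<otimes>\<^bsub>H\<^esub> z = x \<otimes>\<^bsub>H\<^esub> (y \<otimes>\<^bsub>H\<^esub> z)"
  and one_closed: "\<one>\<^bsub>H\<^esub> \<in> carrier H"
  and mult_one_left: "x \<in> carrier H \<Longrightarrow> \<one>\<^bsub>H\<^esub> \<otimes>\<^bsub>H\<^esub> x = x"
  and mult_one_right: "x \<in> carrier H \<Longrightarrow> x \<otimes>\<^bsub>H\<^esub> \<one>\<^bsub>H\<^esub> = x"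
  and comult_linear: "linear_map K H (tensor2 K H) \<Delta>"
  and counit_linear: "linear_map K H (scalars K) \<epsilon>"
  and counit_one: "\<epsilon> \<one>\<^bsub>H\<^esub> = \<one>\<^bsub>K\<^esub>"
proof -
  interpret Q: quasitriangular_hopf_algebra K H \<Delta> \<epsilon> S R
    by (rule quasitriangular)
  have A: "ring H"
    by (rule assoc_algebra.axioms(2)[OF Q.assoc_algebra_axioms])
  show mod_H: "module K H" ..
  show "bilinear_map K H H H (\<otimes>\<^bsub>H\<^esub>)"
    by (intro bilinear_mapI linear_mapI) (simp_all add: ring.ring_simprules[OF A] Q.smult_mult_left Q.smult_mult_right)
  show "linear_map K H (tensor2 K H) \<Delta>" "linear_map K H (scalars K) \<epsilon>"
    by (rule Q.comult_linear, rule Q.counit_linear)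
  show "\<epsilon> \<one>\<^bsub>H\<^esub> = \<one>\<^bsub>K\<^esub>"
    using Q.counit_hom by (rule ring_hom_one)
  show "x \<in> carrier H \<Longrightarrow> y \<in> carrier H \<Longrightarrow> z \<in> carrier H \<Longrightarrow> (x \<otimes>\<^bsub>H\<^esub> y) \<otimes>\<^bsub>H\<^esub> z = x \<otimes>\<^bsub>H\<^esub> (y \<otimes>\<^bsub>H\<^esub> z)"
    "\<one>\<^bsub>H\<^esub> \<in> carrier H" "x \<in> carrier H \<Longrightarrow> \<one>\<^bsub>H\<^esub> \<otimes>\<^bsub>H\<^esub> x = x" "x \<in> carrier H \<Longrightarrow> x \<otimes>\<^bsub>H\<^esub> \<one>\<^bsub>H\<^esub> = x"
    by (simp_all add: monoid.m_assoc[OF ring.is_monoid[OF A]])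
qed

lemmas mods = tensor_mods[OF mod_H]
lemmas mult_closed = bilinear_map_closed[OF mult_bilinear]
lemmas comult_closed = linear_map_closed[OF comult_linear]
lemmas mult_linear = bilinear_map_left[OF mult_bilinear] bilinear_map_right[OF mult_bilinear]
lemmas pure_linear = bilinear_map_left[OF pure_tensor_bilinear] bilinear_map_right[OF pure_tensor_bilinear]
lemmas finsum_linear = linear_map_sum[OF _ _ finite_I]

sublocale T2: tensor_product_algebra K H H
  by (rule tensor_product_algebra.intro[OF tensor_product.intro[OF mods(1,1)]
        tensor_product_algebra_axioms.intro[OF mult_bilinear mult_bilinear]])

sublocale T3: tensor_product_algebra K "tensor2 K H" H
  by (rule tensor_product_algebra.intro[OF tensor_product.intro[OF mods(2,1)]
        tensor_product_algebra_axioms.intro[OF T2.tensor_mult_bilinear mult_bilinear]])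

lemma R_closed: "R \<in> carrier (tensor2 K H)"
  unfolding R_sum by (intro module_finsum_closed[OF mods(2)] pure_tensor_closed mod_H s_closed t_closed)

lemma linear_R:
  assumes U: "module K U" and f: "linear_map K (tensor2 K H) U f"
    and g: "\<And>x y. x \<in> carrier H \<Longrightarrow> y \<in> carrier H \<Longrightarrow> f (pure_tensor K H H x y) = g x y"
  shows "f R = (\<Oplus>\<^bsub>U\<^esub>i\<in>I. g (s i) (t i))"
proof -
  note p = pure_tensor_closed[OF mod_H mod_H s_closed t_closed]
  have "f R = (\<Oplus>\<^bsub>U\<^esub>i\<in>I. f (pure_tensor K H H (s i) (t i)))"
    unfolding R_sum by (rule linear_map_finsum[OF mods(2) U f finite_I p])
  also have "\<dots> = (\<Oplus>\<^bsub>U\<^esub>i\<in>I. g (s i) (t i))"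
  proof (rule module_finsum_cong[OF U])
    fix i assume i: "i \<in> I"
    show e: "f (pure_tensor K H H (s i) (t i)) = g (s i) (t i)"
      by (rule g[OF s_closed[OF i] t_closed[OF i]])
    show "g (s i) (t i) \<in> carrier U"
      using linear_map_closed[OF f p[OF i i]] by (simp only: e)
  qed
  finally show ?thesis .
qed

lemma lift_R:
  assumes U: "module K U" and g: "bilinear_map K H H U g"
  shows "tensor_lift U g R = (\<Oplus>\<^bsub>U\<^esub>i\<in>I. g (s i) (t i))"
  by (rule linear_R[OF U tensor_lift_linear[OF mod_H mod_H U g] tensor_lift_pure[OF mod_H mod_H U g]])

lemma leg12_R: "leg12 K H R = (\<Oplus>\<^bsub>tensor3 K H\<^esub>i\<in>I. pure_tensor3 K H (s i) (t i) \<one>\<^bsub>H\<^esub>)"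
  and leg13_R: "leg13 K H R = (\<Oplus>\<^bsub>tensor3 K H\<^esub>i\<in>I. pure_tensor3 K H (s i) \<one>\<^bsub>H\<^esub> (t i))"
  and leg23_R: "leg23 K H R = (\<Oplus>\<^bsub>tensor3 K H\<^esub>i\<in>I. pure_tensor3 K H \<one>\<^bsub>H\<^esub> (s i) (t i))"
  unfolding leg12_def leg13_def leg23_def
  by (assumption | rule lift_R mods bilinear_mapI pure_tensor3_linear[OF mod_H] linear_map_id one_closed)+

lemma pure_tensor3_mult:
  "\<lbrakk>x \<in> carrier H; y \<in> carrier H; z \<in> carrier H; x' \<in> carrier H; y' \<in> carrier H; z' \<in> carrier H\<rbrakk> \<Longrightarrow>
    pure_tensor3 K H x y z \<otimes>\<^bsub>tensor3 K H\<^esub> pure_tensor3 K H x' y' z'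
    = pure_tensor3 K H (x \<otimes>\<^bsub>H\<^esub> x') (y \<otimes>\<^bsub>H\<^esub> y') (z \<otimes>\<^bsub>H\<^esub> z')"
  unfolding pure_tensor3_def by (simp add: T3.tensor_mult_pure T2.tensor_mult_pure)

section \<open>The axioms of the R-matrix as identities in an arbitrary module\<close>

lemma trilinearI: "module K U \<Longrightarrow> trilinear_map K H U F \<Longrightarrow> trilinear K H U F"
  by (intro trilinear.intro trilinear_axioms.intro mod_H)

text \<open>The product \<open>R\<^sub>1\<^sub>3 R\<^sub>2\<^sub>3\<close> expands to the sum of the
  \<open>s i \<otimes> s j \<otimes> t i t j\<close>, since each of the first two slots meets a
  unit.\<close>

lemma comult_left_R:
  assumes U: "module K U" and F: "trilinear_map K H U F"
  shows "(\<Oplus>\<^bsub>U\<^esub>i\<in>I. tensor_lift U (\<lambda>a b. F a b (t i)) (\<Delta> (s i)))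
    = (\<Oplus>\<^bsub>U\<^esub>i\<in>I. \<Oplus>\<^bsub>U\<^esub>j\<in>I. F (s i) (s j) (t i \<otimes>\<^bsub>H\<^esub> t j))"
proof -
  interpret F: trilinear K H U F
    by (rule trilinearI[OF U F])
  let ?f = "tensor_lift3 U F"
  have c: "linear_map K (tensor2 K H) U (\<lambda>X. ?f (comult_left K H \<Delta> X))"
    unfolding comult_left_def
    by (rule linear_map_comp[OF F.lift3_linear tensor_map_linear]) (intro mods comult_linear linear_map_id)+
  have "?f (comult_left K H \<Delta> R) = (\<Oplus>\<^bsub>U\<^esub>i\<in>I. tensor_lift U (\<lambda>a b. F a b (t i)) (\<Delta> (s i)))"
    by (rule linear_R[OF U c])
      (simp add: comult_left_def tensor_map_pure[OF _ _ _ _ comult_linear linear_map_id] mods F.lift3_pure_left comult_closed)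
  moreover have "?f (leg13 K H R \<otimes>\<^bsub>tensor3 K H\<^esub> leg23 K H R)
      = (\<Oplus>\<^bsub>U\<^esub>i\<in>I. \<Oplus>\<^bsub>U\<^esub>j\<in>I. F (s i) (s j) (t i \<otimes>\<^bsub>H\<^esub> t j))"
  proof -
    have b: "bilinear_map K (tensor3 K H) (tensor3 K H) U (\<lambda>X Y. ?f (X \<otimes>\<^bsub>tensor3 K H\<^esub> Y))"
      by (rule bilinear_mapI) (assumption | rule linear_map_comp[OF F.lift3_linear]
        bilinear_map_left[OF T3.tensor_mult_bilinear] bilinear_map_right[OF T3.tensor_mult_bilinear] linear_map_id)+
    note p = pure_tensor3_closed[OF mod_H]
    have "?f (leg13 K H R \<otimes>\<^bsub>tensor3 K H\<^esub> leg23 K H R) = (\<Oplus>\<^bsub>U\<^esub>i\<in>I. \<Oplus>\<^bsub>U\<^esub>j\<in>I.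
        ?f (pure_tensor3 K H (s i) \<one>\<^bsub>H\<^esub> (t i) \<otimes>\<^bsub>tensor3 K H\<^esub> pure_tensor3 K H \<one>\<^bsub>H\<^esub> (s j) (t j)))"
      unfolding leg13_R leg23_R
      by (rule bilinear_map_finsum[OF mods(3) mods(3) U b finite_I finite_I])
        (assumption | rule p s_closed t_closed one_closed)+
    also have "\<dots> = (\<Oplus>\<^bsub>U\<^esub>i\<in>I. \<Oplus>\<^bsub>U\<^esub>j\<in>I. F (s i) (s j) (t i \<otimes>\<^bsub>H\<^esub> t j))"
      by (intro module_finsum_cong[OF U] module_finsum_closed[OF U])
        (simp_all add: pure_tensor3_mult s_closed t_closed one_closed mult_closed mult_one_left mult_one_right F.lift3_pure F.closed)
    finally show ?thesis .
  qed
  ultimately show ?thesis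
    by (simp only: quasitriangular_hopf_algebra.R_comult_left[OF quasitriangular])
qed

text \<open>The product \<open>R\<^sub>1\<^sub>3 R\<^sub>1\<^sub>2\<close> expands to the sum of the
  \<open>s i s j \<otimes> t j \<otimes> t i\<close>. The index of the second factor stands in the
  middle slot, so the two \<open>t\<close> appear in reverse order.\<close>

lemma comult_right_R:
  assumes U: "module K U" and F: "trilinear_map K H U F"
  shows "(\<Oplus>\<^bsub>U\<^esub>i\<in>I. tensor_lift U (\<lambda>b c. F (s i) b c) (\<Delta> (t i)))
    = (\<Oplus>\<^bsub>U\<^esub>i\<in>I. \<Oplus>\<^bsub>U\<^esub>j\<in>I. F (s i \<otimes>\<^bsub>H\<^esub> s j) (t j) (t i))"
proof -
  interpret F: trilinear K H U F
    by (rule trilinearI[OF U F])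
  let ?f = "tensor_lift3 U F"
  have c: "linear_map K (tensor2 K H) U (\<lambda>X. ?f (comult_right K H \<Delta> X))"
    unfolding comult_right_def
    by (rule linear_map_comp[OF F.lift3_linear linear_map_comp[OF assoc_left_linear[OF mod_H] tensor_map_linear]])
      (intro mods comult_linear linear_map_id)+
  have "?f (comult_right K H \<Delta> R) = (\<Oplus>\<^bsub>U\<^esub>i\<in>I. tensor_lift U (\<lambda>b c. F (s i) b c) (\<Delta> (t i)))"
    by (rule linear_R[OF U c])
      (simp add: comult_right_def tensor_map_pure[OF _ _ _ _ linear_map_id comult_linear] mods F.lift3_assoc_left comult_closed)
  moreover have "?f (leg13 K H R \<otimes>\<^bsub>tensor3 K H\<^esub> leg12 K H R)
      = (\<Oplus>\<^bsub>U\<^esub>i\<in>I. \<Oplus>\<^bsub>U\<^esub>j\<in>I. F (s i \<otimes>\<^bsub>H\<^esub> s j) (t j) (t i))"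
  proof -
    have b: "bilinear_map K (tensor3 K H) (tensor3 K H) U (\<lambda>X Y. ?f (X \<otimes>\<^bsub>tensor3 K H\<^esub> Y))"
      by (rule bilinear_mapI) (assumption | rule linear_map_comp[OF F.lift3_linear]
        bilinear_map_left[OF T3.tensor_mult_bilinear] bilinear_map_right[OF T3.tensor_mult_bilinear] linear_map_id)+
    note p = pure_tensor3_closed[OF mod_H]
    have "?f (leg13 K H R \<otimes>\<^bsub>tensor3 K H\<^esub> leg12 K H R) = (\<Oplus>\<^bsub>U\<^esub>i\<in>I. \<Oplus>\<^bsub>U\<^esub>j\<in>I.
        ?f (pure_tensor3 K H (s i) \<one>\<^bsub>H\<^esub> (t i) \<otimes>\<^bsub>tensor3 K H\<^esub> pure_tensor3 K H (s j) (t j) \<one>\<^bsub>H\<^esub>))"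
      unfolding leg13_R leg12_R
      by (rule bilinear_map_finsum[OF mods(3) mods(3) U b finite_I finite_I])
        (assumption | rule p s_closed t_closed one_closed)+
    also have "\<dots> = (\<Oplus>\<^bsub>U\<^esub>i\<in>I. \<Oplus>\<^bsub>U\<^esub>j\<in>I. F (s i \<otimes>\<^bsub>H\<^esub> s j) (t j) (t i))"
      by (intro module_finsum_cong[OF U] module_finsum_closed[OF U])
        (simp_all add: pure_tensor3_mult s_closed t_closed one_closed mult_closed mult_one_left mult_one_right F.lift3_pure F.closed)
    finally show ?thesis .
  qed
  ultimately show ?thesis
    by (simp only: quasitriangular_hopf_algebra.R_comult_right[OF quasitriangular])
qed

text \<open>The flip puts the second Sweedler component \<open>b\<close> into the first slot, where
  it meets \<open>s i\<close>, and \<open>a\<close> into the second, where it meets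
  \<open>t i\<close>. Only \<open>R\<close> is expanded into a sum; \<Delta> h stays a lift.\<close>

lemma op_comult_R:
  assumes U: "module K U" and G: "bilinear_map K H H U G" and h: "h \<in> carrier H"
  shows "tensor_lift U (\<lambda>a b. \<Oplus>\<^bsub>U\<^esub>i\<in>I. G (b \<otimes>\<^bsub>H\<^esub> s i) (a \<otimes>\<^bsub>H\<^esub> t i)) (\<Delta> h)
    = (\<Oplus>\<^bsub>U\<^esub>i\<in>I. tensor_lift U (\<lambda>a b. G (s i \<otimes>\<^bsub>H\<^esub> a) (t i \<otimes>\<^bsub>H\<^esub> b)) (\<Delta> h))"
proof -
  note D = comult_closed[OF h]
  note lin = bilinear_map_left[OF G] bilinear_map_right[OF G] mult_linear linear_map_id mult_closed
    s_closed t_closed finsum_linear mod_H U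
  have b1: "bilinear_map K H H U (\<lambda>v' w'. G (v \<otimes>\<^bsub>H\<^esub> v') (w \<otimes>\<^bsub>H\<^esub> w'))" if "v \<in> carrier H" "w \<in> carrier H" for v w
    by (rule bilinear_mapI) (assumption | rule lin that)+
  have b2: "bilinear_map K H H U (\<lambda>v w. \<Oplus>\<^bsub>U\<^esub>i\<in>I. G (v \<otimes>\<^bsub>H\<^esub> s i) (w \<otimes>\<^bsub>H\<^esub> t i))"
    by (rule bilinear_mapI) (assumption | rule lin)+
  have b3: "bilinear_map K H H U (\<lambda>v w. tensor_lift U (\<lambda>v' w'. G (v \<otimes>\<^bsub>H\<^esub> v') (w \<otimes>\<^bsub>H\<^esub> w')) X)"
    if "X \<in> carrier (tensor2 K H)" for X
    by (rule bilinear_mapI) (assumption | rule tensor_lift_linear_param[OF mod_H mod_H U mod_H] b1 that lin)+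
  have fl: "tensor_flip K H H (\<Delta> h) \<in> carrier (tensor2 K H)"
    by (rule linear_map_closed[OF tensor_flip_linear[OF mod_H mod_H] D])
  have "tensor_lift U G (tensor_flip K H H (\<Delta> h) \<otimes>\<^bsub>tensor2 K H\<^esub> R)
      = tensor_lift U (\<lambda>v w. tensor_lift U (\<lambda>v' w'. G (v \<otimes>\<^bsub>H\<^esub> v') (w \<otimes>\<^bsub>H\<^esub> w')) R) (tensor_flip K H H (\<Delta> h))"
    by (rule T2.tensor_lift_mult[OF U G fl R_closed])
  also have "\<dots> = tensor_lift U (\<lambda>v w. \<Oplus>\<^bsub>U\<^esub>i\<in>I. G (v \<otimes>\<^bsub>H\<^esub> s i) (w \<otimes>\<^bsub>H\<^esub> t i)) (tensor_flip K H H (\<Delta> h))"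
    by (rule tensor_lift_cong[OF mod_H mod_H U b3[OF R_closed] lift_R[OF U b1] fl])
  also have "\<dots> = tensor_lift U (\<lambda>a b. \<Oplus>\<^bsub>U\<^esub>i\<in>I. G (b \<otimes>\<^bsub>H\<^esub> s i) (a \<otimes>\<^bsub>H\<^esub> t i)) (\<Delta> h)"
    by (rule tensor_lift_flip[OF mod_H mod_H U b2 D])
  finally have 1: "tensor_lift U G (tensor_flip K H H (\<Delta> h) \<otimes>\<^bsub>tensor2 K H\<^esub> R) = \<dots>" .
  have "tensor_lift U G (R \<otimes>\<^bsub>tensor2 K H\<^esub> \<Delta> h)
      = tensor_lift U (\<lambda>v w. tensor_lift U (\<lambda>v' w'. G (v \<otimes>\<^bsub>H\<^esub> v') (w \<otimes>\<^bsub>H\<^esub> w')) (\<Delta> h)) R"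
    by (rule T2.tensor_lift_mult[OF U G R_closed D])
  also have "\<dots> = (\<Oplus>\<^bsub>U\<^esub>i\<in>I. tensor_lift U (\<lambda>a b. G (s i \<otimes>\<^bsub>H\<^esub> a) (t i \<otimes>\<^bsub>H\<^esub> b)) (\<Delta> h))"
    by (rule lift_R[OF U b3[OF D]])
  finally show ?thesis
    using 1 quasitriangular_hopf_algebra.R_op_comult[OF quasitriangular h] by simp
qed

text \<open>
  The quantum Yang-Baxter equation \<open>R\<^sub>1\<^sub>2 R\<^sub>1\<^sub>3 R\<^sub>2\<^sub>3 = R\<^sub>2\<^sub>3 R\<^sub>1\<^sub>3 R\<^sub>1\<^sub>2\<close>: both sides equal
  \<open>R\<^sub>1\<^sub>2 (\<Delta> \<otimes> id) R = (\<Delta>\<^sup>o\<^sup>p \<otimes> id) R \<cdot> R\<^sub>1\<^sub>2\<close>.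
\<close>

lemma yang_baxter:
  assumes U: "module K U" and F: "trilinear_map K H U F"
  shows "(\<Oplus>\<^bsub>U\<^esub>k\<in>I. \<Oplus>\<^bsub>U\<^esub>j\<in>I. \<Oplus>\<^bsub>U\<^esub>i\<in>I. F (s k \<otimes>\<^bsub>H\<^esub> s j) (t k \<otimes>\<^bsub>H\<^esub> s i) (t j \<otimes>\<^bsub>H\<^esub> t i))
    = (\<Oplus>\<^bsub>U\<^esub>k\<in>I. \<Oplus>\<^bsub>U\<^esub>j\<in>I. \<Oplus>\<^bsub>U\<^esub>i\<in>I. F (s j \<otimes>\<^bsub>H\<^esub> s i) (s k \<otimes>\<^bsub>H\<^esub> t i) (t k \<otimes>\<^bsub>H\<^esub> t j))"
proof -
  interpret F: trilinear K H U F
    by (rule trilinearI[OF U F])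
  note lin = linear_map_comp[OF F.lin1] linear_map_comp[OF F.lin2] linear_map_comp[OF F.lin3]
    mult_linear linear_map_id mult_closed s_closed t_closed finsum_linear mod_H U
  \<comment> \<open>The map in \<open>t1\<close> is \<open>F\<close> preceded by left multiplication
    with \<open>s k \<otimes> t k\<close> in the first two slots; summed over \<open>k\<close> it
    evaluates \<open>R\<^sub>1\<^sub>2 (\<Delta> \<otimes> id) R\<close>. The map in
    \<open>t2\<close> exchanges the first two arguments and multiplies by \<open>R\<close> from the
    right; it evaluates \<open>(\<Delta>\<^sup>o\<^sup>p \<otimes> id) R \<cdot>
    R\<^sub>1\<^sub>2\<close>.\<close>
  have t1: "trilinear_map K H U (\<lambda>a b c. F (s k \<otimes>\<^bsub>H\<^esub> a) (t k \<otimes>\<^bsub>H\<^esub> b) c)" if "k \<in> I" for k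
    by (rule trilinear_mapI) (assumption | rule that lin)+
  have t2: "trilinear_map K H U (\<lambda>a b c. \<Oplus>\<^bsub>U\<^esub>i\<in>I. F (b \<otimes>\<^bsub>H\<^esub> s i) (a \<otimes>\<^bsub>H\<^esub> t i) c)"
    by (rule trilinear_mapI) (assumption | rule lin)+
  have cl: "tensor_lift U (\<lambda>a b. F (s k \<otimes>\<^bsub>H\<^esub> a) (t k \<otimes>\<^bsub>H\<^esub> b) (t j)) (\<Delta> (s j)) \<in> carrier U" if "k \<in> I" "j \<in> I" for k j
    by (rule tensor_lift_closed[OF mod_H mod_H U trilinear.bilinear12[OF trilinearI[OF U t1]]])
      (use that in \<open>simp_all add: s_closed t_closed comult_closed\<close>)
  note sc = module_finsum_closed[OF U]
  have "(\<Oplus>\<^bsub>U\<^esub>k\<in>I. \<Oplus>\<^bsub>U\<^esub>j\<in>I. \<Oplus>\<^bsub>U\<^esub>i\<in>I. F (s k \<otimes>\<^bsub>H\<^esub> s j) (t k \<otimes>\<^bsub>H\<^esub> s i) (t j \<otimes>\<^bsub>H\<^esub> t i))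
    = (\<Oplus>\<^bsub>U\<^esub>k\<in>I. \<Oplus>\<^bsub>U\<^esub>j\<in>I. tensor_lift U (\<lambda>a b. F (s k \<otimes>\<^bsub>H\<^esub> a) (t k \<otimes>\<^bsub>H\<^esub> b) (t j)) (\<Delta> (s j)))"
    by (rule module_finsum_cong[OF U]) (simp_all add: comult_left_R[OF U t1] sc F.closed mult_closed s_closed t_closed)
  \<comment> \<open>The sum over \<open>k\<close> has to be the inner one, because
    \<open>op_comult_R\<close> is used for each fixed \<open>s j\<close>, with the third slot frozen
    at \<open>t j\<close>.\<close>
  also have "\<dots> = (\<Oplus>\<^bsub>U\<^esub>j\<in>I. \<Oplus>\<^bsub>U\<^esub>k\<in>I. tensor_lift U (\<lambda>a b. F (s k \<otimes>\<^bsub>H\<^esub> a) (t k \<otimes>\<^bsub>H\<^esub> b) (t j)) (\<Delta> (s j)))"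
    by (rule module_finsum_swap[OF U finite_I finite_I cl])
  also have "\<dots> = (\<Oplus>\<^bsub>U\<^esub>j\<in>I. tensor_lift U (\<lambda>a b. \<Oplus>\<^bsub>U\<^esub>i\<in>I. F (b \<otimes>\<^bsub>H\<^esub> s i) (a \<otimes>\<^bsub>H\<^esub> t i) (t j)) (\<Delta> (s j)))"
  proof (rule module_finsum_cong[OF U])
    fix j assume j: "j \<in> I"
    show "tensor_lift U (\<lambda>a b. \<Oplus>\<^bsub>U\<^esub>i\<in>I. F (b \<otimes>\<^bsub>H\<^esub> s i) (a \<otimes>\<^bsub>H\<^esub> t i) (t j)) (\<Delta> (s j)) \<in> carrier U"
      by (rule tensor_lift_closed[OF mod_H mod_H U trilinear.bilinear12[OF trilinearI[OF U t2]]])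
        (use j in \<open>simp_all add: s_closed t_closed comult_closed\<close>)
    show "(\<Oplus>\<^bsub>U\<^esub>k\<in>I. tensor_lift U (\<lambda>a b. F (s k \<otimes>\<^bsub>H\<^esub> a) (t k \<otimes>\<^bsub>H\<^esub> b) (t j)) (\<Delta> (s j)))
      = tensor_lift U (\<lambda>a b. \<Oplus>\<^bsub>U\<^esub>i\<in>I. F (b \<otimes>\<^bsub>H\<^esub> s i) (a \<otimes>\<^bsub>H\<^esub> t i) (t j)) (\<Delta> (s j))"
      by (rule op_comult_R[symmetric, OF U F.bilinear12[OF t_closed[OF j]] s_closed[OF j]])
  qed
  \<comment> \<open>The same hexagon axiom again, now for the map in \<open>t2\<close>. Its exchange
    of arguments is what puts \<open>s j\<close> before \<open>s k\<close>.\<close>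
  also have "\<dots> = (\<Oplus>\<^bsub>U\<^esub>k\<in>I. \<Oplus>\<^bsub>U\<^esub>j\<in>I. \<Oplus>\<^bsub>U\<^esub>i\<in>I. F (s j \<otimes>\<^bsub>H\<^esub> s i) (s k \<otimes>\<^bsub>H\<^esub> t i) (t k \<otimes>\<^bsub>H\<^esub> t j))"
    by (rule comult_left_R[OF U t2])
  finally show ?thesis .
qed

end

section \<open>The action of \<open>H \<otimes> H\<close> on tensor squares\<close>

text \<open>The action (h \<otimes> k)(x \<otimes> y) = hx \<otimes> ky of H \<otimes> H. With the
  multiplication of \<open>H\<close> as \<open>act\<close> it is the product of H \<otimes> H, and
  at a comultiplied element it is the right-hand side of the module-coalgebra law. Both are
  used.\<close>

definition tensor_act ::
  "('k, 'm) ring_scheme \<Rightarrow> ('k, 'c, 'p) module_scheme \<Rightarrow> ('h \<Rightarrow> 'c \<Rightarrow> 'c)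
    \<Rightarrow> ('h \<times> 'h \<Rightarrow>\<^sub>0 int) set \<Rightarrow> ('c \<times> 'c \<Rightarrow>\<^sub>0 int) set \<Rightarrow> ('c \<times> 'c \<Rightarrow>\<^sub>0 int) set"
  where "tensor_act K M act X Y =
    tensor_lift (tensor2 K M) (\<lambda>h k.
      tensor_lift (tensor2 K M) (\<lambda>x y. pure_tensor K M M (act h x) (act k y)) Y) X"

locale tensor_square_action =
  fixes K :: "('k, 'm) ring_scheme" and H :: "('k, 'h, 'p) module_scheme"
    and M :: "('k, 'c, 'q) module_scheme" and act
  assumes modH: "module K H" and modM: "module K M" and act_bilin: "bilinear_map K H M M act"
begin

lemmas mods = tensor_mods[OF modH] tensor_mods[OF modM]
lemmas lin = bilinear_map_left[OF pure_tensor_bilinear] bilinear_map_right[OF pure_tensor_bilinear]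
  bilinear_map_left[OF act_bilin] bilinear_map_right[OF act_bilin] bilinear_map_closed[OF act_bilin]
  mods linear_map_id

lemma act_pure_bilinear:
  "\<lbrakk>h \<in> carrier H; k \<in> carrier H\<rbrakk> \<Longrightarrow>
    bilinear_map K M M (tensor2 K M) (\<lambda>x y. pure_tensor K M M (act h x) (act k y))"
  by (rule bilinear_mapI) (assumption | rule lin)+

lemma act_lift_bilinear:
  assumes "Y \<in> carrier (tensor2 K M)"
  shows "bilinear_map K H H (tensor2 K M) (\<lambda>h k.
      tensor_lift (tensor2 K M) (\<lambda>x y. pure_tensor K M M (act h x) (act k y)) Y)"
  by (rule bilinear_mapI)
    (assumption | rule tensor_lift_linear_param[OF modM modM _ modH assms] act_pure_bilinear lin)+

lemma tensor_act_bilinear: "bilinear_map K (tensor2 K H) (tensor2 K M) (tensor2 K M) (tensor_act K M act)"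
  unfolding tensor_act_def
  by (rule bilinear_mapI) (assumption | rule tensor_lift_linear[OF modH modH mods(6)] act_lift_bilinear
    tensor_lift_linear_param[OF modH modH mods(6) mods(6)] tensor_lift_linear[OF modM modM mods(6)] act_pure_bilinear)+

lemma tensor_act_pure:
  "\<lbrakk>h \<in> carrier H; k \<in> carrier H; x \<in> carrier M; y \<in> carrier M\<rbrakk> \<Longrightarrow>
    tensor_act K M act (pure_tensor K H H h k) (pure_tensor K M M x y) = pure_tensor K M M (act h x) (act k y)"
  by (simp add: tensor_act_def tensor_lift_pure[OF modH modH mods(6) act_lift_bilinear]
      tensor_lift_pure[OF modM modM mods(6) act_pure_bilinear] pure_tensor_closed modM)

lemma tensor_lift_act:
  assumes U: "module K U" and g: "bilinear_map K M M U g"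
    and X: "X \<in> carrier (tensor2 K H)" and Y: "Y \<in> carrier (tensor2 K M)"
  shows "tensor_lift U g (tensor_act K M act X Y)
    = tensor_lift U (\<lambda>h k. tensor_lift U (\<lambda>x y. g (act h x) (act k y)) Y) X"
  unfolding tensor_act_def
proof (rule linear_map_tensor_lift[OF modH modH mods(6) U tensor_lift_linear[OF modM modM U g] act_lift_bilinear[OF Y] _ X])
  fix h k assume h: "h \<in> carrier H" and k: "k \<in> carrier H"
  show "tensor_lift U g (tensor_lift (tensor2 K M) (\<lambda>x y. pure_tensor K M M (act h x) (act k y)) Y)
    = tensor_lift U (\<lambda>x y. g (act h x) (act k y)) Y"
    by (rule linear_map_tensor_lift[OF modM modM mods(6) U tensor_lift_linear[OF modM modM U g] act_pure_bilinear[OF h k] _ Y])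
      (simp add: tensor_lift_pure[OF modM modM U g] h k bilinear_map_closed[OF act_bilin])
qed

text \<open>The identity is linear in each of \<open>X\<close>, \<open>X'\<close> and
  \<open>Y\<close> separately, so it reduces to pure tensors in three nested stages. It makes an
  inverse of \<open>R\<close> act as the inverse of the action of \<open>R\<close>.\<close>

lemma tensor_act_mult:
  assumes mult: "bilinear_map K H H H (\<otimes>\<^bsub>H\<^esub>)"
    and act_mult: "\<And>h k x. \<lbrakk>h \<in> carrier H; k \<in> carrier H; x \<in> carrier M\<rbrakk> \<Longrightarrow> act (h \<otimes>\<^bsub>H\<^esub> k) x = act h (act k x)"
    and X: "X \<in> carrier (tensor2 K H)" and X': "X' \<in> carrier (tensor2 K H)" and Y: "Y \<in> carrier (tensor2 K M)"
  shows "tensor_act K M act (X \<otimes>\<^bsub>tensor2 K H\<^esub> X') Y = tensor_act K M act X (tensor_act K M act X' Y)"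
proof -
  interpret T2: tensor_product_algebra K H H
    by (rule tensor_product_algebra.intro[OF tensor_product.intro[OF modH modH]
        tensor_product_algebra_axioms.intro[OF mult mult]])
  note l = bilinear_map_left[OF T2.tensor_mult_bilinear] bilinear_map_right[OF T2.tensor_mult_bilinear]
    bilinear_map_left[OF tensor_act_bilinear] bilinear_map_right[OF tensor_act_bilinear] linear_map_id
    bilinear_map_closed[OF tensor_act_bilinear] bilinear_map_closed[OF T2.tensor_mult_bilinear]
    pure_tensor_closed[OF modH modH] pure_tensor_closed[OF modM modM]
  show ?thesis
  proof (rule tensor_linear_eqI[OF modH modH mods(6) _ _ _ X])
    fix h k assume hk: "h \<in> carrier H" "k \<in> carrier H"
    show "tensor_act K M act (pure_tensor K H H h k \<otimes>\<^bsub>tensor2 K H\<^esub> X') Y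
        = tensor_act K M act (pure_tensor K H H h k) (tensor_act K M act X' Y)"
    proof (rule tensor_linear_eqI[OF modH modH mods(6) _ _ _ X'])
      fix h' k' assume hk': "h' \<in> carrier H" "k' \<in> carrier H"
      show "tensor_act K M act (pure_tensor K H H h k \<otimes>\<^bsub>tensor2 K H\<^esub> pure_tensor K H H h' k') Y
        = tensor_act K M act (pure_tensor K H H h k) (tensor_act K M act (pure_tensor K H H h' k') Y)"
      proof (rule tensor_linear_eqI[where f = "tensor_act K M act (pure_tensor K H H h k \<otimes>\<^bsub>tensor2 K H\<^esub> pure_tensor K H H h' k')"
            and g = "\<lambda>Y. tensor_act K M act (pure_tensor K H H h k) (tensor_act K M act (pure_tensor K H H h' k') Y)",
            OF modM modM mods(6) _ _ _ Y])
        show "tensor_act K M act (pure_tensor K H H h k \<otimes>\<^bsub>tensor2 K H\<^esub> pure_tensor K H H h' k') (pure_tensor K M M x y)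
          = tensor_act K M act (pure_tensor K H H h k) (tensor_act K M act (pure_tensor K H H h' k') (pure_tensor K M M x y))"
          if "x \<in> carrier M" "y \<in> carrier M" for x y
          using hk hk' that
          by (simp add: T2.tensor_mult_pure tensor_act_pure act_mult bilinear_map_closed[OF mult] bilinear_map_closed[OF act_bilin])
      qed (assumption | rule l hk hk')+
    qed (assumption | rule l hk Y)+
  qed (assumption | rule l X' Y)+
qed

lemma tensor_act_one:
  assumes one: "e \<in> carrier H" "\<And>x. x \<in> carrier M \<Longrightarrow> act e x = x" and Y: "Y \<in> carrier (tensor2 K M)"
  shows "tensor_act K M act (pure_tensor K H H e e) Y = Y"
  by (rule tensor_linear_eqI[where f = "tensor_act K M act (pure_tensor K H H e e)", OF modM modM mods(6) _ linear_map_id _ Y])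
    (simp_all add: tensor_act_pure one bilinear_map_right[OF tensor_act_bilinear _ linear_map_id] pure_tensor_closed modH)

end

section \<open>The counit and the R-matrix\<close>

context
  fixes K :: "('k, 'm) ring_scheme" and V :: "('k, 'v, 'p) module_scheme" and \<epsilon>
  assumes V: "module K V" and counit: "linear_map K V (scalars K) \<epsilon>"
begin

lemma counit_smult_linear:
  "linear_map K M V g \<Longrightarrow> v \<in> carrier V \<Longrightarrow> linear_map K M V (\<lambda>x. \<epsilon> (g x) \<odot>\<^bsub>V\<^esub> v)"
  and counit_smult_linear': "linear_map K M V g \<Longrightarrow> v \<in> carrier V \<Longrightarrow> linear_map K M V (\<lambda>x. \<epsilon> v \<odot>\<^bsub>V\<^esub> g x)"
  using linear_map_closed[OF counit]
  by (auto intro: linear_map_comp[OF linear_map_smult_left[OF V]] linear_map_comp[OF counit]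
      linear_map_comp[OF linear_map_smult_right[OF V]] simp: scalars_def)

lemma counit_bilinear:
  "bilinear_map K V V V (\<lambda>a b. \<epsilon> a \<odot>\<^bsub>V\<^esub> b)" "bilinear_map K V V V (\<lambda>a b. \<epsilon> b \<odot>\<^bsub>V\<^esub> a)"
  by (intro bilinear_mapI counit_smult_linear counit_smult_linear' linear_map_id; assumption)+

lemma cring_K: "cring K"
  using V by (rule module.axioms)

lemma smult_bilinear:
  "bilinear_map K (scalars K) V V (\<lambda>a v. a \<odot>\<^bsub>V\<^esub> v)" "bilinear_map K V (scalars K) V (\<lambda>v a. a \<odot>\<^bsub>V\<^esub> v)"
  by (intro bilinear_mapI linear_map_smult_left[OF V] linear_map_smult_right[OF V]; simp add: scalars_def)+

lemma counit_left_linear: "linear_map K (tensor2 K V) V (counit_left K V \<epsilon>)"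
  and counit_left_pure: "\<lbrakk>a \<in> carrier V; b \<in> carrier V\<rbrakk> \<Longrightarrow> counit_left K V \<epsilon> (pure_tensor K V V a b) = \<epsilon> a \<odot>\<^bsub>V\<^esub> b"
  and counit_right_linear: "linear_map K (tensor2 K V) V (counit_right K V \<epsilon>)"
  and counit_right_pure: "\<lbrakk>a \<in> carrier V; b \<in> carrier V\<rbrakk> \<Longrightarrow> counit_right K V \<epsilon> (pure_tensor K V V a b) = \<epsilon> b \<odot>\<^bsub>V\<^esub> a"
proof -
  note S = scalars_is_module[OF cring_K]
  note l = tensor_map_linear[OF V V S V counit linear_map_id] tensor_map_linear[OF V V V S linear_map_id counit]
  note p = tensor_map_pure[OF V V S V counit linear_map_id] tensor_map_pure[OF V V V S linear_map_id counit]
  note b = smult_bilinear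
  show "linear_map K (tensor2 K V) V (counit_left K V \<epsilon>)"
    unfolding counit_left_def unit_left_def
    by (rule linear_map_comp[OF tensor_lift_linear[OF S V V b(1)] l(1)])
  show "linear_map K (tensor2 K V) V (counit_right K V \<epsilon>)"
    unfolding counit_right_def unit_right_def
    by (rule linear_map_comp[OF tensor_lift_linear[OF V S V b(2)] l(2)])
  assume a: "a \<in> carrier V" and b': "b \<in> carrier V"
  show "counit_left K V \<epsilon> (pure_tensor K V V a b) = \<epsilon> a \<odot>\<^bsub>V\<^esub> b"
    unfolding counit_left_def unit_left_def p(1)[OF a b']
    by (rule tensor_lift_pure[OF S V V b(1) linear_map_closed[OF counit a] b'])
  show "counit_right K V \<epsilon> (pure_tensor K V V a b) = \<epsilon> b \<odot>\<^bsub>V\<^esub> a"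
    unfolding counit_right_def unit_right_def p(2)[OF a b']
    by (rule tensor_lift_pure[OF V S V b(2) a linear_map_closed[OF counit b']])
qed

text \<open>Replaces the detour through the tensor product with \<open>scalars K\<close> by a single
  Sweedler sum.\<close>

lemma counit_left_eq:
  assumes X: "X \<in> carrier (tensor2 K V)"
  shows "counit_left K V \<epsilon> X = tensor_lift V (\<lambda>a b. \<epsilon> a \<odot>\<^bsub>V\<^esub> b) X"
  by (rule tensor_linear_eqI[OF V V V counit_left_linear tensor_lift_linear[OF V V V counit_bilinear(1)] _ X])
    (simp add: counit_left_pure tensor_lift_pure[OF V V V counit_bilinear(1)])

end

context r_matrix
begin

lemmas counit_linear_rules = counit_smult_linear[OF mod_H counit_linear] counit_smult_linear'[OF mod_H counit_linear]

lemma smult_closed: "x \<in> carrier H \<Longrightarrow> y \<in> carrier H \<Longrightarrow> \<epsilon> x \<odot>\<^bsub>H\<^esub> y \<in> carrier H"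
  by (rule linear_map_closed[OF counit_linear_rules(2)[OF linear_map_id]])

sublocale A: tensor_square_action K H H "(\<otimes>\<^bsub>H\<^esub>)"
  by (rule tensor_square_action.intro[OF mod_H mod_H mult_bilinear])

text \<open>Associativity of H \<otimes> H is the action law \<open>tensor_act_mult\<close> for
  \<open>H\<close> acting on itself by left multiplication.\<close>

lemma tensor_mult_assoc:
  assumes "X \<in> carrier (tensor2 K H)" "Y \<in> carrier (tensor2 K H)" "Z \<in> carrier (tensor2 K H)"
  shows "(X \<otimes>\<^bsub>tensor2 K H\<^esub> Y) \<otimes>\<^bsub>tensor2 K H\<^esub> Z = X \<otimes>\<^bsub>tensor2 K H\<^esub> (Y \<otimes>\<^bsub>tensor2 K H\<^esub> Z)"
  using A.tensor_act_mult[OF mult_bilinear mult_assoc assms]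
  by (simp add: tensor_act_def assms bilinear_map_closed[OF T2.tensor_mult_bilinear] flip: T2.tensor_mult)

lemma tensor_mult_one_right:
  "X \<in> carrier (tensor2 K H) \<Longrightarrow> X \<otimes>\<^bsub>tensor2 K H\<^esub> pure_tensor K H H \<one>\<^bsub>H\<^esub> \<one>\<^bsub>H\<^esub> = X"
  by (rule tensor_linear_eqI[where g = "\<lambda>X. X", OF mod_H mod_H mods(2) _ linear_map_id])
    (simp_all add: T2.tensor_mult_pure one_closed mult_one_right
      bilinear_map_left[OF T2.tensor_mult_bilinear _ linear_map_id])

lemma tensor_mult_one_left:
  "X \<in> carrier (tensor2 K H) \<Longrightarrow> pure_tensor K H H \<one>\<^bsub>H\<^esub> \<one>\<^bsub>H\<^esub> \<otimes>\<^bsub>tensor2 K H\<^esub> X = X"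
  by (rule tensor_linear_eqI[where g = "\<lambda>X. X", OF mod_H mod_H mods(2) _ linear_map_id])
    (simp_all add: T2.tensor_mult_pure one_closed mult_one_left
      bilinear_map_right[OF T2.tensor_mult_bilinear _ linear_map_id])

lemma R_inverse:
  obtains R' where "R' \<in> carrier (tensor2 K H)"
    "R' \<otimes>\<^bsub>tensor2 K H\<^esub> R = pure_tensor K H H \<one>\<^bsub>H\<^esub> \<one>\<^bsub>H\<^esub>" "R \<otimes>\<^bsub>tensor2 K H\<^esub> R' = pure_tensor K H H \<one>\<^bsub>H\<^esub> \<one>\<^bsub>H\<^esub>"
proof -
  have "\<one>\<^bsub>tensor2 K H\<^esub> = pure_tensor K H H \<one>\<^bsub>H\<^esub> \<one>\<^bsub>H\<^esub>"
    by (simp add: tensor_def Let_def)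
  then show ?thesis
    using quasitriangular_hopf_algebra.R_invertible[OF quasitriangular] that by (auto simp: Units_def)
qed

lemma lift_counit_comult:
  "h \<in> carrier H \<Longrightarrow> tensor_lift H (\<lambda>a b. \<epsilon> a \<odot>\<^bsub>H\<^esub> b) (\<Delta> h) = h"
proof -
  interpret Q: quasitriangular_hopf_algebra K H \<Delta> \<epsilon> S R
    by (rule quasitriangular)
  show "h \<in> carrier H \<Longrightarrow> tensor_lift H (\<lambda>a b. \<epsilon> a \<odot>\<^bsub>H\<^esub> b) (\<Delta> h) = h"
    using Q.counit_l by (simp add: counit_left_eq[OF mod_H counit_linear] comult_closed)
qed

text \<open>
  Applying the counit to the first factor of \<open>(\<Delta> \<otimes> id) R = R\<^sub>1\<^sub>3 R\<^sub>2\<^sub>3\<close>, resp. to the middle factor of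
  \<open>(id \<otimes> \<Delta>) R = R\<^sub>1\<^sub>3 R\<^sub>1\<^sub>2\<close>, gives \<open>R = (1 \<otimes> u) R\<close>, resp. \<open>R = R (v \<otimes> 1)\<close>; now cancel \<open>R\<close>.
\<close>

lemma counit_R_left: "(\<Oplus>\<^bsub>H\<^esub>i\<in>I. \<epsilon> (s i) \<odot>\<^bsub>H\<^esub> t i) = \<one>\<^bsub>H\<^esub>" (is "?u = _")
proof -
  let ?T = "tensor2 K H" and ?p = "pure_tensor K H H"
  have u: "?u \<in> carrier H"
    by (intro module_finsum_closed[OF mod_H] smult_closed s_closed t_closed)
  note l = pure_linear counit_linear_rules linear_map_id smult_closed mod_H
  have F: "trilinear_map K H ?T (\<lambda>a b c. ?p (\<epsilon> a \<odot>\<^bsub>H\<^esub> b) c)"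
    by (rule trilinear_mapI) (assumption | rule l)+
  \<comment> \<open>The counit law at each \<open>s i\<close> shows that comultiplying the first leg
    and then applying \<epsilon> to its first component returns \<open>R\<close>.\<close>
  have "R = (\<Oplus>\<^bsub>?T\<^esub>i\<in>I. tensor_lift ?T (\<lambda>a b. ?p (\<epsilon> a \<odot>\<^bsub>H\<^esub> b) (t i)) (\<Delta> (s i)))"
    unfolding R_sum
  proof (rule module_finsum_cong[OF mods(2)])
    fix i assume i: "i \<in> I"
    have "?p (tensor_lift H (\<lambda>a b. \<epsilon> a \<odot>\<^bsub>H\<^esub> b) (\<Delta> (s i))) (t i)
        = tensor_lift ?T (\<lambda>a b. ?p (\<epsilon> a \<odot>\<^bsub>H\<^esub> b) (t i)) (\<Delta> (s i))"
      by (rule linear_map_tensor_lift[OF mod_H mod_H mod_H mods(2) pure_linear(1)[OF mod_H mod_H t_closed[OF i] linear_map_id]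
            counit_bilinear(1)[OF mod_H counit_linear] refl comult_closed[OF s_closed[OF i]]])
    then show "?p (s i) (t i) = tensor_lift ?T (\<lambda>a b. ?p (\<epsilon> a \<odot>\<^bsub>H\<^esub> b) (t i)) (\<Delta> (s i))"
      by (simp only: lift_counit_comult[OF s_closed[OF i]])
    then show "tensor_lift ?T (\<lambda>a b. ?p (\<epsilon> a \<odot>\<^bsub>H\<^esub> b) (t i)) (\<Delta> (s i)) \<in> carrier ?T"
      using pure_tensor_closed[OF mod_H mod_H s_closed[OF i] t_closed[OF i]] by simp
  qed
  also have "\<dots> = (\<Oplus>\<^bsub>?T\<^esub>i\<in>I. \<Oplus>\<^bsub>?T\<^esub>j\<in>I. ?p (\<epsilon> (s i) \<odot>\<^bsub>H\<^esub> s j) (t i \<otimes>\<^bsub>H\<^esub> t j))"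
    by (rule comult_left_R[OF mods(2) F])
  \<comment> \<open>The scalar \<open>\<epsilon> (s i)\<close> can be moved across the tensor sign
    to \<open>t i\<close>, so the sum over \<open>i\<close> assembles to \<open>?u\<close> on the
    left of \<open>t j\<close>. This is why a right inverse of \<open>R\<close> is cancelled
    below.\<close>
  also have "\<dots> = ?p \<one>\<^bsub>H\<^esub> ?u \<otimes>\<^bsub>?T\<^esub> R"
  proof -
    have "bilinear_map K H ?T ?T (\<lambda>x Y. ?p \<one>\<^bsub>H\<^esub> x \<otimes>\<^bsub>?T\<^esub> Y)"
      by (rule bilinear_mapI) (assumption | rule bilinear_map_left[OF T2.tensor_mult_bilinear]
        bilinear_map_right[OF T2.tensor_mult_bilinear] pure_linear mod_H linear_map_id one_closed pure_tensor_closed)+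
    then have "?p \<one>\<^bsub>H\<^esub> ?u \<otimes>\<^bsub>?T\<^esub> R = (\<Oplus>\<^bsub>?T\<^esub>i\<in>I. \<Oplus>\<^bsub>?T\<^esub>j\<in>I. ?p \<one>\<^bsub>H\<^esub> (\<epsilon> (s i) \<odot>\<^bsub>H\<^esub> t i) \<otimes>\<^bsub>?T\<^esub> ?p (s j) (t j))"
      unfolding R_sum by (rule bilinear_map_finsum[OF mod_H mods(2) mods(2) _ finite_I finite_I])
        (assumption | rule smult_closed s_closed t_closed pure_tensor_closed mod_H)+
    also have "\<dots> = (\<Oplus>\<^bsub>?T\<^esub>i\<in>I. \<Oplus>\<^bsub>?T\<^esub>j\<in>I. ?p (\<epsilon> (s i) \<odot>\<^bsub>H\<^esub> s j) (t i \<otimes>\<^bsub>H\<^esub> t j))"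
    proof (intro module_finsum_cong[OF mods(2)] module_finsum_closed[OF mods(2)])
      fix i j assume i: "i \<in> I" and j: "j \<in> I"
      have e: "\<epsilon> (s i) \<in> carrier K"
        using linear_map_closed[OF counit_linear s_closed[OF i]] by (simp add: scalars_def)
      have "?p \<one>\<^bsub>H\<^esub> (\<epsilon> (s i) \<odot>\<^bsub>H\<^esub> t i) \<otimes>\<^bsub>?T\<^esub> ?p (s j) (t j) = ?p (s j) ((\<epsilon> (s i) \<odot>\<^bsub>H\<^esub> t i) \<otimes>\<^bsub>H\<^esub> t j)"
        by (simp add: T2.tensor_mult_pure i j s_closed t_closed smult_closed one_closed mult_one_left)
      also have "\<dots> = ?p (s j) (\<epsilon> (s i) \<odot>\<^bsub>H\<^esub> (t i \<otimes>\<^bsub>H\<^esub> t j))"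
        by (simp only: linear_map_smult[OF mult_linear(1)[OF t_closed[OF j] linear_map_id] e t_closed[OF i]])
      also have "\<dots> = ?p (\<epsilon> (s i) \<odot>\<^bsub>H\<^esub> s j) (t i \<otimes>\<^bsub>H\<^esub> t j)"
        by (rule T2.pure_smult_right[OF e s_closed[OF j] mult_closed[OF t_closed[OF i] t_closed[OF j]]])
      finally show "?p \<one>\<^bsub>H\<^esub> (\<epsilon> (s i) \<odot>\<^bsub>H\<^esub> t i) \<otimes>\<^bsub>?T\<^esub> ?p (s j) (t j) = ?p (\<epsilon> (s i) \<odot>\<^bsub>H\<^esub> s j) (t i \<otimes>\<^bsub>H\<^esub> t j)" .
    qed (assumption | rule pure_tensor_closed mod_H smult_closed mult_closed s_closed t_closed)+
    finally show ?thesis by (rule sym)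
  qed
  finally have R: "?p \<one>\<^bsub>H\<^esub> ?u \<otimes>\<^bsub>?T\<^esub> R = R" by (rule sym)
  obtain R' where R': "R' \<in> carrier ?T" "R \<otimes>\<^bsub>?T\<^esub> R' = ?p \<one>\<^bsub>H\<^esub> \<one>\<^bsub>H\<^esub>"
    by (rule R_inverse)
  have pu: "?p \<one>\<^bsub>H\<^esub> ?u \<in> carrier ?T"
    by (intro pure_tensor_closed mod_H one_closed u)
  have "?p \<one>\<^bsub>H\<^esub> ?u = ?p \<one>\<^bsub>H\<^esub> \<one>\<^bsub>H\<^esub>"
    using tensor_mult_assoc[OF pu R_closed R'(1)] by (simp only: R R'(2) tensor_mult_one_right[OF pu])
  \<comment> \<open>Equality of the pure tensors with first factor 1 does not by itself compare the
    second factors; applying \<epsilon> to the first factor does, because \<epsilon> maps 1 to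
    1.\<close>
  then have "counit_left K H \<epsilon> (?p \<one>\<^bsub>H\<^esub> ?u) = counit_left K H \<epsilon> (?p \<one>\<^bsub>H\<^esub> \<one>\<^bsub>H\<^esub>)"
    by (rule arg_cong)
  then show ?thesis
    by (simp add: counit_left_pure[OF mod_H counit_linear] one_closed u counit_one module.smult_one[OF mod_H])
qed

lemma counit_R_right: "(\<Oplus>\<^bsub>H\<^esub>i\<in>I. \<epsilon> (t i) \<odot>\<^bsub>H\<^esub> s i) = \<one>\<^bsub>H\<^esub>" (is "?v = _")
proof -
  let ?T = "tensor2 K H" and ?p = "pure_tensor K H H"
  have v: "?v \<in> carrier H"
    by (intro module_finsum_closed[OF mod_H] smult_closed s_closed t_closed)
  note l = pure_linear counit_linear_rules linear_map_id smult_closed mod_H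
  have F: "trilinear_map K H ?T (\<lambda>a b c. ?p a (\<epsilon> b \<odot>\<^bsub>H\<^esub> c))"
    by (rule trilinear_mapI) (assumption | rule l)+
  have "R = (\<Oplus>\<^bsub>?T\<^esub>i\<in>I. tensor_lift ?T (\<lambda>b c. ?p (s i) (\<epsilon> b \<odot>\<^bsub>H\<^esub> c)) (\<Delta> (t i)))"
    unfolding R_sum
  proof (rule module_finsum_cong[OF mods(2)])
    fix i assume i: "i \<in> I"
    have "?p (s i) (tensor_lift H (\<lambda>a b. \<epsilon> a \<odot>\<^bsub>H\<^esub> b) (\<Delta> (t i)))
        = tensor_lift ?T (\<lambda>b c. ?p (s i) (\<epsilon> b \<odot>\<^bsub>H\<^esub> c)) (\<Delta> (t i))"
      by (rule linear_map_tensor_lift[OF mod_H mod_H mod_H mods(2) pure_linear(2)[OF mod_H mod_H s_closed[OF i] linear_map_id]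
            counit_bilinear(1)[OF mod_H counit_linear] refl comult_closed[OF t_closed[OF i]]])
    then show "?p (s i) (t i) = tensor_lift ?T (\<lambda>b c. ?p (s i) (\<epsilon> b \<odot>\<^bsub>H\<^esub> c)) (\<Delta> (t i))"
      by (simp only: lift_counit_comult[OF t_closed[OF i]])
    then show "tensor_lift ?T (\<lambda>b c. ?p (s i) (\<epsilon> b \<odot>\<^bsub>H\<^esub> c)) (\<Delta> (t i)) \<in> carrier ?T"
      using pure_tensor_closed[OF mod_H mod_H s_closed[OF i] t_closed[OF i]] by simp
  qed
  also have "\<dots> = (\<Oplus>\<^bsub>?T\<^esub>i\<in>I. \<Oplus>\<^bsub>?T\<^esub>j\<in>I. ?p (s i \<otimes>\<^bsub>H\<^esub> s j) (\<epsilon> (t j) \<odot>\<^bsub>H\<^esub> t i))"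
    by (rule comult_right_R[OF mods(2) F])
  \<comment> \<open>The scalar \<open>\<epsilon> (t j)\<close> belongs to \<open>s j\<close>, which
    stands to the right of \<open>s i\<close>. So \<open>?v\<close> appears on the right of
    \<open>R\<close>, and it is a left inverse that cancels.\<close>
  also have "\<dots> = R \<otimes>\<^bsub>?T\<^esub> ?p ?v \<one>\<^bsub>H\<^esub>"
  proof -
    have "bilinear_map K ?T H ?T (\<lambda>X y. X \<otimes>\<^bsub>?T\<^esub> ?p y \<one>\<^bsub>H\<^esub>)"
      by (rule bilinear_mapI) (assumption | rule bilinear_map_left[OF T2.tensor_mult_bilinear]
        bilinear_map_right[OF T2.tensor_mult_bilinear] pure_linear mod_H linear_map_id one_closed pure_tensor_closed)+
    then have "R \<otimes>\<^bsub>?T\<^esub> ?p ?v \<one>\<^bsub>H\<^esub> = (\<Oplus>\<^bsub>?T\<^esub>i\<in>I. \<Oplus>\<^bsub>?T\<^esub>j\<in>I. ?p (s i) (t i) \<otimes>\<^bsub>?T\<^esub> ?p (\<epsilon> (t j) \<odot>\<^bsub>H\<^esub> s j) \<one>\<^bsub>H\<^esub>)"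
      unfolding R_sum by (rule bilinear_map_finsum[OF mods(2) mod_H mods(2) _ finite_I finite_I])
        (assumption | rule smult_closed s_closed t_closed pure_tensor_closed mod_H)+
    also have "\<dots> = (\<Oplus>\<^bsub>?T\<^esub>i\<in>I. \<Oplus>\<^bsub>?T\<^esub>j\<in>I. ?p (s i \<otimes>\<^bsub>H\<^esub> s j) (\<epsilon> (t j) \<odot>\<^bsub>H\<^esub> t i))"
    proof (intro module_finsum_cong[OF mods(2)] module_finsum_closed[OF mods(2)])
      fix i j assume i: "i \<in> I" and j: "j \<in> I"
      have e: "\<epsilon> (t j) \<in> carrier K"
        using linear_map_closed[OF counit_linear t_closed[OF j]] by (simp add: scalars_def)
      have "?p (s i) (t i) \<otimes>\<^bsub>?T\<^esub> ?p (\<epsilon> (t j) \<odot>\<^bsub>H\<^esub> s j) \<one>\<^bsub>H\<^esub> = ?p (s i \<otimes>\<^bsub>H\<^esub> (\<epsilon> (t j) \<odot>\<^bsub>H\<^esub> s j)) (t i)"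
        by (simp add: T2.tensor_mult_pure i j s_closed t_closed smult_closed one_closed mult_one_right)
      also have "\<dots> = ?p (\<epsilon> (t j) \<odot>\<^bsub>H\<^esub> (s i \<otimes>\<^bsub>H\<^esub> s j)) (t i)"
        by (simp only: linear_map_smult[OF mult_linear(2)[OF s_closed[OF i] linear_map_id] e s_closed[OF j]])
      also have "\<dots> = ?p (s i \<otimes>\<^bsub>H\<^esub> s j) (\<epsilon> (t j) \<odot>\<^bsub>H\<^esub> t i)"
        by (rule T2.pure_smult_right[symmetric, OF e mult_closed[OF s_closed[OF i] s_closed[OF j]] t_closed[OF i]])
      finally show "?p (s i) (t i) \<otimes>\<^bsub>?T\<^esub> ?p (\<epsilon> (t j) \<odot>\<^bsub>H\<^esub> s j) \<one>\<^bsub>H\<^esub> = ?p (s i \<otimes>\<^bsub>H\<^esub> s j) (\<epsilon> (t j) \<odot>\<^bsub>H\<^esub> t i)" .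
    qed (assumption | rule pure_tensor_closed mod_H smult_closed mult_closed s_closed t_closed)+
    finally show ?thesis by (rule sym)
  qed
  finally have R: "R \<otimes>\<^bsub>?T\<^esub> ?p ?v \<one>\<^bsub>H\<^esub> = R" by (rule sym)
  obtain R' where R': "R' \<in> carrier ?T" "R' \<otimes>\<^bsub>?T\<^esub> R = ?p \<one>\<^bsub>H\<^esub> \<one>\<^bsub>H\<^esub>"
    by (rule R_inverse)
  have pv: "?p ?v \<one>\<^bsub>H\<^esub> \<in> carrier ?T"
    by (intro pure_tensor_closed mod_H one_closed v)
  have "?p ?v \<one>\<^bsub>H\<^esub> = ?p \<one>\<^bsub>H\<^esub> \<one>\<^bsub>H\<^esub>"
    using tensor_mult_assoc[OF R'(1) R_closed pv] by (simp only: R R'(2) tensor_mult_one_left[OF pv])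
  \<comment> \<open>As before, the factors are separated by a counit, this time applied to the
    second factor.\<close>
  then have "counit_right K H \<epsilon> (?p ?v \<one>\<^bsub>H\<^esub>) = counit_right K H \<epsilon> (?p \<one>\<^bsub>H\<^esub> \<one>\<^bsub>H\<^esub>)"
    by (rule arg_cong)
  then show ?thesis
    by (simp add: counit_right_pure[OF mod_H counit_linear] one_closed v counit_one module.smult_one[OF mod_H])
qed

end

section \<open>The braiding\<close>

lemma linear_map_finsum2:
  assumes "module K V" "module K W" "linear_map K V W f" "finite I" "finite J"
    and g: "\<And>i j. i \<in> I \<Longrightarrow> j \<in> J \<Longrightarrow> g i j \<in> carrier V"
  shows "f (\<Oplus>\<^bsub>V\<^esub>i\<in>I. \<Oplus>\<^bsub>V\<^esub>j\<in>J. g i j) = (\<Oplus>\<^bsub>W\<^esub>i\<in>I. \<Oplus>\<^bsub>W\<^esub>j\<in>J. f (g i j))"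
proof -
  have "f (\<Oplus>\<^bsub>V\<^esub>i\<in>I. \<Oplus>\<^bsub>V\<^esub>j\<in>J. g i j) = (\<Oplus>\<^bsub>W\<^esub>i\<in>I. f (\<Oplus>\<^bsub>V\<^esub>j\<in>J. g i j))"
    by (rule linear_map_finsum[OF assms(1-4)]) (intro module_finsum_closed[OF assms(1)] g)
  also have "\<dots> = (\<Oplus>\<^bsub>W\<^esub>i\<in>I. \<Oplus>\<^bsub>W\<^esub>j\<in>J. f (g i j))"
    by (rule module_finsum_cong[OF assms(2)], intro module_finsum_closed[OF assms(2)] linear_map_closed[OF assms(3)] g,
        assumption+, rule linear_map_finsum[OF assms(1-3,5) g])
  finally show ?thesis .
qed

locale r_matrix_action = r_matrix K H \<Delta> \<epsilon> S R I s t
  for K :: "('k, 'm) ring_scheme" and H :: "('k, 'h, 'p) module_scheme" and \<Delta> \<epsilon> S R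
    and I :: "'i set" and s t :: "'i \<Rightarrow> 'h" +
  fixes C :: "('k, 'c, 'q) module_scheme" and \<Delta>\<^sub>C \<epsilon>\<^sub>C act
  assumes module_coalgebra: "module_coalgebra K H \<Delta> \<epsilon> C \<Delta>\<^sub>C \<epsilon>\<^sub>C act"
begin

lemma coalgebra_C: "coalgebra K C \<Delta>\<^sub>C \<epsilon>\<^sub>C"
  and mod_C: "module K C"
  and act_bilinear: "bilinear_map K H C C act"
  and act_mult: "\<lbrakk>h \<in> carrier H; k \<in> carrier H; c \<in> carrier C\<rbrakk> \<Longrightarrow> act (h \<otimes>\<^bsub>H\<^esub> k) c = act h (act k c)"
  and act_one: "c \<in> carrier C \<Longrightarrow> act \<one>\<^bsub>H\<^esub> c = c"
  and comult_C_linear: "linear_map K C (tensor2 K C) \<Delta>\<^sub>C"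
  and counit_C_linear: "linear_map K C (scalars K) \<epsilon>\<^sub>C"
  and comult_act: "\<lbrakk>h \<in> carrier H; c \<in> carrier C\<rbrakk> \<Longrightarrow> \<Delta>\<^sub>C (act h c) = tensor_act K C act (\<Delta> h) (\<Delta>\<^sub>C c)"
  and counit_act: "\<lbrakk>h \<in> carrier H; c \<in> carrier C\<rbrakk> \<Longrightarrow> \<epsilon>\<^sub>C (act h c) = \<epsilon> h \<otimes>\<^bsub>K\<^esub> \<epsilon>\<^sub>C c"
proof -
  interpret M: module_coalgebra K H \<Delta> \<epsilon> C \<Delta>\<^sub>C \<epsilon>\<^sub>C act
    by (rule module_coalgebra)
  show "coalgebra K C \<Delta>\<^sub>C \<epsilon>\<^sub>C"
    by (rule M.C.coalgebra_axioms)
  then show "module K C" "linear_map K C (tensor2 K C) \<Delta>\<^sub>C" "linear_map K C (scalars K) \<epsilon>\<^sub>C"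
    by (simp_all add: coalgebra_def vector_space_over_def coalgebra_axioms_def)
  show "bilinear_map K H C C act"
    by (rule M.act_bilinear)
  show "act (h \<otimes>\<^bsub>H\<^esub> k) c = act h (act k c)" if "h \<in> carrier H" "k \<in> carrier H" "c \<in> carrier C"
    by (rule M.act_mult[OF that])
  show "act \<one>\<^bsub>H\<^esub> c = c" if "c \<in> carrier C"
    by (rule M.act_one[OF that])
  show "\<Delta>\<^sub>C (act h c) = tensor_act K C act (\<Delta> h) (\<Delta>\<^sub>C c)" "\<epsilon>\<^sub>C (act h c) = \<epsilon> h \<otimes>\<^bsub>K\<^esub> \<epsilon>\<^sub>C c"
    if "h \<in> carrier H" "c \<in> carrier C"
    unfolding tensor_act_def by (rule M.comult_act[OF that], rule M.counit_act[OF that])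
qed

lemmas act_closed = bilinear_map_closed[OF act_bilinear]
lemmas act_linear = bilinear_map_left[OF act_bilinear] bilinear_map_right[OF act_bilinear]
lemmas mods_C = tensor_mods[OF mod_C]
lemmas comult_C_closed = linear_map_closed[OF comult_C_linear]

sublocale AC: tensor_square_action K H C act
  by (rule tensor_square_action.intro[OF mod_H mod_C act_bilinear])

abbreviation "\<sigma> \<equiv> module_braiding K C act I s t"
abbreviation "pure2 \<equiv> pure_tensor K C C"
abbreviation "pure3 \<equiv> pure_tensor3 K C"
abbreviation "CC \<equiv> tensor2 K C"
abbreviation "CCC \<equiv> tensor3 K C"

lemmas pure2_closed = pure_tensor_closed[OF mod_C mod_C]
lemmas pure3_closed = pure_tensor3_closed[OF mod_C]
lemmas st_closed = s_closed t_closed act_closed mult_closed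

section \<open>Linearity and invertibility of the braiding\<close>

lemma braiding_bilinear:
  "bilinear_map K C C CC (\<lambda>x y. \<Oplus>\<^bsub>CC\<^esub>i\<in>I. pure2 (act (t i) y) (act (s i) x))"
  by (rule bilinear_mapI) (assumption | rule finsum_linear mods_C pure_linear act_linear st_closed linear_map_id)+

lemma braiding_linear: "linear_map K CC CC \<sigma>"
  unfolding module_braiding_def by (rule tensor_lift_linear[OF mod_C mod_C mods_C(2) braiding_bilinear])

lemma braiding_pure:
  "x \<in> carrier C \<Longrightarrow> y \<in> carrier C \<Longrightarrow> \<sigma> (pure2 x y) = (\<Oplus>\<^bsub>CC\<^esub>i\<in>I. pure2 (act (t i) y) (act (s i) x))"
  unfolding module_braiding_def by (rule tensor_lift_pure[OF mod_C mod_C mods_C(2) braiding_bilinear])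

lemma braiding_eq_flip_act:
  assumes X: "X \<in> carrier CC"
  shows "\<sigma> X = tensor_flip K C C (tensor_act K C act R X)"
proof (rule tensor_linear_eqI[OF mod_C mod_C mods_C(2) braiding_linear _ _ X])
  note fl = tensor_flip_linear[OF mod_C mod_C]
  show "linear_map K CC CC (\<lambda>X. tensor_flip K C C (tensor_act K C act R X))"
    by (rule linear_map_comp[OF fl bilinear_map_right[OF AC.tensor_act_bilinear R_closed linear_map_id]])
  fix x y assume x: "x \<in> carrier C" and y: "y \<in> carrier C"
  have l: "linear_map K (tensor2 K H) CC (\<lambda>R. tensor_flip K C C (tensor_act K C act R (pure2 x y)))"
    by (rule linear_map_comp[OF fl bilinear_map_left[OF AC.tensor_act_bilinear pure2_closed[OF x y] linear_map_id]])
  show "\<sigma> (pure2 x y) = tensor_flip K C C (tensor_act K C act R (pure2 x y))"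
    unfolding braiding_pure[OF x y]
    by (rule linear_R[OF mods_C(2) l, symmetric])
      (simp add: AC.tensor_act_pure tensor_flip_pure[OF mod_C mod_C] act_closed x y)
qed

lemma braiding_bij: "bij_betw \<sigma> (carrier CC) (carrier CC)"
proof -
  let ?f = "tensor_flip K C C" and ?a = "tensor_act K C act"
  obtain R' where R': "R' \<in> carrier (tensor2 K H)"
    "R' \<otimes>\<^bsub>tensor2 K H\<^esub> R = pure_tensor K H H \<one>\<^bsub>H\<^esub> \<one>\<^bsub>H\<^esub>" "R \<otimes>\<^bsub>tensor2 K H\<^esub> R' = pure_tensor K H H \<one>\<^bsub>H\<^esub> \<one>\<^bsub>H\<^esub>"
    by (rule R_inverse)
  note fl = tensor_flip_linear[OF mod_C mod_C]
  have flip2: "?f (?f X) = X" if X: "X \<in> carrier CC" for X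
    by (rule tensor_linear_eqI[where g = "\<lambda>X. X", OF mod_C mod_C mods_C(2) linear_map_comp[OF fl fl] linear_map_id _ X])
      (simp add: tensor_flip_pure[OF mod_C mod_C])
  note c = linear_map_closed[OF fl] bilinear_map_closed[OF AC.tensor_act_bilinear] R_closed R'(1)
  have inv: "?a R (?a R' X) = X" "?a R' (?a R X) = X" if "X \<in> carrier CC" for X
    using AC.tensor_act_mult[OF mult_bilinear act_mult R_closed R'(1) that]
      AC.tensor_act_mult[OF mult_bilinear act_mult R'(1) R_closed that]
      AC.tensor_act_one[OF one_closed act_one that]
    by (simp_all add: R')
  show ?thesis
    by (rule bij_betw_byWitness[where f' = "\<lambda>X. ?a R' (?f X)"])
      (auto simp: braiding_eq_flip_act c flip2 inv)
qed

section \<open>The braid relation\<close>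

lemma on_left_linear: "linear_map K CCC CCC (on_left K C \<sigma>)"
  unfolding on_left_def by (intro tensor_map_linear mods_C braiding_linear linear_map_id)

lemma on_right_linear: "linear_map K CCC CCC (on_right K C \<sigma>)"
  unfolding on_right_def
  by (intro linear_map_comp[OF assoc_left_linear[OF mod_C]] linear_map_comp[OF tensor_map_linear[OF _ _ _ _ linear_map_id braiding_linear]]
      mods_C assoc_right_linear[OF mod_C])

lemma on_left_pure3:
  assumes x: "x \<in> carrier C" and y: "y \<in> carrier C" and z: "z \<in> carrier C"
  shows "on_left K C \<sigma> (pure3 x y z) = (\<Oplus>\<^bsub>CCC\<^esub>i\<in>I. pure3 (act (t i) y) (act (s i) x) z)"
proof -
  have "on_left K C \<sigma> (pure3 x y z) = pure_tensor K CC C (\<sigma> (pure2 x y)) z"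
    unfolding on_left_def pure_tensor3_def
    by (rule tensor_map_pure) (intro mods_C braiding_linear linear_map_id pure2_closed x y z)+
  also have "\<dots> = (\<Oplus>\<^bsub>CCC\<^esub>i\<in>I. pure3 (act (t i) y) (act (s i) x) z)"
    unfolding braiding_pure[OF x y] pure_tensor3_def
    by (rule linear_map_finsum[OF mods_C(2,3) _ finite_I])
      (assumption | rule pure_linear mods_C z linear_map_id pure2_closed st_closed x y)+
  finally show ?thesis .
qed

lemma on_right_pure3:
  assumes x: "x \<in> carrier C" and y: "y \<in> carrier C" and z: "z \<in> carrier C"
  shows "on_right K C \<sigma> (pure3 x y z) = (\<Oplus>\<^bsub>CCC\<^esub>i\<in>I. pure3 x (act (t i) z) (act (s i) y))"
proof -
  have "on_right K C \<sigma> (pure3 x y z) = assoc_left K C (pure_tensor K C CC x (\<sigma> (pure2 y z)))"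
    unfolding on_right_def assoc_right_pure3[OF mod_C x y z]
    by (rule arg_cong[where f = "assoc_left K C"], rule tensor_map_pure)
      (intro mods_C braiding_linear linear_map_id pure2_closed x y z)+
  also have "\<dots> = (\<Oplus>\<^bsub>CCC\<^esub>i\<in>I. assoc_left K C (pure_tensor K C CC x (pure2 (act (t i) z) (act (s i) y))))"
    unfolding braiding_pure[OF y z]
    by (rule linear_map_finsum[OF mods_C(2,3) _ finite_I])
      (assumption | rule linear_map_comp[OF assoc_left_linear[OF mod_C]] pure_linear mods_C x linear_map_id pure2_closed st_closed y z)+
  also have "\<dots> = (\<Oplus>\<^bsub>CCC\<^esub>i\<in>I. pure3 x (act (t i) z) (act (s i) y))"
    by (rule module_finsum_cong[OF mods_C(3)])
      (simp_all add: assoc_left_pure3[OF mod_C] st_closed pure3_closed x y z)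
  finally show ?thesis .
qed

text \<open>
  On \<open>x \<otimes> y \<otimes> z\<close> the two sides are the two sides of the Yang-Baxter equation, evaluated at
  \<open>a \<otimes> b \<otimes> c \<mapsto> c \<cdot> z \<otimes> b \<cdot> y \<otimes> a \<cdot> x\<close>.
\<close>

lemma braid_relation:
  assumes X: "X \<in> carrier CCC"
  shows "on_left K C \<sigma> (on_right K C \<sigma> (on_left K C \<sigma> X)) = on_right K C \<sigma> (on_left K C \<sigma> (on_right K C \<sigma> X))"
proof (rule tensor3_linear_eqI[OF mod_C mods_C(3) _ _ _ X])
  note l = on_left_linear and r = on_right_linear
  show "linear_map K CCC CCC (\<lambda>X. on_left K C \<sigma> (on_right K C \<sigma> (on_left K C \<sigma> X)))"
    "linear_map K CCC CCC (\<lambda>X. on_right K C \<sigma> (on_left K C \<sigma> (on_right K C \<sigma> X)))"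
    by (rule linear_map_comp[OF l linear_map_comp[OF r l]], rule linear_map_comp[OF r linear_map_comp[OF l r]])
  fix x y z assume x: "x \<in> carrier C" and y: "y \<in> carrier C" and z: "z \<in> carrier C"
  note c = pure3_closed st_closed x y z
  define F where "F a b c = pure3 (act c z) (act b y) (act a x)" for a b c
  have F: "trilinear_map K H CCC F"
    unfolding F_def by (rule trilinear_mapI)
      (assumption | rule pure_tensor3_linear[OF mod_C] act_linear linear_map_id act_closed x y z)+
  have Fc: "F a b c \<in> carrier CCC" if "a \<in> carrier H" "b \<in> carrier H" "c \<in> carrier H" for a b c
    unfolding F_def by (intro c that)
  note sums = linear_map_finsum[OF mods_C(3,3) _ finite_I] linear_map_finsum2[OF mods_C(3,3) _ finite_I finite_I]
  note cong = module_finsum_cong[OF mods_C(3)] module_finsum_closed[OF mods_C(3)]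
  show "on_left K C \<sigma> (on_right K C \<sigma> (on_left K C \<sigma> (pure3 x y z)))
      = on_right K C \<sigma> (on_left K C \<sigma> (on_right K C \<sigma> (pure3 x y z)))"
  proof -
    have "on_left K C \<sigma> (on_right K C \<sigma> (on_left K C \<sigma> (pure3 x y z)))
      = on_left K C \<sigma> (\<Oplus>\<^bsub>CCC\<^esub>i\<in>I. on_right K C \<sigma> (pure3 (act (t i) y) (act (s i) x) z))"
      by (simp only: on_left_pure3[OF x y z]) (rule arg_cong[where f = "on_left K C \<sigma>"],
        rule sums(1)[OF on_right_linear], intro c)
    also have "\<dots> = on_left K C \<sigma> (\<Oplus>\<^bsub>CCC\<^esub>i\<in>I. \<Oplus>\<^bsub>CCC\<^esub>j\<in>I. pure3 (act (t i) y) (act (t j) z) (act (s j) (act (s i) x)))"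
      by (rule arg_cong[where f = "on_left K C \<sigma>"], rule cong(1))
        (assumption | rule cong(2) c on_right_pure3)+
    also have "\<dots> = (\<Oplus>\<^bsub>CCC\<^esub>i\<in>I. \<Oplus>\<^bsub>CCC\<^esub>j\<in>I. on_left K C \<sigma> (pure3 (act (t i) y) (act (t j) z) (act (s j) (act (s i) x))))"
      by (rule sums(2)[OF on_left_linear]) (assumption | rule c)+
    \<comment> \<open>The indices \<open>i\<close>, \<open>j\<close>, \<open>k\<close> number the
      crossings in the order in which they are applied; \<open>act_mult\<close> collects the two
      elements that have acted on each vector, the later one on the left.\<close>
    also have "\<dots> = (\<Oplus>\<^bsub>CCC\<^esub>i\<in>I. \<Oplus>\<^bsub>CCC\<^esub>j\<in>I. \<Oplus>\<^bsub>CCC\<^esub>k\<in>I. F (s j \<otimes>\<^bsub>H\<^esub> s i) (s k \<otimes>\<^bsub>H\<^esub> t i) (t k \<otimes>\<^bsub>H\<^esub> t j))"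
    proof (intro cong)
      fix i j assume i: "i \<in> I" and j: "j \<in> I"
      have "on_left K C \<sigma> (pure3 (act (t i) y) (act (t j) z) (act (s j) (act (s i) x)))
        = (\<Oplus>\<^bsub>CCC\<^esub>k\<in>I. pure3 (act (t k) (act (t j) z)) (act (s k) (act (t i) y)) (act (s j) (act (s i) x)))"
        by (rule on_left_pure3) (intro c i j)+
      also have "\<dots> = (\<Oplus>\<^bsub>CCC\<^esub>k\<in>I. F (s j \<otimes>\<^bsub>H\<^esub> s i) (s k \<otimes>\<^bsub>H\<^esub> t i) (t k \<otimes>\<^bsub>H\<^esub> t j))"
        by (rule cong(1)) (simp_all add: F_def act_mult c i j)
      finally show "on_left K C \<sigma> (pure3 (act (t i) y) (act (t j) z) (act (s j) (act (s i) x)))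
        = (\<Oplus>\<^bsub>CCC\<^esub>k\<in>I. F (s j \<otimes>\<^bsub>H\<^esub> s i) (s k \<otimes>\<^bsub>H\<^esub> t i) (t k \<otimes>\<^bsub>H\<^esub> t j))" .
    qed (assumption | rule Fc st_closed)+
    \<comment> \<open>In \<open>yang_baxter\<close> the outermost index belongs to the crossing
      applied last, so the nesting is reversed before its use and restored afterwards.\<close>
    also have "\<dots> = (\<Oplus>\<^bsub>CCC\<^esub>k\<in>I. \<Oplus>\<^bsub>CCC\<^esub>j\<in>I. \<Oplus>\<^bsub>CCC\<^esub>i\<in>I. F (s j \<otimes>\<^bsub>H\<^esub> s i) (s k \<otimes>\<^bsub>H\<^esub> t i) (t k \<otimes>\<^bsub>H\<^esub> t j))"
      by (rule module_finsum_reverse3[OF mods_C(3) finite_I]) (assumption | rule Fc st_closed)+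
    also have "\<dots> = (\<Oplus>\<^bsub>CCC\<^esub>k\<in>I. \<Oplus>\<^bsub>CCC\<^esub>j\<in>I. \<Oplus>\<^bsub>CCC\<^esub>i\<in>I. F (s k \<otimes>\<^bsub>H\<^esub> s j) (t k \<otimes>\<^bsub>H\<^esub> s i) (t j \<otimes>\<^bsub>H\<^esub> t i))"
      by (rule yang_baxter[OF mods_C(3) F, symmetric])
    also have "\<dots> = (\<Oplus>\<^bsub>CCC\<^esub>i\<in>I. \<Oplus>\<^bsub>CCC\<^esub>j\<in>I. \<Oplus>\<^bsub>CCC\<^esub>k\<in>I. F (s k \<otimes>\<^bsub>H\<^esub> s j) (t k \<otimes>\<^bsub>H\<^esub> s i) (t j \<otimes>\<^bsub>H\<^esub> t i))"
      by (rule module_finsum_reverse3[OF mods_C(3) finite_I]) (assumption | rule Fc st_closed)+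
    also have "\<dots> = (\<Oplus>\<^bsub>CCC\<^esub>i\<in>I. \<Oplus>\<^bsub>CCC\<^esub>j\<in>I. on_right K C \<sigma> (pure3 (act (t j) (act (t i) z)) (act (s j) x) (act (s i) y)))"
    proof (intro cong)
      fix i j assume i: "i \<in> I" and j: "j \<in> I"
      have "(\<Oplus>\<^bsub>CCC\<^esub>k\<in>I. F (s k \<otimes>\<^bsub>H\<^esub> s j) (t k \<otimes>\<^bsub>H\<^esub> s i) (t j \<otimes>\<^bsub>H\<^esub> t i))
        = (\<Oplus>\<^bsub>CCC\<^esub>k\<in>I. pure3 (act (t j) (act (t i) z)) (act (t k) (act (s i) y)) (act (s k) (act (s j) x)))"
        by (rule cong(1)) (simp_all add: F_def act_mult c i j)
      also have "\<dots> = on_right K C \<sigma> (pure3 (act (t j) (act (t i) z)) (act (s j) x) (act (s i) y))"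
        by (rule on_right_pure3[symmetric]) (intro c i j)+
      finally show "(\<Oplus>\<^bsub>CCC\<^esub>k\<in>I. F (s k \<otimes>\<^bsub>H\<^esub> s j) (t k \<otimes>\<^bsub>H\<^esub> s i) (t j \<otimes>\<^bsub>H\<^esub> t i))
        = on_right K C \<sigma> (pure3 (act (t j) (act (t i) z)) (act (s j) x) (act (s i) y))" .
    qed (assumption | rule linear_map_closed[OF on_right_linear] c)+
    also have "\<dots> = on_right K C \<sigma> (\<Oplus>\<^bsub>CCC\<^esub>i\<in>I. \<Oplus>\<^bsub>CCC\<^esub>j\<in>I. pure3 (act (t j) (act (t i) z)) (act (s j) x) (act (s i) y))"
      by (rule sums(2)[OF on_right_linear, symmetric]) (assumption | rule c)+
    also have "\<dots> = on_right K C \<sigma> (\<Oplus>\<^bsub>CCC\<^esub>i\<in>I. on_left K C \<sigma> (pure3 x (act (t i) z) (act (s i) y)))"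
      by (rule arg_cong[where f = "on_right K C \<sigma>"], rule cong(1)[symmetric])
        (assumption | rule cong(2) c on_left_pure3)+
    also have "\<dots> = on_right K C \<sigma> (on_left K C \<sigma> (on_right K C \<sigma> (pure3 x y z)))"
      by (simp only: on_right_pure3[OF x y z]) (rule arg_cong[where f = "on_right K C \<sigma>"],
        rule sums(1)[OF on_left_linear, symmetric], intro c)
    finally show ?thesis .
  qed
qed

section \<open>Compatibility of the braiding with the comultiplication of \<open>C\<close>\<close>

lemma comult_left_C_linear: "linear_map K CC CCC (comult_left K C \<Delta>\<^sub>C)"
  unfolding comult_left_def by (intro tensor_map_linear mods_C comult_C_linear linear_map_id)

lemma comult_left_C_pure:
  "x \<in> carrier C \<Longrightarrow> y \<in> carrier C \<Longrightarrow> comult_left K C \<Delta>\<^sub>C (pure2 x y) = pure_tensor K CC C (\<Delta>\<^sub>C x) y"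
  unfolding comult_left_def by (rule tensor_map_pure) (assumption | rule mods_C comult_C_linear linear_map_id)+

lemma comult_right_C_linear: "linear_map K CC CCC (comult_right K C \<Delta>\<^sub>C)"
  unfolding comult_right_def
  by (intro linear_map_comp[OF assoc_left_linear[OF mod_C]] tensor_map_linear mods_C comult_C_linear linear_map_id)

lemma comult_right_C_pure:
  assumes x: "x \<in> carrier C" and y: "y \<in> carrier C"
  shows "comult_right K C \<Delta>\<^sub>C (pure2 x y) = tensor_lift CCC (\<lambda>y1 y2. pure3 x y1 y2) (\<Delta>\<^sub>C y)"
proof -
  have "comult_right K C \<Delta>\<^sub>C (pure2 x y) = assoc_left K C (pure_tensor K C CC x (\<Delta>\<^sub>C y))"
    unfolding comult_right_def
    by (rule arg_cong[where f = "assoc_left K C"], rule tensor_map_pure)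
      (intro mods_C comult_C_linear linear_map_id x y)+
  then show ?thesis
    by (simp only: assoc_left_pure[OF mod_C x comult_C_closed[OF y]])
qed

lemma pure3_lift_bilinear:
  "z \<in> carrier C \<Longrightarrow> bilinear_map K C C CCC (\<lambda>x y. pure3 x y z)"
  "z \<in> carrier C \<Longrightarrow> bilinear_map K C C CCC (\<lambda>x y. pure3 z x y)"
  by (rule bilinear_mapI; (assumption | rule pure_tensor3_linear[OF mod_C] linear_map_id)+)+

text \<open>Presents X \<otimes> z as a Sweedler sum, so that \<open>tensor_lift_act\<close> applies
  when \<open>X\<close> is the result of an action.\<close>

lemma pure_tensor_eq_lift:
  assumes X: "X \<in> carrier CC" and z: "z \<in> carrier C"
  shows "pure_tensor K CC C X z = tensor_lift CCC (\<lambda>x y. pure3 x y z) X"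
  by (rule tensor_linear_eqI[where f = "\<lambda>X. pure_tensor K CC C X z",
        OF mod_C mod_C mods_C(3) pure_linear(1)[OF mods_C(2) mod_C z linear_map_id]
          tensor_lift_linear[OF mod_C mod_C mods_C(3) pure3_lift_bilinear(1)[OF z]] _ X])
    (subst tensor_lift_pure[OF mod_C mod_C mods_C(3) pure3_lift_bilinear(1)[OF z]]; simp add: pure_tensor3_def)

lemma act_pure3_bilinear:
  assumes "a \<in> carrier H" "b \<in> carrier H" "z \<in> carrier C"
  shows "bilinear_map K C C CCC (\<lambda>x y. pure3 (act a x) (act b y) z)"
    and "bilinear_map K C C CCC (\<lambda>x y. pure3 z (act a x) (act b y))"
  by (rule bilinear_mapI; (assumption | rule pure_tensor3_linear[OF mod_C] act_linear act_closed assms linear_map_id)+)+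

text \<open>On x \<otimes> y the two sides are the two sides of \<open>comult_left_R\<close> at the
  map \<open>F\<close> sending (a, b, d) to the Sweedler sum of the d y \<otimes> a x1 \<otimes> b
  x2. On the left, \<open>y\<close> crosses x2 and then x1; on the right, the module-coalgebra law
  lets \<Delta> (s i) act on the comultiplied \<open>x\<close>.\<close>

lemma comult_left_braid:
  assumes X: "X \<in> carrier CC"
  shows "on_left K C \<sigma> (on_right K C \<sigma> (comult_left K C \<Delta>\<^sub>C X)) = comult_right K C \<Delta>\<^sub>C (\<sigma> X)"
proof (rule tensor_linear_eqI[OF mod_C mod_C mods_C(3) _ _ _ X])
  let ?L = "on_left K C \<sigma>" and ?R = "on_right K C \<sigma>"
  note lr = linear_map_comp[OF on_left_linear linear_map_comp[OF on_right_linear]]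
  show "linear_map K CC CCC (\<lambda>X. ?L (?R (comult_left K C \<Delta>\<^sub>C X)))"
    "linear_map K CC CCC (\<lambda>X. comult_right K C \<Delta>\<^sub>C (\<sigma> X))"
    by (rule lr[OF comult_left_C_linear], rule linear_map_comp[OF comult_right_C_linear braiding_linear])
  fix x y assume x: "x \<in> carrier C" and y: "y \<in> carrier C"
  note c = pure3_closed st_closed x y
  note cong = module_finsum_cong[OF mods_C(3)] module_finsum_closed[OF mods_C(3)]
  define F where "F a b d = tensor_lift CCC (\<lambda>x1 x2. pure3 (act d y) (act a x1) (act b x2)) (\<Delta>\<^sub>C x)" for a b d
  have F: "trilinear_map K H CCC F"
    unfolding F_def by (rule trilinear_mapI)
      (assumption | rule tensor_lift_linear_param[OF mod_C mod_C mods_C(3) mod_H comult_C_closed[OF x]]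
        act_pure3_bilinear pure_tensor3_linear[OF mod_C] act_linear linear_map_id act_closed y)+
  have Fc: "F a b d \<in> carrier CCC" if "a \<in> carrier H" "b \<in> carrier H" "d \<in> carrier H" for a b d
    unfolding F_def
    by (rule tensor_lift_closed[OF mod_C mod_C mods_C(3) act_pure3_bilinear(2) comult_C_closed[OF x]]) (intro that c)+
  \<comment> \<open>Stated for arbitrary \<open>X\<close> in place of the comultiplied
    \<open>x\<close>, so that it can be checked on pure tensors.\<close>
  have left: "?L (?R (pure_tensor K CC C X y)) = (\<Oplus>\<^bsub>CCC\<^esub>i\<in>I. \<Oplus>\<^bsub>CCC\<^esub>j\<in>I.
      tensor_lift CCC (\<lambda>x1 x2. pure3 (act (t j \<otimes>\<^bsub>H\<^esub> t i) y) (act (s j) x1) (act (s i) x2)) X)"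
    if X: "X \<in> carrier CC" for X
  proof (rule tensor_linear_eqI[where f = "\<lambda>X. ?L (?R (pure_tensor K CC C X y))", OF mod_C mod_C mods_C(3) _ _ _ X])
    note b = act_pure3_bilinear(2)
    show "linear_map K CC CCC (\<lambda>X. ?L (?R (pure_tensor K CC C X y)))"
      by (rule lr[OF pure_linear(1)[OF mods_C(2) mod_C y linear_map_id]])
    show "linear_map K CC CCC (\<lambda>X. \<Oplus>\<^bsub>CCC\<^esub>i\<in>I. \<Oplus>\<^bsub>CCC\<^esub>j\<in>I.
      tensor_lift CCC (\<lambda>x1 x2. pure3 (act (t j \<otimes>\<^bsub>H\<^esub> t i) y) (act (s j) x1) (act (s i) x2)) X)"
      by (assumption | rule finsum_linear mods_C tensor_lift_linear b st_closed y)+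
    fix x1 x2 assume x1: "x1 \<in> carrier C" and x2: "x2 \<in> carrier C"
    have "?L (?R (pure_tensor K CC C (pure2 x1 x2) y))
        = ?L (\<Oplus>\<^bsub>CCC\<^esub>i\<in>I. pure3 x1 (act (t i) y) (act (s i) x2))"
      using on_right_pure3[OF x1 x2 y] by (simp add: pure_tensor3_def)
    also have "\<dots> = (\<Oplus>\<^bsub>CCC\<^esub>i\<in>I. ?L (pure3 x1 (act (t i) y) (act (s i) x2)))"
      by (rule linear_map_finsum[OF mods_C(3,3) on_left_linear finite_I]) (intro c x1 x2)
    also have "\<dots> = (\<Oplus>\<^bsub>CCC\<^esub>i\<in>I. \<Oplus>\<^bsub>CCC\<^esub>j\<in>I. pure3 (act (t j) (act (t i) y)) (act (s j) x1) (act (s i) x2))"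
      by (rule cong(1)) (assumption | rule cong(2) c x1 x2 on_left_pure3)+
    also have "\<dots> = (\<Oplus>\<^bsub>CCC\<^esub>i\<in>I. \<Oplus>\<^bsub>CCC\<^esub>j\<in>I.
      tensor_lift CCC (\<lambda>x1 x2. pure3 (act (t j \<otimes>\<^bsub>H\<^esub> t i) y) (act (s j) x1) (act (s i) x2)) (pure2 x1 x2))"
      by (intro cong) (simp_all add: tensor_lift_pure[OF mod_C mod_C mods_C(3) b] c x1 x2 act_mult)
    finally show "?L (?R (pure_tensor K CC C (pure2 x1 x2) y)) = \<dots>" .
  qed
  have "?L (?R (comult_left K C \<Delta>\<^sub>C (pure2 x y))) = (\<Oplus>\<^bsub>CCC\<^esub>i\<in>I. \<Oplus>\<^bsub>CCC\<^esub>j\<in>I. F (s j) (s i) (t j \<otimes>\<^bsub>H\<^esub> t i))"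
    unfolding comult_left_C_pure[OF x y] left[OF comult_C_closed[OF x]] F_def ..
  \<comment> \<open>Only the names of the indices change: in the hexagon identity the outer index
    belongs to the first slot, which here is the second crossing.\<close>
  also have "\<dots> = (\<Oplus>\<^bsub>CCC\<^esub>i\<in>I. \<Oplus>\<^bsub>CCC\<^esub>j\<in>I. F (s i) (s j) (t i \<otimes>\<^bsub>H\<^esub> t j))"
    by (rule module_finsum_swap[OF mods_C(3) finite_I finite_I]) (intro Fc st_closed)
  also have "\<dots> = (\<Oplus>\<^bsub>CCC\<^esub>i\<in>I. tensor_lift CCC (\<lambda>a b. F a b (t i)) (\<Delta> (s i)))"
    by (rule comult_left_R[OF mods_C(3) F, symmetric])
  also have "\<dots> = (\<Oplus>\<^bsub>CCC\<^esub>i\<in>I. comult_right K C \<Delta>\<^sub>C (pure2 (act (t i) y) (act (s i) x)))"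
  proof (rule cong(1))
    fix i assume i: "i \<in> I"
    show "comult_right K C \<Delta>\<^sub>C (pure2 (act (t i) y) (act (s i) x)) \<in> carrier CCC"
      by (intro linear_map_closed[OF comult_right_C_linear] pure2_closed c i)
    have "comult_right K C \<Delta>\<^sub>C (pure2 (act (t i) y) (act (s i) x))
        = tensor_lift CCC (\<lambda>y1 y2. pure3 (act (t i) y) y1 y2) (tensor_act K C act (\<Delta> (s i)) (\<Delta>\<^sub>C x))"
      by (simp add: comult_right_C_pure comult_act c i)
    also have "\<dots> = tensor_lift CCC (\<lambda>a b. F a b (t i)) (\<Delta> (s i))"
      unfolding F_def
      by (rule AC.tensor_lift_act[OF mods_C(3) pure3_lift_bilinear(2)]) (intro c i comult_closed comult_C_closed)+
    finally show "tensor_lift CCC (\<lambda>a b. F a b (t i)) (\<Delta> (s i)) = comult_right K C \<Delta>\<^sub>C (pure2 (act (t i) y) (act (s i) x))"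
      by (rule sym)
  qed
  also have "\<dots> = comult_right K C \<Delta>\<^sub>C (\<sigma> (pure2 x y))"
    unfolding braiding_pure[OF x y]
    by (rule linear_map_finsum[OF mods_C(2,3) comult_right_C_linear finite_I, symmetric]) (intro pure2_closed c)
  finally show "?L (?R (comult_left K C \<Delta>\<^sub>C (pure2 x y))) = comult_right K C \<Delta>\<^sub>C (\<sigma> (pure2 x y))" .
qed

text \<open>The mirror image, from \<open>comult_right_R\<close> at the map \<open>F\<close> sending
  (a, b, d) to the Sweedler sum of the b y1 \<otimes> d y2 \<otimes> a x. Now \<open>x\<close>
  crosses y1 and then y2, so two factors \<open>s\<close> accumulate on \<open>x\<close>, and
  \<Delta> (t i) acts on the comultiplied \<open>y\<close>.\<close>

lemma comult_right_braid:
  assumes X: "X \<in> carrier CC"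
  shows "on_right K C \<sigma> (on_left K C \<sigma> (comult_right K C \<Delta>\<^sub>C X)) = comult_left K C \<Delta>\<^sub>C (\<sigma> X)"
proof (rule tensor_linear_eqI[OF mod_C mod_C mods_C(3) _ _ _ X])
  let ?L = "on_left K C \<sigma>" and ?R = "on_right K C \<sigma>"
  note rl = linear_map_comp[OF on_right_linear linear_map_comp[OF on_left_linear]]
  show "linear_map K CC CCC (\<lambda>X. ?R (?L (comult_right K C \<Delta>\<^sub>C X)))"
    "linear_map K CC CCC (\<lambda>X. comult_left K C \<Delta>\<^sub>C (\<sigma> X))"
    by (rule rl[OF comult_right_C_linear], rule linear_map_comp[OF comult_left_C_linear braiding_linear])
  fix x y assume x: "x \<in> carrier C" and y: "y \<in> carrier C"
  note c = pure3_closed st_closed x y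
  note cong = module_finsum_cong[OF mods_C(3)] module_finsum_closed[OF mods_C(3)]
  define F where "F a b d = tensor_lift CCC (\<lambda>y1 y2. pure3 (act b y1) (act d y2) (act a x)) (\<Delta>\<^sub>C y)" for a b d
  have F: "trilinear_map K H CCC F"
    unfolding F_def by (rule trilinear_mapI)
      (assumption | rule tensor_lift_linear_param[OF mod_C mod_C mods_C(3) mod_H comult_C_closed[OF y]]
        act_pure3_bilinear pure_tensor3_linear[OF mod_C] act_linear linear_map_id act_closed x)+
  have Fc: "F a b d \<in> carrier CCC" if "a \<in> carrier H" "b \<in> carrier H" "d \<in> carrier H" for a b d
    unfolding F_def
    by (rule tensor_lift_closed[OF mod_C mod_C mods_C(3) act_pure3_bilinear(1) comult_C_closed[OF y]]) (intro that c)+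
  have right: "?R (?L (tensor_lift CCC (\<lambda>y1 y2. pure3 x y1 y2) Y)) = (\<Oplus>\<^bsub>CCC\<^esub>i\<in>I. \<Oplus>\<^bsub>CCC\<^esub>j\<in>I.
      tensor_lift CCC (\<lambda>y1 y2. pure3 (act (t i) y1) (act (t j) y2) (act (s j \<otimes>\<^bsub>H\<^esub> s i) x)) Y)"
    if Y: "Y \<in> carrier CC" for Y
  proof (rule tensor_linear_eqI[where f = "\<lambda>Y. ?R (?L (tensor_lift CCC (\<lambda>y1 y2. pure3 x y1 y2) Y))",
        OF mod_C mod_C mods_C(3) _ _ _ Y])
    note b = act_pure3_bilinear(1)
    show "linear_map K CC CCC (\<lambda>Y. ?R (?L (tensor_lift CCC (\<lambda>y1 y2. pure3 x y1 y2) Y)))"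
      by (rule rl[OF tensor_lift_linear[OF mod_C mod_C mods_C(3) pure3_lift_bilinear(2)[OF x]]])
    show "linear_map K CC CCC (\<lambda>Y. \<Oplus>\<^bsub>CCC\<^esub>i\<in>I. \<Oplus>\<^bsub>CCC\<^esub>j\<in>I.
      tensor_lift CCC (\<lambda>y1 y2. pure3 (act (t i) y1) (act (t j) y2) (act (s j \<otimes>\<^bsub>H\<^esub> s i) x)) Y)"
      by (assumption | rule finsum_linear mods_C tensor_lift_linear b st_closed x)+
    fix y1 y2 assume y1: "y1 \<in> carrier C" and y2: "y2 \<in> carrier C"
    have "?R (?L (tensor_lift CCC (\<lambda>y1 y2. pure3 x y1 y2) (pure2 y1 y2)))
        = ?R (\<Oplus>\<^bsub>CCC\<^esub>i\<in>I. pure3 (act (t i) y1) (act (s i) x) y2)"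
      by (simp only: tensor_lift_pure[OF mod_C mod_C mods_C(3) pure3_lift_bilinear(2)[OF x] y1 y2] on_left_pure3[OF x y1 y2])
    also have "\<dots> = (\<Oplus>\<^bsub>CCC\<^esub>i\<in>I. ?R (pure3 (act (t i) y1) (act (s i) x) y2))"
      by (rule linear_map_finsum[OF mods_C(3,3) on_right_linear finite_I]) (intro c y1 y2)
    also have "\<dots> = (\<Oplus>\<^bsub>CCC\<^esub>i\<in>I. \<Oplus>\<^bsub>CCC\<^esub>j\<in>I. pure3 (act (t i) y1) (act (t j) y2) (act (s j) (act (s i) x)))"
      by (rule cong(1)) (assumption | rule cong(2) c y1 y2 on_right_pure3)+
    also have "\<dots> = (\<Oplus>\<^bsub>CCC\<^esub>i\<in>I. \<Oplus>\<^bsub>CCC\<^esub>j\<in>I.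
      tensor_lift CCC (\<lambda>y1 y2. pure3 (act (t i) y1) (act (t j) y2) (act (s j \<otimes>\<^bsub>H\<^esub> s i) x)) (pure2 y1 y2))"
      by (intro cong) (simp_all add: tensor_lift_pure[OF mod_C mod_C mods_C(3) b] c y1 y2 act_mult)
    finally show "?R (?L (tensor_lift CCC (\<lambda>y1 y2. pure3 x y1 y2) (pure2 y1 y2))) = \<dots>" .
  qed
  have "?R (?L (comult_right K C \<Delta>\<^sub>C (pure2 x y))) = (\<Oplus>\<^bsub>CCC\<^esub>i\<in>I. \<Oplus>\<^bsub>CCC\<^esub>j\<in>I. F (s j \<otimes>\<^bsub>H\<^esub> s i) (t i) (t j))"
    unfolding comult_right_C_pure[OF x y] right[OF comult_C_closed[OF y]] F_def ..
  \<comment> \<open>The exchange of the sums matches \<open>comult_right_R\<close>, where the outer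
    index supplies the left factor \<open>s\<close> and the last slot.\<close>
  also have "\<dots> = (\<Oplus>\<^bsub>CCC\<^esub>i\<in>I. \<Oplus>\<^bsub>CCC\<^esub>j\<in>I. F (s i \<otimes>\<^bsub>H\<^esub> s j) (t j) (t i))"
    by (rule module_finsum_swap[OF mods_C(3) finite_I finite_I]) (intro Fc st_closed)
  also have "\<dots> = (\<Oplus>\<^bsub>CCC\<^esub>i\<in>I. tensor_lift CCC (\<lambda>b d. F (s i) b d) (\<Delta> (t i)))"
    by (rule comult_right_R[OF mods_C(3) F, symmetric])
  also have "\<dots> = (\<Oplus>\<^bsub>CCC\<^esub>i\<in>I. comult_left K C \<Delta>\<^sub>C (pure2 (act (t i) y) (act (s i) x)))"
  proof (rule cong(1))
    fix i assume i: "i \<in> I"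
    show "comult_left K C \<Delta>\<^sub>C (pure2 (act (t i) y) (act (s i) x)) \<in> carrier CCC"
      by (intro linear_map_closed[OF comult_left_C_linear] pure2_closed c i)
    have "comult_left K C \<Delta>\<^sub>C (pure2 (act (t i) y) (act (s i) x))
        = pure_tensor K CC C (tensor_act K C act (\<Delta> (t i)) (\<Delta>\<^sub>C y)) (act (s i) x)"
      by (simp add: comult_left_C_pure comult_act c i)
    also have "\<dots> = tensor_lift CCC (\<lambda>y1 y2. pure3 y1 y2 (act (s i) x)) (tensor_act K C act (\<Delta> (t i)) (\<Delta>\<^sub>C y))"
      by (rule pure_tensor_eq_lift)
        (intro bilinear_map_closed[OF AC.tensor_act_bilinear] comult_closed comult_C_closed c i)+
    also have "\<dots> = tensor_lift CCC (\<lambda>b d. F (s i) b d) (\<Delta> (t i))"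
      unfolding F_def
      by (rule AC.tensor_lift_act[OF mods_C(3) pure3_lift_bilinear(1)]) (intro c i comult_closed comult_C_closed)+
    finally show "tensor_lift CCC (\<lambda>b d. F (s i) b d) (\<Delta> (t i)) = comult_left K C \<Delta>\<^sub>C (pure2 (act (t i) y) (act (s i) x))"
      by (rule sym)
  qed
  also have "\<dots> = comult_left K C \<Delta>\<^sub>C (\<sigma> (pure2 x y))"
    unfolding braiding_pure[OF x y]
    by (rule linear_map_finsum[OF mods_C(2,3) comult_left_C_linear finite_I, symmetric]) (intro pure2_closed c)
  finally show "?R (?L (comult_right K C \<Delta>\<^sub>C (pure2 x y))) = comult_left K C \<Delta>\<^sub>C (\<sigma> (pure2 x y))" .
qed

section \<open>Compatibility of the braiding with the counit of \<open>C\<close>\<close>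

lemma counit_act_sum:
  assumes f: "\<And>i. i \<in> I \<Longrightarrow> f i \<in> carrier H" and g: "\<And>i. i \<in> I \<Longrightarrow> g i \<in> carrier H"
    and one: "(\<Oplus>\<^bsub>H\<^esub>i\<in>I. \<epsilon> (f i) \<odot>\<^bsub>H\<^esub> g i) = \<one>\<^bsub>H\<^esub>"
    and x: "x \<in> carrier C" and y: "y \<in> carrier C"
  shows "(\<Oplus>\<^bsub>C\<^esub>i\<in>I. \<epsilon>\<^sub>C (act (f i) x) \<odot>\<^bsub>C\<^esub> act (g i) y) = \<epsilon>\<^sub>C x \<odot>\<^bsub>C\<^esub> y"
proof -
  interpret C: module K C by (rule mod_C)
  have e: "\<epsilon> h \<in> carrier K" if "h \<in> carrier H" for h
    using linear_map_closed[OF counit_linear that] by (simp add: scalars_def)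
  have k: "\<epsilon>\<^sub>C x \<in> carrier K"
    using linear_map_closed[OF counit_C_linear x] by (simp add: scalars_def)
  have l: "linear_map K H C (\<lambda>h. \<epsilon>\<^sub>C x \<odot>\<^bsub>C\<^esub> act h y)"
    by (rule linear_map_comp[OF linear_map_smult_right[OF mod_C k] act_linear(1)[OF y linear_map_id]])
  \<comment> \<open>Multiplicativity of the counit under the action turns the sum into the scalar
    \<open>\<epsilon>\<^sub>C x\<close> times the action of the hypothesis \<open>one\<close> on
    \<open>y\<close>. Keeping \<open>f\<close> and \<open>g\<close> general serves both legs of
    \<open>R\<close>.\<close>
  have "\<epsilon>\<^sub>C x \<odot>\<^bsub>C\<^esub> y = \<epsilon>\<^sub>C x \<odot>\<^bsub>C\<^esub> act (\<Oplus>\<^bsub>H\<^esub>i\<in>I. \<epsilon> (f i) \<odot>\<^bsub>H\<^esub> g i) y"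
    by (simp only: one act_one[OF y])
  also have "\<dots> = (\<Oplus>\<^bsub>C\<^esub>i\<in>I. \<epsilon>\<^sub>C x \<odot>\<^bsub>C\<^esub> act (\<epsilon> (f i) \<odot>\<^bsub>H\<^esub> g i) y)"
    by (rule linear_map_finsum[OF mod_H mod_C l finite_I]) (intro smult_closed f g)
  also have "\<dots> = (\<Oplus>\<^bsub>C\<^esub>i\<in>I. \<epsilon>\<^sub>C (act (f i) x) \<odot>\<^bsub>C\<^esub> act (g i) y)"
    by (rule module_finsum_cong[OF mod_C])
      (simp_all add: counit_act f g x y k e act_closed linear_map_smult[OF l] C.smult_assoc1)
  finally show ?thesis by (rule sym)
qed

text \<open>After the crossing the counit of \<open>C\<close> falls on \<open>s i\<close> acting on
  \<open>x\<close>, so \<open>counit_R_left\<close> decides; in \<open>counit_left_braid\<close> it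
  falls on \<open>t i\<close> acting on \<open>y\<close>, which calls for
  \<open>counit_R_right\<close>.\<close>

lemma counit_right_braid:
  assumes X: "X \<in> carrier CC"
  shows "counit_right K C \<epsilon>\<^sub>C (\<sigma> X) = counit_left K C \<epsilon>\<^sub>C X"
proof (rule tensor_linear_eqI[OF mod_C mod_C mod_C _ counit_left_linear[OF mod_C counit_C_linear] _ X])
  note r = counit_right_linear[OF mod_C counit_C_linear]
  show "linear_map K CC C (\<lambda>X. counit_right K C \<epsilon>\<^sub>C (\<sigma> X))"
    by (rule linear_map_comp[OF r braiding_linear])
  fix x y assume x: "x \<in> carrier C" and y: "y \<in> carrier C"
  have "counit_right K C \<epsilon>\<^sub>C (\<sigma> (pure2 x y)) = (\<Oplus>\<^bsub>C\<^esub>i\<in>I. counit_right K C \<epsilon>\<^sub>C (pure2 (act (t i) y) (act (s i) x)))"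
    unfolding braiding_pure[OF x y]
    by (rule linear_map_finsum[OF mods_C(2) mod_C r finite_I]) (intro pure2_closed st_closed x y)
  also have "\<dots> = (\<Oplus>\<^bsub>C\<^esub>i\<in>I. \<epsilon>\<^sub>C (act (s i) x) \<odot>\<^bsub>C\<^esub> act (t i) y)"
    by (rule module_finsum_cong[OF mod_C])
      (assumption | rule counit_right_pure[OF mod_C counit_C_linear] st_closed x y
        linear_map_closed[OF counit_smult_linear[OF mod_C counit_C_linear linear_map_id]])+
  also have "\<dots> = \<epsilon>\<^sub>C x \<odot>\<^bsub>C\<^esub> y"
    by (rule counit_act_sum[OF s_closed t_closed counit_R_left x y])
  finally show "counit_right K C \<epsilon>\<^sub>C (\<sigma> (pure2 x y)) = counit_left K C \<epsilon>\<^sub>C (pure2 x y)"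
    by (simp only: counit_left_pure[OF mod_C counit_C_linear x y])
qed

lemma counit_left_braid:
  assumes X: "X \<in> carrier CC"
  shows "counit_left K C \<epsilon>\<^sub>C (\<sigma> X) = counit_right K C \<epsilon>\<^sub>C X"
proof (rule tensor_linear_eqI[OF mod_C mod_C mod_C _ counit_right_linear[OF mod_C counit_C_linear] _ X])
  note l = counit_left_linear[OF mod_C counit_C_linear]
  show "linear_map K CC C (\<lambda>X. counit_left K C \<epsilon>\<^sub>C (\<sigma> X))"
    by (rule linear_map_comp[OF l braiding_linear])
  fix x y assume x: "x \<in> carrier C" and y: "y \<in> carrier C"
  have "counit_left K C \<epsilon>\<^sub>C (\<sigma> (pure2 x y)) = (\<Oplus>\<^bsub>C\<^esub>i\<in>I. counit_left K C \<epsilon>\<^sub>C (pure2 (act (t i) y) (act (s i) x)))"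
    unfolding braiding_pure[OF x y]
    by (rule linear_map_finsum[OF mods_C(2) mod_C l finite_I]) (intro pure2_closed st_closed x y)
  also have "\<dots> = (\<Oplus>\<^bsub>C\<^esub>i\<in>I. \<epsilon>\<^sub>C (act (t i) y) \<odot>\<^bsub>C\<^esub> act (s i) x)"
    by (rule module_finsum_cong[OF mod_C])
      (assumption | rule counit_left_pure[OF mod_C counit_C_linear] st_closed x y
        linear_map_closed[OF counit_smult_linear[OF mod_C counit_C_linear linear_map_id]])+
  also have "\<dots> = \<epsilon>\<^sub>C y \<odot>\<^bsub>C\<^esub> x"
    by (rule counit_act_sum[OF t_closed s_closed counit_R_right y x])
  finally show "counit_left K C \<epsilon>\<^sub>C (\<sigma> (pure2 x y)) = counit_right K C \<epsilon>\<^sub>C (pure2 x y)"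
    by (simp only: counit_right_pure[OF mod_C counit_C_linear x y])
qed

end

theorem theorem2p8:
  fixes K :: "'k ring" and H :: "('k, 'h) module" and C :: "('k, 'c) module"
    and I :: "'i set" and s t :: "'i \<Rightarrow> 'h"
  assumes "field K"
    and "\<And>n::nat. n > 0 \<Longrightarrow> [n] \<cdot>\<^bsub>K\<^esub> \<one>\<^bsub>K\<^esub> \<noteq> \<zero>\<^bsub>K\<^esub>"
    and "quasitriangular_hopf_algebra K H \<Delta>\<^sub>H \<epsilon>\<^sub>H S R"
    and "finite I" and "s \<in> I \<rightarrow> carrier H" and "t \<in> I \<rightarrow> carrier H"
    and "R = (\<Oplus>\<^bsub>tensor2 K H\<^esub>i\<in>I. pure_tensor K H H (s i) (t i))"
    and "module_coalgebra K H \<Delta>\<^sub>H \<epsilon>\<^sub>H C \<Delta>\<^sub>C \<epsilon>\<^sub>C act"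
  shows "braided_coalgebra K C \<Delta>\<^sub>C \<epsilon>\<^sub>C (module_braiding K C act I s t)"
proof -
  have "r_matrix K H \<Delta>\<^sub>H \<epsilon>\<^sub>H S R I s t"
    using assms(3-7) by (intro r_matrix.intro) auto
  then interpret r_matrix_action K H \<Delta>\<^sub>H \<epsilon>\<^sub>H S R I s t C \<Delta>\<^sub>C \<epsilon>\<^sub>C act
    using assms(8) by (intro r_matrix_action.intro r_matrix_action_axioms.intro)
  show ?thesis
    by (intro braided_coalgebra.intro braided_coalgebra_axioms.intro braiding.intro braiding_axioms.intro
        coalgebra.axioms(1)[OF coalgebra_C] coalgebra_C braiding_linear braiding_bij braid_relation
        comult_left_braid comult_right_braid counit_right_braid counit_left_braid)
qed

end
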